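(* Let $n\ge 2$, let $\mathfrak g$ be a first-class $n$-Lie superalgebra over a field $\mathbb K$ and let $V$ be a graded $\mathfrak g$-module. Then the coboundary operator $\delta: C^m(\mathfrak g,V)\to C^{m+1}(\mathfrak g,V)$ ($m\ge 0$) defined in the context satisfies $\delta^2 f=0$ for all $f\in C^m(\mathfrak g,V)$ and all $m\ge 0$.
   Context: Conventions: whenever $|x|$ appears, $x$ is homogeneous of degree $|x|\in\mathbb Z_2$; a hat means that the entry is omitted; formulas are given on homogeneous elements and extended multilinearly. A first-class $n$-Lie superalgebra (i.e. an $n$-Lie superalgebra of parity $0$) is a $\mathbb Z_2$-graded vector space $\mathfrak g=\mathfrak g_{\bar 0}\oplus\mathfrak g_{\bar 1}$ with an $n$-linear bracket $[\ ,\cdots,\ ]$ such that $|[x_1,\cdots,x_n]|=|x_1|+\cdots+|x_n|$; $[x_1,\cdots,x_i,x_{i+1},\cdots,x_n]=-(-1)^{|x_i||x_{i+1}|}[x_1,\cdots,x_{i+1},x_i,\cdots,x_n]$; and $$[x_1,\cdots,x_{n-1},[y_1,\cdots,y_n]]=\sum_{i=1}^n(-1)^{(|x_1|+\cdots+|x_{n-1}|)(|y_1|+\cdots+|y_{i-1}|)}[y_1,\cdots,[x_1,\cdots,x_{n-1},y_i],\cdots,y_n].$$ Exterior powers are taken in the super sense ($x\wedge y=-(-1)^{|x||y|}y\wedge x$). A fundamental object is $\mathscr X=x_1\wedge\cdots\wedge x_{n-1}\in\mathfrak g^{\wedge^{n-1}}$, with $|\mathscr X|=|x_1|+\cdots+|x_{n-1}|$;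 put $\mathscr X\cdot z:=[x_1,\cdots,x_{n-1},z]$ for $z\in\mathfrak g$, and for $\mathscr Y=y_1\wedge\cdots\wedge y_{n-1}$ put $$\mathscr X\cdot\mathscr Y=\sum_{i=1}^{n-1}(-1)^{|\mathscr X|(|y_1|+\cdots+|y_{i-1}|)}y_1\wedge\cdots\wedge\mathscr X\cdot y_i\wedge\cdots\wedge y_{n-1}\in\mathfrak g^{\wedge^{n-1}}.$$ A graded representation of $\mathfrak g$ on a $\mathbb Z_2$-graded vector space $V$ (making $V$ a graded $\mathfrak g$-module) is a linear map $\rho:\mathfrak g^{\wedge^{n-1}}\to\mathrm{End}(V)$, $\rho(\mathscr X)=\rho(x_1,\cdots,x_{n-1})$, with $\rho(\mathscr X)V_\alpha\subseteq V_{\alpha+|\mathscr X|}$, $\rho(\mathscr X)\rho(\mathscr Y)=\rho(\mathscr X\cdot\mathscr Y)+(-1)^{|\mathscr X||\mathscr Y|}\rho(\mathscr Y)\rho(\mathscr X)$, and $$\rho(x_1,\cdots,x_{n-2},[y_1,\cdots,y_n])=\sum_{i=1}^n(-1)^{n-i}(-1)^{(|x_1|+\cdots+|x_{n-2}|)(|y_1|+\cdots+\widehat{|y_i|}+\cdots+|y_n|)}(-1)^{|y_i|(|y_{i+1}|+\cdots+|y_n|)}\rho(y_1,\cdots,\widehat{y_i},\cdots,y_n)\rho(x_1,\cdots,x_{n-2},y_i).$$ Write $\mathscr X\cdot v=[x_1,\cdots,x_{n-1},v]:=\rho(\mathscr X)v$, and define brackets with one entry $v\in V$ in another position by the super-skew-symmetry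 rule above. For $m\ge0$, $C^m(\mathfrak g,V)=\mathrm{Hom}(\underbrace{\mathfrak g^{\wedge^{n-1}}\otimes\cdots\otimes\mathfrak g^{\wedge^{n-1}}}_m\wedge\mathfrak g,V)$, that is, linear maps $f(\mathscr X_1,\cdots,\mathscr X_m,z)$ which are super-skew-symmetric in the $n$ entries of $\mathscr X_m\wedge z$ (for $m=0$: $\mathrm{Hom}(\mathfrak g,V)$); it is $\mathbb Z_2$-graded by the degree $|f|$ of maps. The coboundary operator is, for $\mathscr X_i=\mathscr X_i^1\wedge\cdots\wedge\mathscr X_i^{n-1}$ and $z\in\mathfrak g$, $$\begin{aligned}(\delta f)(\mathscr X_1,\cdots,\mathscr X_{m+1},z)=&\sum_{i<j}(-1)^i(-1)^{|\mathscr X_i|(|\mathscr X_{i+1}|+\cdots+|\mathscr X_{j-1}|)}f(\mathscr X_1,\cdots,\widehat{\mathscr X_i},\cdots,\mathscr X_i\cdot\mathscr X_j,\cdots,\mathscr X_{m+1},z)\\&+\sum_{i=1}^{m+1}(-1)^i(-1)^{|\mathscr X_i|(|\mathscr X_{i+1}|+\cdots+|\mathscr X_{m+1}|)}f(\mathscr X_1,\cdots,\widehat{\mathscr X_i},\cdots,\mathscr X_{m+1},\mathscr X_i\cdot z)\\&+\sum_{i=1}^{m+1}(-1)^{i+1}(-1)^{|\mathscr X_i|(|f|+|\mathscr X_1|+\cdots+|\mathscr X_{i-1}|)}\mathscr X_i\cdot f(\mathscr X_1,\cdots,\widehat{\mathscr X_i},\cdots,\mathscr X_{m+1},z)\\&+(-1)^m(f(\mathscr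 X_1,\cdots,\mathscr X_m,\ )\cdot\mathscr X_{m+1})\cdot z,\end{aligned}$$ where $$(f(\mathscr X_1,\cdots,\mathscr X_m,\ )\cdot\mathscr X_{m+1})\cdot z=\sum_{i=1}^{n-1}(-1)^{(|f|+|\mathscr X_1|+\cdots+|\mathscr X_m|)(|\mathscr X_{m+1}^1|+\cdots+|\mathscr X_{m+1}^{i-1}|)}[\mathscr X_{m+1}^1,\cdots,f(\mathscr X_1,\cdots,\mathscr X_m,\mathscr X_{m+1}^i),\cdots,\mathscr X_{m+1}^{n-1},z].$$ *)

theory Defs
  imports Complex_Main "HOL-Library.Z2"
begin

text \<open>
  Degrees live in the two-element field \<^typ>\<open>bit\<close>, so degree formulas are computed modulo 2.
  The sign $(-1)^p$ acts on any abelian group; exponents coming from positions are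
  injected with \<^const>\<open>of_nat\<close>.
\<close>

definition sgn2 :: "bit \<Rightarrow> 'w::ab_group_add \<Rightarrow> 'w" where
  "sgn2 p w = (if p = 0 then w else - w)"

definition omit :: "nat \<Rightarrow> 'b list \<Rightarrow> 'b list" where
  "omit i xs = take i xs @ drop (Suc i) xs"

definition multilinear ::
  "('k::field \<Rightarrow> 'a::ab_group_add \<Rightarrow> 'a) \<Rightarrow> ('k \<Rightarrow> 'w::ab_group_add \<Rightarrow> 'w)
    \<Rightarrow> nat \<Rightarrow> ('a list \<Rightarrow> 'w) \<Rightarrow> bool" where
  "multilinear s t N \<phi> \<longleftrightarrow>
     (\<forall>xs i. length xs = N \<longrightarrow> i < N \<longrightarrow> Vector_Spaces.linear s t (\<lambda>x. \<phi> (xs[i := x])))"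

locale graded_space = vector_space scale
  for scale :: "'k::field \<Rightarrow> 'a::ab_group_add \<Rightarrow> 'a" +
  fixes H :: "bit \<Rightarrow> 'a set"
  assumes subspace_H: "subspace (H a)"
    and direct_sum: "\<exists>!p. fst p \<in> H 0 \<and> snd p \<in> H 1 \<and> x = fst p + snd p"
begin

definition homogeneous :: "'a \<Rightarrow> bool" where
  "homogeneous x \<longleftrightarrow> (\<exists>a. x \<in> H a)"

text \<open>
  The degree of a nonzero homogeneous element.  The vector 0, which lies in both summands, gets
  degree 0; this choice is harmless because every formula below is additive in each entry.
\<close>

definition deg :: "'a \<Rightarrow> bit" where
  "deg x = (if x \<in> H 0 then 0 else 1)"

definition degs :: "'a list \<Rightarrow> bit" where
  "degs xs = (\<Sum>x\<leftarrow>xs. deg x)"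

definition part :: "bit \<Rightarrow> 'a \<Rightarrow> 'a" where
  "part a x = (THE y. y \<in> H a \<and> x - y \<in> H (a + 1))"

definition super_skew :: "nat \<Rightarrow> ('a list \<Rightarrow> 'w::ab_group_add) \<Rightarrow> bool" where
  "super_skew N \<phi> \<longleftrightarrow>
     (\<forall>xs i. length xs = N \<longrightarrow> list_all homogeneous xs \<longrightarrow> Suc i < N \<longrightarrow>
        \<phi> xs = - sgn2 (deg (xs ! i) * deg (xs ! Suc i))
                   (\<phi> (xs[i := xs ! Suc i, Suc i := xs ! i])))"

text \<open>
  The homogeneous components of a vector, and those of a tuple and of a tuple of tuples obtained by
  choosing a component of every entry.  Summing a formula over them is the multilinear extension of
  that formula from homogeneous entries to all entries.
\<close>

definition comps1 :: "'a \<Rightarrow> 'a list" where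
  "comps1 x = [part 0 x, part 1 x]"

definition comps2 :: "'a list \<Rightarrow> 'a list list" where
  "comps2 xs = product_lists (map comps1 xs)"

definition comps3 :: "'a list list \<Rightarrow> 'a list list list" where
  "comps3 Xs = product_lists (map comps2 Xs)"

end

text \<open>
  The bracket takes the list of its \<open>n\<close> arguments; its values on lists of other lengths are
  irrelevant.
\<close>

locale n_Lie_superalgebra = graded_space sg G
  for sg :: "'k::field \<Rightarrow> 'g::ab_group_add \<Rightarrow> 'g" and G :: "bit \<Rightarrow> 'g set" +
  fixes n :: nat and br :: "'g list \<Rightarrow> 'g"
  assumes br_multilinear: "multilinear sg sg n br"
    and br_degree: "length xs = n \<Longrightarrow> list_all homogeneous xs \<Longrightarrow> br xs \<in> G (degs xs)"
    and br_super_skew: "super_skew n br"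
    and br_Jacobi:
      "length X = n - 1 \<Longrightarrow> list_all homogeneous X \<Longrightarrow> length Y = n \<Longrightarrow> list_all homogeneous Y \<Longrightarrow>
       br (X @ [br Y]) =
         (\<Sum>i<n. sgn2 (degs X * degs (take i Y)) (br (Y[i := br (X @ [Y ! i])])))"
begin

text \<open>
  A list \<open>X\<close> of length \<open>n - 1\<close> stands for the fundamental object that is the wedge of its entries.
  By the universal property, a linear map out of the super exterior power is a multilinear
  super-skew map of \<open>n - 1\<close> arguments.  The element $X \cdot Y$ of the exterior power is given by
  the list of its signed decomposable summands, and \<open>lin_ext \<phi>\<close> evaluates the linear map induced by
  \<open>\<phi>\<close> on such a sum.
\<close>

definition act :: "'g list \<Rightarrow> 'g \<Rightarrow> 'g" where
  "act X z = br (X @ [z])"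

definition act_fo :: "'g list \<Rightarrow> 'g list \<Rightarrow> (bit \<times> 'g list) list" where
  "act_fo X Y =
     map (\<lambda>i. (degs X * degs (take i Y), Y[i := act X (Y ! i)])) [0..<length Y]"

definition lin_ext :: "('g list \<Rightarrow> 'w::ab_group_add) \<Rightarrow> (bit \<times> 'g list) list \<Rightarrow> 'w" where
  "lin_ext \<phi> cs = (\<Sum>(p, Z)\<leftarrow>cs. sgn2 p (\<phi> Z))"

text \<open>Arguments \<open>(X\<^sub>1, \<dots>, X\<^sub>m, z)\<close> of an \<open>m\<close>-cochain are given as a list \<open>Xs\<close> of lists and \<open>z\<close>.\<close>

definition fo_list :: "nat \<Rightarrow> 'g list list \<Rightarrow> bool" where
  "fo_list m Xs \<longleftrightarrow> length Xs = m \<and> (\<forall>X\<in>set Xs. length X = n - 1)"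

end

locale graded_module =
  n_Lie_superalgebra sg G n br + V: graded_space sv V
  for sg :: "'k::field \<Rightarrow> 'g::ab_group_add \<Rightarrow> 'g" and G :: "bit \<Rightarrow> 'g set"
    and n :: nat and br :: "'g list \<Rightarrow> 'g"
    and sv :: "'k \<Rightarrow> 'v::ab_group_add \<Rightarrow> 'v" and V :: "bit \<Rightarrow> 'v set" +
  fixes \<rho> :: "'g list \<Rightarrow> 'v \<Rightarrow> 'v"
  assumes rho_linear: "length X = n - 1 \<Longrightarrow> Vector_Spaces.linear sv sv (\<rho> X)"
    and rho_multilinear: "multilinear sg sv (n - 1) (\<lambda>X. \<rho> X v)"
    and rho_super_skew: "super_skew (n - 1) (\<lambda>X. \<rho> X v)"
    and rho_degree:
      "length X = n - 1 \<Longrightarrow> list_all homogeneous X \<Longrightarrow> v \<in> V a \<Longrightarrow> \<rho> X v \<in> V (a + degs X)"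
    and rho_commutator:
      "length X = n - 1 \<Longrightarrow> list_all homogeneous X \<Longrightarrow> length Y = n - 1 \<Longrightarrow> list_all homogeneous Y \<Longrightarrow>
       \<rho> X (\<rho> Y v) =
         lin_ext (\<lambda>Z. \<rho> Z v) (act_fo X Y) + sgn2 (degs X * degs Y) (\<rho> Y (\<rho> X v))"
    and rho_bracket:
      "length xs = n - 2 \<Longrightarrow> list_all homogeneous xs \<Longrightarrow> length Y = n \<Longrightarrow> list_all homogeneous Y \<Longrightarrow>
       \<rho> (xs @ [br Y]) v =
         (\<Sum>i<n. sgn2 (of_nat (n - Suc i) + degs xs * degs (omit i Y)
                        + deg (Y ! i) * degs (drop (Suc i) Y))
                   (\<rho> (omit i Y) (\<rho> (xs @ [Y ! i]) v)))"
begin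

text \<open>
  \<open>mixed_br ys v zs\<close> is the bracket with entries \<open>ys\<close>, then \<open>v\<close> in \<open>V\<close>, then \<open>zs\<close>: the entry \<open>v\<close>
  is moved to the last position by successive super-skew transpositions.
\<close>

primrec mixed_br :: "'g list \<Rightarrow> 'v \<Rightarrow> 'g list \<Rightarrow> 'v" where
  "mixed_br ys v [] = \<rho> ys v"
| "mixed_br ys v (z # zs) = - sgn2 (V.deg v * deg z) (mixed_br (ys @ [z]) v zs)"

text \<open>
  Maps are normalised to 0 on argument lists of the wrong shape, so that equality in the cochain
  space is equality of functions.
\<close>

definition cochains :: "nat \<Rightarrow> ('g list list \<Rightarrow> 'g \<Rightarrow> 'v) set" where
  "cochains m = {f.
     (\<forall>Xs z. \<not> fo_list m Xs \<longrightarrow> f Xs z = 0) \<and>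
     (\<forall>Xs. fo_list m Xs \<longrightarrow> Vector_Spaces.linear sg sv (f Xs)) \<and>
     (\<forall>Xs z i. fo_list m Xs \<longrightarrow> i < m \<longrightarrow>
        multilinear sg sv (n - 1) (\<lambda>X. f (Xs[i := X]) z) \<and>
        super_skew (n - 1) (\<lambda>X. f (Xs[i := X]) z)) \<and>
     (\<forall>Xs. fo_list m Xs \<longrightarrow> 0 < m \<longrightarrow>
        super_skew n (\<lambda>W. f (Xs[m - 1 := butlast W]) (last W)))}"

text \<open>The component of degree \<open>a\<close> of a cochain \<open>f\<close>.\<close>

definition cochain_part ::
  "bit \<Rightarrow> ('g list list \<Rightarrow> 'g \<Rightarrow> 'v) \<Rightarrow> 'g list list \<Rightarrow> 'g \<Rightarrow> 'v" where
  "cochain_part a f Xs z =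
     (\<Sum>Ys\<leftarrow>comps3 Xs. \<Sum>y\<leftarrow>comps1 z.
        V.part (a + (\<Sum>Y\<leftarrow>Ys. degs Y) + deg y) (f Ys y))"

text \<open>
  The coboundary formula for an \<open>m\<close>-cochain \<open>f\<close> of degree \<open>a\<close> and homogeneous entries.  Positions
  are counted from 0 here, so the position signs of the usual 1-based formula are shifted by one.
\<close>

definition coboundary_hom ::
  "bit \<Rightarrow> nat \<Rightarrow> ('g list list \<Rightarrow> 'g \<Rightarrow> 'v) \<Rightarrow> 'g list list \<Rightarrow> 'g \<Rightarrow> 'v" where
  "coboundary_hom a m f Xs z =
     (\<Sum>j\<le>m. \<Sum>i<j.
        sgn2 (of_nat (Suc i) + degs (Xs ! i) * (\<Sum>k\<in>{i<..<j}. degs (Xs ! k)))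
          (lin_ext (\<lambda>Z. f (omit i (Xs[j := Z])) z) (act_fo (Xs ! i) (Xs ! j))))
   + (\<Sum>i\<le>m.
        sgn2 (of_nat (Suc i) + degs (Xs ! i) * (\<Sum>k\<in>{i<..m}. degs (Xs ! k)))
          (f (omit i Xs) (act (Xs ! i) z)))
   + (\<Sum>i\<le>m.
        sgn2 (of_nat i + degs (Xs ! i) * (a + (\<Sum>k<i. degs (Xs ! k))))
          (\<rho> (Xs ! i) (f (omit i Xs) z)))
   + sgn2 (of_nat m)
       (\<Sum>i<n - 1.
          sgn2 ((a + (\<Sum>k<m. degs (Xs ! k))) * degs (take i (Xs ! m)))
            (mixed_br (take i (Xs ! m)) (f (take m Xs) (Xs ! m ! i)) (drop (Suc i) (Xs ! m) @ [z])))"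

definition coboundary ::
  "nat \<Rightarrow> ('g list list \<Rightarrow> 'g \<Rightarrow> 'v) \<Rightarrow> 'g list list \<Rightarrow> 'g \<Rightarrow> 'v" where
  "coboundary m f Xs z =
     (if fo_list (Suc m) Xs
      then \<Sum>a\<in>{0, 1}. \<Sum>Ys\<leftarrow>comps3 Xs. \<Sum>y\<leftarrow>comps1 z. coboundary_hom a m (cochain_part a f) Ys y
      else 0)"

end

end

theory Submission
  imports Defs
begin

text \<open>
  Fix all arguments of a cochain except the last vector: what remains is a map \<open>\<phi>\<close> from \<open>\<gg>\<close> to \<open>V\<close>.
  In the coboundary formula such a map occurs in two ways.  A fundamental object \<open>X\<close> acts on it by
  the commutator \<open>\<theta>\<^sub>X \<phi> = [X, \<phi>]\<close>, and its failure to be a derivation of the bracket,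
  \<open>\<Sum>\<^sub>i [w\<^sub>1, \<dots>, \<phi> w\<^sub>i, \<dots>, w\<^sub>n] - \<phi> [w\<^sub>1, \<dots>, w\<^sub>n]\<close> with the appropriate signs, is the sum, up
  to a common sign, of the terms of the formula in which the last fundamental object is combined
  with \<open>z\<close> or with values of \<open>f\<close>.  The coboundary of a 0-cochain is exactly
  this defect, and for more arguments it satisfies the recursion
  \<open>(\<delta> f)(X, \<dots>) = \<theta>\<^sub>X f - \<delta> (f (X, \<dots>))\<close>, where \<open>\<theta>\<^sub>X\<close> now acts on the value of \<open>f\<close> and on all its
  arguments (\<open>coboundary_hom_Cons\<close>, \<open>coboundary_hom_0\<close>).  This is the complex of the Leibniz
  algebra of fundamental objects with coefficients in the maps from \<open>\<gg>\<close> to \<open>V\<close>.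

  By the recursion \<open>\<delta>\<^sup>2 = 0\<close> follows by induction on the number of arguments (\<open>cob_cob\<close>), provided
  that \<open>\<theta>\<^sub>X\<close> commutes with \<open>\<delta>\<close> (\<open>cob_theta\<close>).  Three facts are behind this.  The operators \<open>\<theta>\<^sub>X\<close>
  satisfy the commutation relation of the fundamental objects (\<open>theta_commute\<close>), which is the
  fundamental identity of the bracket together with the commutator axiom of the module.  They
  commute with the formation of the derivation defect (\<open>cob_0_theta\<close>), for the same reason.
  Finally the defect of \<open>\<phi>\<close> at \<open>(x\<^sub>1, \<dots>, x\<^sub>n\<^sub>-\<^sub>1, w)\<close> differs from \<open>\<theta>\<^sub>X \<phi>\<close> at \<open>w\<close> by a sum of inner
  maps \<open>w \<mapsto> [x\<^sub>1, \<dots>, \<phi> x\<^sub>i, \<dots>, x\<^sub>n\<^sub>-\<^sub>1, w]\<close>, and inner maps are derivations by the second module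
  axiom (\<open>cob_0_inner\<close>).  The same recursion shows that \<open>\<delta>\<close> preserves multilinearity, the degree
  and super skew symmetry (\<open>mlin_cob\<close>, \<open>cob_degree\<close>, \<open>skew_cob\<close>).

  Since \<open>X\<close> acts in the same way on all entries, the arguments of a cochain are concatenated to one
  list for this computation.  Each vector carries a label that stands for its degree: the degree of
  an element like \<open>[x\<^sub>1, \<dots>, x\<^sub>n]\<close> is read off from the entries even if the bracket happens to be 0,
  and signs stay polynomials in the labels.  The identities are proved for homogeneous entries and
  carried over to all entries by multilinear extension (\<open>coboundary_nest\<close>).
\<close>

section \<open>Signs and finite sums\<close>

text \<open>
  Exponents of signs are kept as polynomials over the two-element field, not turned into bit
  operations, so that they can be sorted.
\<close>

declare add_bit_eq_xor [simp del] mult_bit_eq_and [simp del]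

lemma bit_add_self [simp]: "p + p = 0" for p :: bit
  by (cases p) simp_all

lemma bit_add_left_self [simp]: "p + (p + q) = q" for p :: bit
  by (cases p; cases q) simp_all

lemma sgn2_0 [simp]: "sgn2 0 w = w"
  by (simp add: sgn2_def)

lemma sgn2_zero [simp]: "sgn2 p 0 = 0"
  by (simp add: sgn2_def)

lemma sgn2_1 [simp]: "sgn2 1 w = - w"
  by (simp add: sgn2_def)

lemma sgn2_sgn2: "sgn2 p (sgn2 q w) = sgn2 (p + q) w"
  by (cases p; cases q) simp_all

lemma sgn2_add: "sgn2 p (v + w) = sgn2 p v + sgn2 p w"
  by (simp add: sgn2_def)

lemma sgn2_diff: "sgn2 p (v - w) = sgn2 p v - sgn2 p w"
  by (simp add: sgn2_def)

lemma sgn2_minus: "sgn2 p (- w) = - sgn2 p w"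
  by (simp add: sgn2_def)

lemma sgn2_Suc_left: "sgn2 (1 + p) w = - sgn2 p w"
  by (cases p) simp_all

lemma sgn2_Suc_right: "sgn2 (p + 1) w = - sgn2 p w"
  by (cases p) simp_all

lemma sgn2_Suc_middle: "sgn2 (p + (1 + q)) w = - sgn2 (p + q) w"
  by (cases p; cases q) simp_all

lemma sgn2_sum: "sgn2 p (sum g I) = (\<Sum>i\<in>I. sgn2 p (g i))"
  by (simp add: sgn2_def sum_negf)

text \<open>
  Signs are compared by pushing every sign to the atomic terms and sorting its exponent as a
  polynomial over the two-element field.
\<close>

lemmas sgn2_simps = sgn2_sgn2 sgn2_add sgn2_diff sgn2_minus
  sgn2_Suc_left sgn2_Suc_right sgn2_Suc_middle algebra_simps

lemma additive_zero:
  fixes L :: "'a::ab_group_add \<Rightarrow> 'b::ab_group_add"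
  assumes "\<And>v w. L (v + w) = L v + L w"
  shows "L 0 = 0"
  using assms[of 0 0] by simp

lemma additive_sgn2:
  fixes L :: "'a::ab_group_add \<Rightarrow> 'b::ab_group_add"
  assumes "\<And>v w. L (v + w) = L v + L w"
  shows "L (sgn2 p v) = sgn2 p (L v)"
proof -
  have "L v + L (- v) = 0"
    using assms[of v "- v"] additive_zero[of L, OF assms] by simp
  then show ?thesis
    by (simp add: sgn2_def eq_neg_iff_add_eq_0 add.commute)
qed

lemma multilinear_zero:
  assumes "multilinear s t N \<phi>" "length xs = N" "0 \<in> set xs"
  shows "\<phi> xs = 0"
proof -
  obtain i where i: "i < N" "xs ! i = 0"
    using assms by (metis in_set_conv_nth)
  then have "Vector_Spaces.linear s t (\<lambda>x. \<phi> (xs[i := x]))"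
    using assms by (auto simp: multilinear_def)
  then have "\<phi> (xs[i := 0]) = 0"
    unfolding Vector_Spaces.linear_iff by (intro additive_zero) blast
  then show ?thesis
    using i by (metis list_update_id)
qed

lemma multilinear_slot:
  assumes "multilinear s t N \<phi>" "Suc (length A + length B) = N"
  shows "\<phi> (A @ (x + y) # B) = \<phi> (A @ x # B) + \<phi> (A @ y # B)"
    "\<phi> (A @ s c x # B) = t c (\<phi> (A @ x # B))"
proof -
  have "Vector_Spaces.linear s t (\<lambda>x. \<phi> ((A @ 0 # B)[length A := x]))"
    using assms unfolding multilinear_def by (metis length_append length_Cons add_Suc_right less_add_Suc1)
  then show "\<phi> (A @ (x + y) # B) = \<phi> (A @ x # B) + \<phi> (A @ y # B)"
    "\<phi> (A @ s c x # B) = t c (\<phi> (A @ x # B))"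
    unfolding Vector_Spaces.linear_iff by simp_all
qed

lemma sum_list_product_lists_Cons:
  fixes f :: "'b list \<Rightarrow> 'w::comm_monoid_add"
  shows "(\<Sum>ys\<leftarrow>product_lists (L # Ls). f ys) = (\<Sum>y\<leftarrow>L. \<Sum>ys\<leftarrow>product_lists Ls. f (y # ys))"
  by (induction L) (simp_all add: comp_def)

lemma sum_list_product_lists_append:
  fixes f :: "'b list \<Rightarrow> 'w::comm_monoid_add"
  shows "(\<Sum>ys\<leftarrow>product_lists (Ls @ Ms). f ys)
    = (\<Sum>us\<leftarrow>product_lists Ls. \<Sum>ws\<leftarrow>product_lists Ms. f (us @ ws))"
proof (induction Ls arbitrary: f)
  case (Cons L Ls)
  show ?case
    unfolding append_Cons sum_list_product_lists_Cons
    by (simp add: Cons.IH)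
qed simp

lemma omit_0 [simp]: "omit 0 (x # xs) = xs"
  by (simp add: omit_def)

lemma omit_Suc [simp]: "omit (Suc i) (x # xs) = x # omit i xs"
  by (simp add: omit_def)

lemma sum_Suc_Suc_open:
  "(\<Sum>k\<in>{Suc i<..<Suc j}. g k) = (\<Sum>k\<in>{i<..<j}. g (Suc k))"
  by (rule sum.reindex_bij_witness[of _ Suc "\<lambda>k. k - 1"]) auto

lemma sum_Suc_Suc_half_open:
  "(\<Sum>k\<in>{Suc i<..Suc j}. g k) = (\<Sum>k\<in>{i<..j}. g (Suc k))"
  by (rule sum.reindex_bij_witness[of _ Suc "\<lambda>k. k - 1"]) auto

lemma sum_0_Suc_open: "(\<Sum>k\<in>{0<..<Suc j}. g k) = (\<Sum>k<j. g (Suc k))"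
  by (rule sum.reindex_bij_witness[of _ Suc "\<lambda>k. k - 1"]) auto

lemma sum_0_Suc_half_open: "(\<Sum>k\<in>{0<..Suc j}. g k) = (\<Sum>k<Suc j. g (Suc k))"
  by (rule sum.reindex_bij_witness[of _ Suc "\<lambda>k. k - 1"]) auto

section \<open>Homogeneous components and graded lists\<close>

context graded_space
begin

text \<open>
  A list of vectors with labels; a label is a degree in which the vector is homogeneous.  The zero
  vector may carry either label.
\<close>

definition graded :: "('a \<times> bit) list \<Rightarrow> bool" where
  "graded W \<longleftrightarrow> (\<forall>w\<in>set W. fst w \<in> H (snd w))"

text \<open>
  The total degree, computed from the labels.
\<close>

definition wt :: "('a \<times> bit) list \<Rightarrow> bit" where
  "wt W = sum_list (map snd W)"

definition label :: "'a list \<Rightarrow> ('a \<times> bit) list" where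
  "label xs = map (\<lambda>x. (x, deg x)) xs"

lemma graded_simps [simp]:
  "graded []" "graded (w # W) \<longleftrightarrow> fst w \<in> H (snd w) \<and> graded W"
  "graded (A @ B) \<longleftrightarrow> graded A \<and> graded B"
  by (auto simp: graded_def)

lemma wt_simps [simp]:
  "wt [] = 0" "wt (w # W) = snd w + wt W" "wt (A @ B) = wt A + wt B"
  by (simp_all add: wt_def)

lemma label_simps [simp]:
  "label [] = []" "label (x # xs) = (x, deg x) # label xs"
  "label (xs @ ys) = label xs @ label ys" "length (label xs) = length xs"
  "map fst (label xs) = xs"
  by (simp_all add: label_def comp_def)

lemma wt_label [simp]: "wt (label xs) = degs xs"
  by (simp add: wt_def label_def degs_def comp_def)

lemma zero_in_H [simp]: "0 \<in> H a"
  by (simp add: subspace_0 subspace_H)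

lemma H_add: "x \<in> H a \<Longrightarrow> y \<in> H a \<Longrightarrow> x + y \<in> H a"
  by (simp add: subspace_add subspace_H)

lemma H_scale: "x \<in> H a \<Longrightarrow> scale c x \<in> H a"
  by (simp add: subspace_scale subspace_H)

lemma H_diff: "x \<in> H a \<Longrightarrow> y \<in> H a \<Longrightarrow> x - y \<in> H a"
  by (simp add: subspace_diff subspace_H)

lemma H_minus: "x \<in> H a \<Longrightarrow> - x \<in> H a"
  using H_diff[of 0 a x] by simp

lemma H_sgn2: "x \<in> H a \<Longrightarrow> sgn2 p x \<in> H a"
  by (simp add: sgn2_def H_minus)

lemma H_Int: "x \<in> H 0 \<Longrightarrow> x \<in> H 1 \<Longrightarrow> x = 0"
  using direct_sum[of x] by (metis add_0 add.right_neutral fst_conv prod.inject snd_conv zero_in_H)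

lemma deg_unique: "x \<in> H a \<Longrightarrow> x \<noteq> 0 \<Longrightarrow> deg x = a"
  using H_Int by (cases a) (auto simp: deg_def)

lemma homogeneous_deg: "homogeneous x \<Longrightarrow> x \<in> H (deg x)"
  unfolding homogeneous_def by (metis deg_unique zero_in_H)

lemma homogeneous_iff: "homogeneous x \<longleftrightarrow> x \<in> H (deg x)"
  using homogeneous_deg homogeneous_def by blast

lemma graded_label [simp]: "graded (label xs) \<longleftrightarrow> list_all homogeneous xs"
  by (induction xs) (auto simp: homogeneous_iff)

lemma graded_homogeneous: "graded W \<Longrightarrow> list_all homogeneous (map fst W)"
  by (induction W) (auto simp: homogeneous_def)

text \<open>
  A label can differ from the degree only at the vector 0, where every multilinear formula
  vanishes; so identities for degrees carry over to arbitrary labels.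
\<close>

lemma graded_label_cases:
  assumes "graded W"
  obtains "0 \<in> set (map fst W)" | "W = label (map fst W)"
proof (cases "0 \<in> set (map fst W)")
  case False
  with assms have "W = label (map fst W)"
  proof (induction W)
    case (Cons w W)
    then have "deg (fst w) = snd w"
      by (intro deg_unique) auto
    with Cons show ?case
      by (cases w) auto
  qed simp
  then show ?thesis by (rule that)
qed (rule that)

lemma graded_take [simp]: "graded W \<Longrightarrow> graded (take i W)"
  by (auto simp: graded_def dest: in_set_takeD)

lemma graded_drop [simp]: "graded W \<Longrightarrow> graded (drop i W)"
  by (auto simp: graded_def dest: in_set_dropD)

lemma part_split: "part 0 x + part 1 x = x" "part a x \<in> H a"
proof -
  obtain p where p: "fst p \<in> H 0" "snd p \<in> H 1" "x = fst p + snd p"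
    using direct_sum[of x] by blast
  have u: "p' = p" if "fst p' \<in> H 0 \<and> snd p' \<in> H 1 \<and> x = fst p' + snd p'" for p'
    using direct_sum[of x] p that by blast
  have 0: "part 0 x = fst p"
    unfolding part_def
  proof (rule the_equality)
    fix y assume "y \<in> H 0 \<and> x - y \<in> H (0 + 1)"
    then show "y = fst p" using u[of "(y, x - y)"] by auto
  qed (use p in simp)
  have 1: "part 1 x = snd p"
    unfolding part_def
  proof (rule the_equality)
    fix y assume "y \<in> H 1 \<and> x - y \<in> H (1 + 1)"
    then show "y = snd p" using u[of "(x - y, y)"] by auto
  qed (use p in simp)
  show "part 0 x + part 1 x = x" using 0 1 p by simp
  show "part a x \<in> H a" using 0 1 p by (cases a) simp_all
qed

lemma part_unique:
  assumes "y \<in> H 0" "z \<in> H 1"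
  shows "part 0 (y + z) = y" "part 1 (y + z) = z"
proof -
  have "\<exists>!p. fst p \<in> H 0 \<and> snd p \<in> H 1 \<and> y + z = fst p + snd p"
    by (rule direct_sum)
  moreover have "fst (y, z) \<in> H 0 \<and> snd (y, z) \<in> H 1 \<and> y + z = fst (y, z) + snd (y, z)"
    using assms by simp
  moreover have "fst (part 0 (y + z), part 1 (y + z)) \<in> H 0 \<and>
      snd (part 0 (y + z), part 1 (y + z)) \<in> H 1 \<and>
      y + z = fst (part 0 (y + z), part 1 (y + z)) + snd (part 0 (y + z), part 1 (y + z))"
    by (simp add: part_split)
  ultimately have "(part 0 (y + z), part 1 (y + z)) = (y, z)" by blast
  then show "part 0 (y + z) = y" "part 1 (y + z) = z" by auto
qed

lemma part_same: "x \<in> H a \<Longrightarrow> part a x = x"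
  using part_unique[of x 0] part_unique[of 0 x] by (cases a) simp_all

lemma part_other: "x \<in> H b \<Longrightarrow> a \<noteq> b \<Longrightarrow> part a x = 0"
  using part_unique[of x 0] part_unique[of 0 x] by (cases a; cases b) simp_all

lemma part_add: "part a (x + y) = part a x + part a y"
proof -
  have "x + y = (part 0 x + part 0 y) + (part 1 x + part 1 y)"
    using part_split(1)[of x] part_split(1)[of y] by (metis add.assoc add.left_commute)
  then show ?thesis
    using part_unique[OF H_add[OF part_split(2) part_split(2)] H_add[OF part_split(2) part_split(2)]]
    by (cases a) metis+
qed

lemma part_scale: "part a (scale c x) = scale c (part a x)"
proof -
  have "scale c x = scale c (part 0 x) + scale c (part 1 x)"
    using part_split(1)[of x] by (metis scale_right_distrib)
  then show ?thesis
    using part_unique[OF H_scale[OF part_split(2)] H_scale[OF part_split(2)]]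
    by (cases a) metis+
qed

lemma part_zero [simp]: "part a 0 = 0"
  by (simp add: part_same)

lemma part_minus: "part a (- x) = - part a x"
  using part_add[of a x "- x"] by (simp add: eq_neg_iff_add_eq_0 add.commute)

lemma part_sgn2: "part a (sgn2 p x) = sgn2 p (part a x)"
  by (simp add: sgn2_def part_minus)

lemma label_take: "label (take i xs) = take i (label xs)"
  by (simp add: label_def take_map)

lemma label_drop: "label (drop i xs) = drop i (label xs)"
  by (simp add: label_def drop_map)

lemma wt_take_label [simp]: "wt (take i (label xs)) = degs (take i xs)"
  by (simp flip: label_take)

lemma wt_drop_label [simp]: "wt (drop i (label xs)) = degs (drop i xs)"
  by (simp flip: label_drop)

lemma nth_label [simp]: "i < length xs \<Longrightarrow> label xs ! i = (xs ! i, deg (xs ! i))"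
  by (simp add: label_def)

lemma map_fst_omit: "map fst (omit i W) = omit i (map fst W)"
  by (simp add: omit_def take_map drop_map)

lemma degs_omit: "degs (omit i xs) = degs (take i xs) + degs (drop (Suc i) xs)"
  by (simp add: omit_def degs_def)

lemma length_omit: "i < length xs \<Longrightarrow> Suc (length (omit i xs)) = length xs"
  by (simp add: omit_def)

lemma graded_omit: "graded W \<Longrightarrow> graded (omit i W)"
  by (simp add: omit_def)

lemma wt_omit: "i < length W \<Longrightarrow> wt W = snd (W ! i) + wt (omit i W)"
  by (subst (1) id_take_nth_drop[of i W]) (simp_all add: omit_def algebra_simps)

lemma degs_simps [simp]:
  "degs [] = 0" "degs (x # xs) = deg x + degs xs" "degs (xs @ ys) = degs xs + degs ys"
  by (simp_all add: degs_def)

lemma degs_concat: "degs (concat Xs) = (\<Sum>X\<leftarrow>Xs. degs X)"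
  by (induction Xs) simp_all

lemma comps2_append:
  fixes f :: "'a list \<Rightarrow> 'w::comm_monoid_add"
  shows "(\<Sum>ys\<leftarrow>comps2 (xs @ zs). f ys) = (\<Sum>us\<leftarrow>comps2 xs. \<Sum>ws\<leftarrow>comps2 zs. f (us @ ws))"
  by (simp add: comps2_def sum_list_product_lists_append)

lemma comps3_concat:
  fixes f :: "'a list \<Rightarrow> 'w::comm_monoid_add"
  shows "(\<Sum>Ys\<leftarrow>comps3 Xs. f (concat Ys)) = (\<Sum>ys\<leftarrow>comps2 (concat Xs). f ys)"
proof (induction Xs arbitrary: f)
  case (Cons X Xs)
  have "(\<Sum>Ys\<leftarrow>comps3 (X # Xs). f (concat Ys))
      = (\<Sum>Y\<leftarrow>comps2 X. \<Sum>Ys\<leftarrow>comps3 Xs. f (Y @ concat Ys))"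
    by (simp only: comps3_def list.map sum_list_product_lists_Cons concat.simps)
  then show ?case
    by (simp add: comps2_append Cons.IH[of "\<lambda>us. f (Y @ us)" for Y])
qed (simp add: comps3_def comps2_def)

text \<open>
  Both sides run over all choices of a component for each entry; nesting of the entries does not
  matter.
\<close>

lemma comps3_comps1:
  fixes f :: "'a list \<Rightarrow> 'w::comm_monoid_add"
  shows "(\<Sum>Ys\<leftarrow>comps3 Xs. \<Sum>y\<leftarrow>comps1 z. f (concat Ys @ [y])) = (\<Sum>ys\<leftarrow>comps2 (concat Xs @ [z]). f ys)"
  unfolding comps2_append comps3_concat[symmetric, of "\<lambda>us. \<Sum>ws\<leftarrow>comps2 [z]. f (us @ ws)"]
  by (simp add: comps2_def comps1_def)

lemma homogeneous_part: "homogeneous (part a x)"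
  using part_split(2) homogeneous_def by blast

lemma comps2_homogeneous:
  assumes "ys \<in> set (comps2 xs)"
  shows "list_all homogeneous ys" "length ys = length xs"
proof -
  have "list_all homogeneous ys \<and> length ys = length xs"
    using assms
    by (induction xs arbitrary: ys) (auto simp: comps2_def comps1_def homogeneous_part)
  then show "list_all homogeneous ys" "length ys = length xs" by auto
qed

lemma comps3_homogeneous:
  assumes "Ys \<in> set (comps3 Xs)"
  shows "list_all homogeneous (concat Ys)" "map length Ys = map length Xs"
proof -
  have "list_all homogeneous (concat Ys) \<and> map length Ys = map length Xs"
    using assms
  proof (induction Xs arbitrary: Ys)
    case (Cons X Xs)
    then obtain Y Zs where "Ys = Y # Zs" "Y \<in> set (comps2 X)" "Zs \<in> set (comps3 Xs)"
      by (auto simp: comps3_def)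
    then show ?case
      using Cons.IH[of Zs] comps2_homogeneous[of Y X] by simp
  qed (simp add: comps3_def)
  then show "list_all homogeneous (concat Ys)" "map length Ys = map length Xs" by auto
qed

text \<open>
  The multilinear extension of a function of graded lists: the sum of its values over all choices
  of a component of each entry.  In contrast to \<open>comps2\<close> each component comes with its label.
\<close>

primrec ext :: "(('a \<times> bit) list \<Rightarrow> 'w::ab_group_add) \<Rightarrow> 'a list \<Rightarrow> 'w" where
  "ext F [] = F []"
| "ext F (x # xs) =
     ext (\<lambda>U. F ((part 0 x, 0) # U)) xs + ext (\<lambda>U. F ((part 1 x, 1) # U)) xs"

lemma ext_cong:
  assumes "\<And>U. graded U \<Longrightarrow> length U = length xs \<Longrightarrow> F U = F' U"
  shows "ext F xs = ext F' xs"
  using assms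
proof (induction xs arbitrary: F F')
  case (Cons x xs)
  have "ext (\<lambda>U. F ((part a x, a) # U)) xs = ext (\<lambda>U. F' ((part a x, a) # U)) xs" for a
    by (rule Cons.IH, rule Cons.prems) (simp_all add: part_split)
  then show ?case by simp
qed simp

lemma ext_zero [simp]: "ext (\<lambda>U. 0) xs = 0"
  by (induction xs) simp_all

lemma ext_additive:
  assumes "\<And>v w. L (v + w) = L v + L w"
  shows "ext (\<lambda>U. L (F U)) xs = L (ext F xs)"
  by (induction xs arbitrary: F) (simp_all add: assms)

lemma ext_add: "ext (\<lambda>U. F U + F' U) xs = ext F xs + ext F' xs"
  by (induction xs arbitrary: F F') (simp_all add: algebra_simps)

lemma ext_minus_sgn2: "ext (\<lambda>U. - sgn2 p (F U)) xs = - sgn2 p (ext F xs)"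
  by (rule ext_additive[of "\<lambda>v. - sgn2 p v"]) (simp add: sgn2_add)

lemma sum_comps2_ext:
  assumes "\<And>U. graded U \<Longrightarrow> length U = length xs \<Longrightarrow> h (map fst U) = F U"
  shows "(\<Sum>ys\<leftarrow>comps2 xs. h ys) = ext F xs"
  using assms
proof (induction xs arbitrary: h F)
  case (Cons x xs)
  have IH: "(\<Sum>ys\<leftarrow>comps2 xs. h (part a x # ys)) = ext (\<lambda>U. F ((part a x, a) # U)) xs" for a
    by (rule Cons.IH) (simp add: Cons.prems[symmetric] part_split)
  have "(\<Sum>ys\<leftarrow>comps2 (x # xs). h ys) = (\<Sum>y\<leftarrow>comps1 x. \<Sum>ys\<leftarrow>comps2 xs. h (y # ys))"
    by (simp only: comps2_def list.map sum_list_product_lists_Cons)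
  then show ?case
    using IH by (simp add: comps1_def)
qed (simp add: comps2_def)

end

section \<open>Lie derivatives and substitutions\<close>

context n_Lie_superalgebra
begin

definition actl :: "('g \<times> bit) list \<Rightarrow> 'g \<times> bit \<Rightarrow> 'g \<times> bit" where
  "actl X w = (br (map fst X @ [fst w]), wt X + snd w)"

text \<open>
  The signed sum of the values of \<open>F\<close> after letting \<open>X\<close> act on one entry of the list; the sign
  arises from moving \<open>X\<close> past the entries before it.  The values may lie in any group, so that the
  bracket itself and the module action are instances of \<open>F\<close>.
\<close>

primrec lder :: "('g \<times> bit) list \<Rightarrow> (('g \<times> bit) list \<Rightarrow> 'w::ab_group_add) \<Rightarrow>
    ('g \<times> bit) list \<Rightarrow> 'w" where
  "lder X F [] = 0"
| "lder X F (w # W) = F (actl X w # W) + sgn2 (wt X * snd w) (lder X (\<lambda>U. F (w # U)) W)"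

text \<open>
  With \<open>R\<close> the module action this is the sum of the brackets \<open>[w\<^sub>1, \<dots>, \<phi> w\<^sub>i, \<dots>, w\<^sub>n]\<close> for a map
  \<open>\<phi>\<close> of degree \<open>a\<close>: the map moves past the entries before \<open>w\<^sub>i\<close>, and then the vector \<open>\<phi> w\<^sub>i\<close> of
  degree \<open>a + |w\<^sub>i|\<close> is moved behind the remaining entries by skew transpositions, each of which
  also contributes a factor \<open>-1\<close>.
\<close>

primrec plug :: "bit \<Rightarrow> ('g \<times> bit \<Rightarrow> 'u) \<Rightarrow>
    (('g \<times> bit) list \<Rightarrow> 'u \<Rightarrow> 'w::ab_group_add) \<Rightarrow> ('g \<times> bit) list \<Rightarrow> 'w" where
  "plug a \<phi> R [] = 0"
| "plug a \<phi> R (w # W) =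
     sgn2 ((a + snd w) * wt W + of_nat (length W)) (R W (\<phi> w))
     + sgn2 (a * snd w) (plug a \<phi> (\<lambda>U. R (w # U)) W)"

lemma snd_actl [simp]: "snd (actl X w) = wt X + snd w"
  by (simp add: actl_def)

lemmas br_zero = multilinear_zero[OF br_multilinear]

lemma br_graded:
  assumes "graded W" "length W = n"
  shows "br (map fst W) \<in> G (wt W)"
  using assms(1)
proof (cases rule: graded_label_cases)
  case 1
  then show ?thesis
    using br_zero[of "map fst W"] assms(2) by simp
next
  case 2
  then have "wt W = degs (map fst W)" by (metis wt_label)
  then show ?thesis
    using br_degree[of "map fst W"] assms graded_homogeneous by simp
qed

lemma actl_graded [simp]:
  assumes "1 \<le> n" "graded X" "length X = n - 1" "fst w \<in> G (snd w)"
  shows "fst (actl X w) \<in> G (wt X + snd w)" "fst (actl X w) \<in> G (snd w + wt X)"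
  using br_graded[of "X @ [w]"] assms by (simp_all add: actl_def add.commute)

text \<open>
  The action on one entry changes neither the length nor the labels of the other entries, and it
  adds the degree of \<open>X\<close> to the total degree.
\<close>

lemma lder_cong:
  assumes "\<And>U. length U = length W \<Longrightarrow> wt U = wt X + wt W \<Longrightarrow>
    (1 \<le> n \<Longrightarrow> graded X \<Longrightarrow> length X = n - 1 \<Longrightarrow> graded W \<Longrightarrow> graded U) \<Longrightarrow> F U = F' U"
  shows "lder X F W = lder X F' W"
  using assms
proof (induction W arbitrary: F F')
  case (Cons w W)
  have "F (actl X w # W) = F' (actl X w # W)"
    by (rule Cons.prems) (auto simp: algebra_simps)
  moreover have "lder X (\<lambda>U. F (w # U)) W = lder X (\<lambda>U. F' (w # U)) W"
    by (rule Cons.IH, rule Cons.prems) (auto simp: algebra_simps)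
  ultimately show ?case by simp
qed simp

lemma lder_add: "lder X (\<lambda>U. F U + F' U) W = lder X F W + lder X F' W"
  by (induction W arbitrary: F F') (simp_all add: sgn2_simps)

lemma lder_minus: "lder X (\<lambda>U. - F U) W = - lder X F W"
  by (induction W arbitrary: F) (simp_all add: sgn2_simps)

lemma lder_diff: "lder X (\<lambda>U. F U - F' U) W = lder X F W - lder X F' W"
  using lder_add[of X F "\<lambda>U. - F' U" W] by (simp add: lder_minus)

lemma lder_sgn2: "lder X (\<lambda>U. sgn2 p (F U)) W = sgn2 p (lder X F W)"
  by (cases p) (simp_all add: lder_minus)

lemma lder_sgn2_wt:
  "lder X (\<lambda>U. sgn2 (p + q * wt U) (F U)) W = sgn2 (p + q * (wt X + wt W)) (lder X F W)"
proof -
  have "lder X (\<lambda>U. sgn2 (p + q * wt U) (F U)) W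
      = lder X (\<lambda>U. sgn2 (p + q * (wt X + wt W)) (F U)) W"
    by (rule lder_cong) simp
  then show ?thesis by (simp add: lder_sgn2)
qed

lemma lder_additive:
  assumes "\<And>v w. L (v + w) = L v + L w"
  shows "L (lder X F W) = lder X (\<lambda>U. L (F U)) W"
  by (induction W arbitrary: F)
    (simp_all add: assms additive_zero[of L, OF assms] additive_sgn2[of L, OF assms])

lemma lder_append:
  "lder X F (A @ C) = lder X (\<lambda>U. F (U @ C)) A + sgn2 (wt X * wt A) (lder X (\<lambda>U. F (A @ U)) C)"
  by (induction A arbitrary: F) (simp_all add: sgn2_simps)

lemma lder_index:
  "lder X F W = (\<Sum>i<length W. sgn2 (wt X * wt (take i W)) (F (W[i := actl X (W ! i)])))"
  by (induction W arbitrary: F)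
    (simp_all add: sum.lessThan_Suc_shift sgn2_sum sgn2_simps del: sum.lessThan_Suc)

lemma plug_cong:
  assumes "\<And>w. w \<in> set W \<Longrightarrow> \<phi> w = \<phi>' w"
    and "\<And>U w. Suc (length U) = length W \<Longrightarrow> w \<in> set W \<Longrightarrow> set U \<subseteq> set W \<Longrightarrow>
      wt U = snd w + wt W \<Longrightarrow> R U (\<phi> w) = R' U (\<phi> w)"
  shows "plug a \<phi> R W = plug a \<phi>' R' W"
  using assms
proof (induction W arbitrary: R R')
  case (Cons w W)
  have "R W (\<phi> w) = R' W (\<phi> w)"
    by (rule Cons.prems) auto
  moreover have "plug a \<phi> (\<lambda>U. R (w # U)) W = plug a \<phi>' (\<lambda>U. R' (w # U)) W"
    by (rule Cons.IH, rule Cons.prems, simp, rule Cons.prems) (auto simp: algebra_simps)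
  ultimately show ?case
    using Cons.prems(1) by simp
qed simp

lemma plug_add: "plug a \<phi> (\<lambda>U v. R U v + R' U v) W = plug a \<phi> R W + plug a \<phi> R' W"
  by (induction W arbitrary: R R') (simp_all add: sgn2_simps)

lemma plug_additive:
  assumes "\<And>v w. L (v + w) = L v + L w"
  shows "L (plug a \<phi> R W) = plug a \<phi> (\<lambda>U v. L (R U v)) W"
  by (induction W arbitrary: R)
    (simp_all add: assms additive_zero[of L, OF assms] additive_sgn2[of L, OF assms])

lemma plug_minus: "plug a \<phi> (\<lambda>U v. - R U v) W = - plug a \<phi> R W"
  by (induction W arbitrary: R) (simp_all add: sgn2_simps)

lemma plug_sgn2: "plug a \<phi> (\<lambda>U v. sgn2 p (R U v)) W = sgn2 p (plug a \<phi> R W)"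
  by (cases p) (simp_all add: plug_minus)

lemma plug_comp: "plug a (\<lambda>w. g (\<phi> w)) R W = plug a \<phi> (\<lambda>U v. R U (g v)) W"
  by (induction W arbitrary: R) simp_all

lemma plug_index:
  "plug a \<phi> R W = (\<Sum>i<length W.
     sgn2 (a * wt (take i W) + (a + snd (W ! i)) * wt (drop (Suc i) W) + of_nat (length W - Suc i))
       (R (omit i W) (\<phi> (W ! i))))"
  by (induction W arbitrary: R)
    (simp_all add: sum.lessThan_Suc_shift sgn2_sum sgn2_simps omit_def del: sum.lessThan_Suc)

text \<open>
  Raising the degree of \<open>\<phi>\<close> by \<open>c\<close> multiplies the summand of \<open>w\<close> by the sign of moving \<open>c\<close> past
  all entries except \<open>w\<close>.  Together with the sign at \<open>w\<close> this is the same sign in all summands.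
\<close>

lemma plug_shift_degree:
  assumes "\<And>U v. Suc (length U) = length W \<Longrightarrow> R U (- v) = - R U v"
  shows "plug (a + c) (\<lambda>w. sgn2 (c * snd w) (\<phi> w)) R W = sgn2 (c * wt W) (plug a \<phi> R W)"
  using assms
proof (induction W arbitrary: R)
  case (Cons w W)
  have R: "R W (sgn2 p v) = sgn2 p (R W v)" for p v
    using Cons.prems[of W] by (cases p) simp_all
  have "plug (a + c) (\<lambda>w. sgn2 (c * snd w) (\<phi> w)) (\<lambda>U. R (w # U)) W
      = sgn2 (c * wt W) (plug a \<phi> (\<lambda>U. R (w # U)) W)"
    by (rule Cons.IH) (simp add: Cons.prems)
  then show ?case
    by (simp add: R sgn2_simps)
qed simp

text \<open>
  A map \<open>g\<close> of degree \<open>c\<close> that is applied after \<open>\<phi>\<close> also has to pass the remaining entries \<open>U\<close>.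
\<close>

lemma plug_sgn2_wt:
  "plug a \<phi> (\<lambda>U v. sgn2 (c * wt U) (R U (g v))) W = plug (a + c) (\<lambda>w. g (\<phi> w)) R W"
proof -
  have "plug a \<phi> (\<lambda>U v. sgn2 (q + c * wt U) (R U (g v))) W
      = sgn2 q (plug (a + c) (\<lambda>w. g (\<phi> w)) R W)" for q
  proof (induction W arbitrary: R q)
    case (Cons w W)
    have "plug a \<phi> (\<lambda>U v. sgn2 (q + c * wt (w # U)) (R (w # U) (g v))) W
      = plug a \<phi> (\<lambda>U v. sgn2 ((q + c * snd w) + c * wt U) (R (w # U) (g v))) W"
      by (simp add: algebra_simps)
    also have "\<dots> = sgn2 (q + c * snd w) (plug (a + c) (\<lambda>w. g (\<phi> w)) (\<lambda>U. R (w # U)) W)"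
      by (rule Cons.IH)
    finally show ?case
      by (simp add: sgn2_simps)
  qed simp
  from this[of 0] show ?thesis by simp
qed

text \<open>
  An additional last entry \<open>z\<close> has to be passed by every value substituted further left, and it can
  be the substituted entry itself.
\<close>

lemma plug_snoc:
  assumes "\<And>U v. length U = length W \<Longrightarrow> R U (- v) = - R U v"
  shows "plug a \<phi> R (W @ [z]) =
    plug a (\<lambda>w. - sgn2 ((a + snd w) * snd z) (\<phi> w)) (\<lambda>U. R (U @ [z])) W
    + sgn2 (a * wt W) (R W (\<phi> z))"
  using assms
proof (induction W arbitrary: R)
  case (Cons w W)
  have R: "R (W @ [z]) (sgn2 p v) = sgn2 p (R (W @ [z]) v)"
    "R (W @ [z]) (- v) = - R (W @ [z]) v" for p v
    using Cons.prems[of "W @ [z]"] by (cases p, simp_all)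
  show ?case
    using Cons.IH[of "\<lambda>U. R (w # U)"] Cons.prems
    by (simp add: R sgn2_simps)
qed simp

text \<open>
  The Lie derivative of a substitution sum either hits the substituted entry, which replaces
  \<open>\<phi>\<close> by \<open>\<phi>\<close> after the action of \<open>X\<close>, or one of the remaining entries.
\<close>

lemma lder_plug:
  "lder X (plug a \<phi> R) W =
     plug (a + wt X) (\<lambda>w. \<phi> (actl X w)) R W
     + sgn2 (wt X * a) (plug a \<phi> (\<lambda>U v. lder X (\<lambda>U. R U v) U) W)"
proof (induction W arbitrary: R)
  case (Cons w W)
  have 1: "lder X (\<lambda>U. sgn2 ((a + snd w) * wt U + of_nat (length U)) (R U (\<phi> w))) W
      = sgn2 ((a + snd w) * (wt X + wt W) + of_nat (length W)) (lder X (\<lambda>U. R U (\<phi> w)) W)"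
  proof -
    have "lder X (\<lambda>U. sgn2 ((a + snd w) * wt U + of_nat (length U)) (R U (\<phi> w))) W
      = lder X (\<lambda>U. sgn2 ((a + snd w) * (wt X + wt W) + of_nat (length W)) (R U (\<phi> w))) W"
      by (rule lder_cong) simp
    then show ?thesis by (simp add: lder_sgn2)
  qed
  show ?case
    by (simp add: lder_add lder_sgn2 1 Cons.IH plug_add plug_sgn2)
      (simp add: sgn2_simps)
qed simp

lemma plug_additive_arg:
  assumes "\<And>v. g (\<phi> v) = \<phi>' v"
    and "\<And>U v. Suc (length U) = length W \<Longrightarrow> R U (g v) = L (R U v)"
    and "\<And>v w. L (v + w) = L v + L w"
  shows "plug a \<phi>' R W = L (plug a \<phi> R W)"
proof -
  have "plug a \<phi>' R W = plug a (\<lambda>w. g (\<phi> w)) R W"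
    by (simp add: assms(1))
  also have "\<dots> = plug a \<phi> (\<lambda>U v. R U (g v)) W"
    by (rule plug_comp)
  also have "\<dots> = plug a \<phi> (\<lambda>U v. L (R U v)) W"
    by (rule plug_cong) (simp_all add: assms(2))
  also have "\<dots> = L (plug a \<phi> R W)"
    by (rule plug_additive[symmetric]) (rule assms(3))
  finally show ?thesis .
qed

lemma plug_add_arg:
  assumes "\<And>U v v'. Suc (length U) = length W \<Longrightarrow> R U (v + v') = R U v + R U v'"
  shows "plug a (\<lambda>w. \<phi> w + \<phi>' w) R W = plug a \<phi> R W + plug a \<phi>' R W"
  using assms by (induction W arbitrary: R) (simp_all add: sgn2_simps)

lemma lder_vanish:
  assumes "\<And>U. length U = length W \<Longrightarrow> 0 \<in> set (map fst U) \<Longrightarrow> F U = 0"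
    and "1 \<le> n" "length X = n - 1"
    and "0 \<in> set (map fst W) \<or> 0 \<in> set (map fst X)"
  shows "lder X F W = 0"
  using assms(1,4)
proof (induction W arbitrary: F)
  case (Cons w W)
  have "F (actl X w # W) = 0"
  proof (rule Cons.prems)
    have "fst (actl X w) = 0" if "0 \<in> set (map fst X @ [fst w])"
      unfolding actl_def fst_conv by (rule br_zero) (use that assms in auto)
    then show "0 \<in> set (map fst (actl X w # W))"
      using Cons.prems(2) by auto
  qed simp
  moreover have "lder X (\<lambda>U. F (w # U)) W = 0"
  proof (cases "fst w = 0")
    case True
    have "lder X (\<lambda>U. F (w # U)) W = lder X (\<lambda>U. 0) W"
      by (rule lder_cong, rule Cons.prems) (use True in auto)
    also have "\<dots> = 0"
      using lder_add[of X "\<lambda>_. 0" "\<lambda>_. 0" W] by simp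
    finally show ?thesis .
  next
    case False
    show ?thesis
      by (rule Cons.IH, rule Cons.prems) (use False Cons.prems(2) in auto)
  qed
  ultimately show ?case by simp
qed simp

lemma plug_vanish:
  assumes "\<And>U v. Suc (length U) = length W \<Longrightarrow> 0 \<in> set (map fst U) \<Longrightarrow> R U v = 0"
    and "\<And>U. Suc (length U) = length W \<Longrightarrow> R U 0 = 0"
    and "\<And>w. fst w = 0 \<Longrightarrow> \<phi> w = 0"
    and "0 \<in> set (map fst W)"
  shows "plug a \<phi> R W = 0"
  using assms(1,2,4)
proof (induction W arbitrary: R)
  case (Cons w W)
  have 1: "R W (\<phi> w) = 0"
    using Cons.prems(1)[of W] Cons.prems(2)[of W] Cons.prems(3) assms(3)[of w]
    by (cases "fst w = 0") auto
  have "plug a \<phi> (\<lambda>U. R (w # U)) W = 0"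
  proof (cases "fst w = 0")
    case True
    have "plug a \<phi> (\<lambda>U. R (w # U)) W = plug a \<phi> (\<lambda>U v. 0) W"
      by (rule plug_cong, simp, rule Cons.prems) (use True in auto)
    also have "\<dots> = 0"
      using plug_add[of a \<phi> "\<lambda>_ _. 0" "\<lambda>_ _. 0" W] by simp
    finally show ?thesis .
  next
    case False
    show ?thesis
      by (rule Cons.IH; (rule Cons.prems)?) (use False Cons.prems in auto)
  qed
  with 1 show ?case by simp
qed simp

text \<open>
  The fundamental identity holds for arbitrary labels because both sides vanish as soon as an entry
  is 0.
\<close>

lemma Jacobi_label:
  assumes n: "1 \<le> n" and X: "graded X" "length X = n - 1" and Y: "graded Y" "length Y = n"
  shows "br (map fst X @ [br (map fst Y)]) = lder X (\<lambda>U. br (map fst U)) Y"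
proof (cases "0 \<in> set (map fst X) \<or> 0 \<in> set (map fst Y)")
  case True
  have "lder X (\<lambda>U. br (map fst U)) Y = 0"
    by (rule lder_vanish) (use True n X Y in \<open>auto intro!: br_zero simp del: set_map\<close>)
  moreover have "br (map fst X @ [br (map fst Y)]) = 0"
    by (rule br_zero) (use True n X Y br_zero[of "map fst Y"] in auto)
  ultimately show ?thesis by simp
next
  case False
  obtain xs ys where XY: "X = label xs" "Y = label ys"
    using False graded_label_cases X(1) Y(1) by metis
  show ?thesis
    using br_Jacobi[of xs ys] X Y unfolding XY
    by (simp add: lder_index actl_def map_update)
qed

text \<open>
  The fundamental identity as a commutation rule: \<open>X\<close> acts on \<open>[y\<^sub>1, \<dots>, y\<^sub>n\<^sub>-\<^sub>1, w]\<close> either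
  through \<open>Y\<close> or through \<open>w\<close>.
\<close>

lemma Jacobi_actl:
  assumes n: "1 \<le> n" and X: "graded X" "length X = n - 1" and Y: "graded Y" "length Y = n - 1"
    and w: "fst w \<in> G (snd w)"
  shows "fst (actl X (actl Y w)) =
    lder X (\<lambda>U. fst (actl U w)) Y + sgn2 (wt X * wt Y) (fst (actl Y (actl X w)))"
  using Jacobi_label[of X "Y @ [w]"] assms by (simp add: actl_def lder_append)

text \<open>
  This identifies the signed sum of decomposable elements that represents \<open>X \<cdot> Y\<close> with a Lie
  derivative; further on \<open>F (X \<cdot> Y)\<close> is always written as \<open>lder X F Y\<close>.
\<close>

lemma lin_ext_lder:
  "lin_ext \<phi> (act_fo xs ys) = lder (label xs) (\<lambda>U. \<phi> (map fst U)) (label ys)"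
  by (simp add: lin_ext_def act_fo_def lder_index act_def actl_def map_update comp_def
      interv_sum_list_conv_sum_set_nat atLeast0LessThan)

end

section \<open>Modules\<close>

locale graded_module_ge2 = graded_module sg G n br sv V \<rho>
  for sg :: "'k::field \<Rightarrow> 'g::ab_group_add \<Rightarrow> 'g" and G :: "bit \<Rightarrow> 'g set"
    and n :: nat and br :: "'g list \<Rightarrow> 'g"
    and sv :: "'k \<Rightarrow> 'v::ab_group_add \<Rightarrow> 'v" and V :: "bit \<Rightarrow> 'v set"
    and \<rho> :: "'g list \<Rightarrow> 'v \<Rightarrow> 'v" +
  assumes n_ge_2: "2 \<le> n"
begin

lemma n_ge_1 [simp]: "Suc 0 \<le> n"
  using n_ge_2 by simp

lemma rho_add: "length X = n - 1 \<Longrightarrow> \<rho> X (v + w) = \<rho> X v + \<rho> X w"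
  using rho_linear[of X] by (simp add: Vector_Spaces.linear_iff)

lemma rho_scale: "length X = n - 1 \<Longrightarrow> \<rho> X (sv c v) = sv c (\<rho> X v)"
  using rho_linear[of X] by (simp add: Vector_Spaces.linear_iff)

lemma rho_zero [simp]: "length X = n - 1 \<Longrightarrow> \<rho> X 0 = 0"
  by (rule additive_zero) (rule rho_add)

lemma rho_sgn2: "length X = n - 1 \<Longrightarrow> \<rho> X (sgn2 p v) = sgn2 p (\<rho> X v)"
  by (rule additive_sgn2) (rule rho_add)

lemma rho_minus: "length X = n - 1 \<Longrightarrow> \<rho> X (- v) = - \<rho> X v"
  using rho_sgn2[of X 1] by simp

lemma rho_diff: "length X = n - 1 \<Longrightarrow> \<rho> X (v - w) = \<rho> X v - \<rho> X w"
  using rho_add[of X v "- w"] by (simp add: rho_minus)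

lemmas rho_vanish = multilinear_zero[OF rho_multilinear]

lemma rho_commutator_label:
  assumes X: "graded X" "length X = n - 1" and Y: "graded Y" "length Y = n - 1"
  shows "\<rho> (map fst X) (\<rho> (map fst Y) v) =
    lder X (\<lambda>U. \<rho> (map fst U) v) Y + sgn2 (wt X * wt Y) (\<rho> (map fst Y) (\<rho> (map fst X) v))"
proof (cases "0 \<in> set (map fst X) \<or> 0 \<in> set (map fst Y)")
  case True
  have "lder X (\<lambda>U. \<rho> (map fst U) v) Y = 0"
    by (rule lder_vanish) (use True X Y in \<open>auto intro!: rho_vanish simp del: set_map\<close>)
  moreover have "(\<forall>v. \<rho> (map fst X) v = 0) \<or> (\<forall>v. \<rho> (map fst Y) v = 0)"
    using True X Y rho_vanish[of "map fst X"] rho_vanish[of "map fst Y"] by auto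
  then have "\<rho> (map fst X) (\<rho> (map fst Y) v) = 0" "\<rho> (map fst Y) (\<rho> (map fst X) v) = 0"
    using X Y by auto
  ultimately show ?thesis by simp
next
  case False
  obtain xs ys where XY: "X = label xs" "Y = label ys"
    using False graded_label_cases X(1) Y(1) by metis
  show ?thesis
    using rho_commutator[of xs ys v] X Y unfolding XY lin_ext_lder by simp
qed

text \<open>
  The second module axiom says that the inner map \<open>w \<mapsto> [x\<^sub>1, \<dots>, x\<^sub>n\<^sub>-\<^sub>2, w, v]\<close> is a derivation of
  the bracket: its signs are those of a substitution by a map of degree \<open>|x\<^sub>1| + \<dots> + |x\<^sub>n\<^sub>-\<^sub>2|\<close>.
\<close>

lemma rho_bracket_label:
  assumes X: "graded X" "length X = n - 2" and Y: "graded Y" "length Y = n"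
  shows "\<rho> (map fst X @ [br (map fst Y)]) v =
    plug (wt X) (\<lambda>w. \<rho> (map fst X @ [fst w]) v) (\<lambda>U. \<rho> (map fst U)) Y"
proof (cases "0 \<in> set (map fst X) \<or> 0 \<in> set (map fst Y)")
  case True
  have len: "length (map fst X @ [z]) = n - 1" for z
    using X n_ge_2 by simp
  have L: "\<rho> (map fst X @ [br (map fst Y)]) v = 0"
    by (rule rho_vanish[OF len]) (use True Y br_zero[of "map fst Y"] in auto)
  show ?thesis
  proof (cases "0 \<in> set (map fst X)")
    case True
    have "plug (wt X) (\<lambda>w. \<rho> (map fst X @ [fst w]) v) (\<lambda>U. \<rho> (map fst U)) Y
        = plug (wt X) (\<lambda>w. 0 :: 'v) (\<lambda>U v. 0) Y"
    proof (rule plug_cong)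
      show *: "\<rho> (map fst X @ [fst w]) v = 0" for w :: "'g \<times> bit"
        by (rule rho_vanish[OF len]) (use True in auto)
      show "\<rho> (map fst U) (\<rho> (map fst X @ [fst w]) v) = 0"
        if "Suc (length U) = length Y" for U and w :: "'g \<times> bit"
      proof -
        have "length U = n - 1" using that Y by simp
        then show ?thesis by (simp add: *)
      qed
    qed
    also have "\<dots> = 0"
      using plug_add[of "wt X" "\<lambda>_. 0" "\<lambda>_ _. 0" "\<lambda>_ _. 0" Y] by simp
    finally show ?thesis using L by simp
  next
    case False
    have "plug (wt X) (\<lambda>w. \<rho> (map fst X @ [fst w]) v) (\<lambda>U. \<rho> (map fst U)) Y = 0"
    proof (rule plug_vanish)
      show "\<rho> (map fst X @ [fst w]) v = 0" if "fst w = 0" for w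
        by (rule rho_vanish[OF len]) (use that in auto)
    qed (use True False Y in \<open>auto intro!: rho_vanish simp del: set_map\<close>)
    then show ?thesis using L by simp
  qed
next
  case False
  obtain xs ys where XY: "X = label xs" "Y = label ys"
    using False graded_label_cases X(1) Y(1) by metis
  show ?thesis
    using rho_bracket[of xs ys v] X Y unfolding XY
    by (simp add: plug_index map_fst_omit degs_omit algebra_simps)
qed

section \<open>Multilinearity on homogeneous entries\<close>

text \<open>
  Signs depend on the degrees of the entries, so the formulas are linear only as long as an entry
  stays in one homogeneous component.
\<close>

definition hlin :: "bit \<Rightarrow> ('g \<Rightarrow> 'v) \<Rightarrow> bool" where
  "hlin b g \<longleftrightarrow> (\<forall>x\<in>G b. \<forall>y\<in>G b. g (x + y) = g x + g y) \<and>
     (\<forall>c. \<forall>x\<in>G b. g (sg c x) = sv c (g x))"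

definition mlin :: "nat \<Rightarrow> (('g \<times> bit) list \<Rightarrow> 'v) \<Rightarrow> bool" where
  "mlin N F \<longleftrightarrow> (\<forall>A b B. Suc (length A + length B) = N \<longrightarrow> graded A \<longrightarrow> graded B \<longrightarrow>
     hlin b (\<lambda>x. F (A @ (x, b) # B)))"

lemma sv_sgn2: "sv c (sgn2 p v) = sgn2 p (sv c v)"
  by (simp add: sgn2_def)

lemma hlin_add: "hlin b g \<Longrightarrow> hlin b g' \<Longrightarrow> hlin b (\<lambda>x. g x + g' x)"
  by (simp add: hlin_def V.scale_right_distrib)

lemma hlin_diff: "hlin b g \<Longrightarrow> hlin b g' \<Longrightarrow> hlin b (\<lambda>x. g x - g' x)"
  by (simp add: hlin_def V.scale_right_diff_distrib)

lemma hlin_sgn2: "hlin b g \<Longrightarrow> hlin b (\<lambda>x. sgn2 p (g x))"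
  by (simp add: hlin_def sgn2_add sv_sgn2)

lemma hlin_0 [simp]: "hlin b (\<lambda>x. 0)"
  by (simp add: hlin_def)

lemma hlin_rho: "length X = n - 1 \<Longrightarrow> hlin b g \<Longrightarrow> hlin b (\<lambda>x. \<rho> X (g x))"
  by (simp add: hlin_def rho_add rho_scale)

lemma hlin_zero: "hlin b g \<Longrightarrow> g 0 = 0"
  unfolding hlin_def by (metis add.right_neutral add_cancel_right_left zero_in_H)

lemma hlin_compose:
  assumes "hlin c g" "\<And>x. x \<in> G b \<Longrightarrow> h x \<in> G c"
    and "\<And>x y. h (x + y) = h x + h y" "\<And>k x. h (sg k x) = sg k (h x)"
  shows "hlin b (\<lambda>x. g (h x))"
  using assms by (simp add: hlin_def)

lemma hlin_multilinear:
  assumes "multilinear sg sv N \<phi>" "Suc (length A + length B) = N"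
  shows "hlin b (\<lambda>x. \<phi> (A @ x # B))"
  using multilinear_slot[OF assms] by (simp add: hlin_def)

lemma mlin_slot:
  "mlin N F \<Longrightarrow> Suc (length A + length B) = N \<Longrightarrow> graded A \<Longrightarrow> graded B \<Longrightarrow>
    hlin b (\<lambda>x. F (A @ (x, b) # B))"
  by (simp add: mlin_def)

lemma mlin_Cons: "mlin (Suc N) F \<Longrightarrow> fst w \<in> G (snd w) \<Longrightarrow> mlin N (\<lambda>U. F (w # U))"
  unfolding mlin_def
proof (intro allI impI)
  fix A b B
  assume *: "\<forall>A b B. Suc (length A + length B) = Suc N \<longrightarrow> graded A \<longrightarrow> graded B \<longrightarrow>
      hlin b (\<lambda>x. F (A @ (x, b) # B))"
    and "fst w \<in> G (snd w)" "Suc (length A + length B) = N" "graded A" "graded B"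
  then show "hlin b (\<lambda>x. F (w # A @ (x, b) # B))"
    using *[rule_format, of "w # A" B b] by simp
qed

lemma mlin_append: "mlin (length A + N) F \<Longrightarrow> graded A \<Longrightarrow> mlin N (\<lambda>U. F (A @ U))"
  by (induction A arbitrary: F) (auto dest: mlin_Cons)

lemma mlin_zero:
  assumes "mlin N F" "graded W" "length W = N" "0 \<in> set (map fst W)"
  shows "F W = 0"
proof -
  obtain w where "w \<in> set W" "fst w = 0" using assms(4) by auto
  then obtain A B where W: "W = A @ (0, snd w) # B"
    by (metis split_list prod.collapse)
  have "hlin (snd w) (\<lambda>x. F (A @ (x, snd w) # B))"
    by (rule mlin_slot) (use assms W in auto)
  from hlin_zero[OF this] show ?thesis using W by simp
qed

lemma mlin_multilinear: "multilinear sg sv N \<phi> \<Longrightarrow> mlin N (\<lambda>W. \<phi> (map fst W))"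
  unfolding mlin_def by (auto intro!: hlin_multilinear)

lemma hlin_lder:
  assumes "\<And>U. length U = length W \<Longrightarrow> graded U \<Longrightarrow> hlin b (\<lambda>x. F x U)"
    and "graded X" "length X = n - 1" "graded W"
  shows "hlin b (\<lambda>x. lder X (F x) W)"
  using assms(1,4)
proof (induction W arbitrary: F)
  case (Cons w W)
  have "hlin b (\<lambda>x. F x (actl X w # W))"
    by (rule Cons.prems(1)) (use assms Cons.prems in simp_all)
  moreover have "hlin b (\<lambda>x. lder X (\<lambda>U. F x (w # U)) W)"
    by (rule Cons.IH, rule Cons.prems(1)) (use Cons.prems in simp_all)
  ultimately show ?case
    by (simp add: hlin_add hlin_sgn2)
qed simp

lemma hlin_plug:
  assumes "\<And>U w. Suc (length U) = length W \<Longrightarrow> graded U \<Longrightarrow> fst w \<in> G (snd w) \<Longrightarrow>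
      hlin b (\<lambda>x. R x U (\<phi> x w))"
    and "graded W"
  shows "hlin b (\<lambda>x. plug a (\<phi> x) (R x) W)"
  using assms
proof (induction W arbitrary: R)
  case (Cons w W)
  have "hlin b (\<lambda>x. R x W (\<phi> x w))"
    by (rule Cons.prems(1)) (use assms Cons.prems in simp_all)
  moreover have "hlin b (\<lambda>x. plug a (\<phi> x) (\<lambda>U. R x (w # U)) W)"
    by (rule Cons.IH, rule Cons.prems(1)) (use Cons.prems in simp_all)
  ultimately show ?case
    by (simp add: hlin_add hlin_sgn2)
qed simp

section \<open>The action of fundamental objects on cochains\<close>

lemma hlin_add_sgn2:
  assumes "hlin b g" "x \<in> G b" "y \<in> G b"
  shows "g (x + sgn2 p y) = g x + sgn2 p (g y)"
proof -
  have "g (y + - y) = g y + g (- y)"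
    using assms H_minus[of y b] unfolding hlin_def by blast
  then have "g (sgn2 p y) = sgn2 p (g y)"
    using hlin_zero[OF assms(1)] by (simp add: sgn2_def eq_neg_iff_add_eq_0 add.commute)
  then show ?thesis
    using assms by (simp add: hlin_def H_sgn2)
qed

text \<open>
  A map that is linear on one component can be moved inside a Lie derivative with values there.
  Membership is proved along with the identity since the induction needs both.
\<close>

lemma hlin_lder_out:
  assumes g: "hlin b g"
    and "\<And>U. length U = length W \<Longrightarrow> wt U = wt X + wt W \<Longrightarrow> graded U \<Longrightarrow> F U \<in> G b"
    and X: "graded X" "length X = n - 1" and "graded W"
  shows "lder X F W \<in> G b \<and> g (lder X F W) = lder X (\<lambda>U. g (F U)) W"
  using assms(2,5)
proof (induction W arbitrary: F)
  case Nil
  show ?case using hlin_zero[OF g] by simp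
next
  case (Cons w W)
  have 1: "F (actl X w # W) \<in> G b"
    by (rule Cons.prems(1)) (use X Cons.prems(2) in \<open>auto simp: algebra_simps\<close>)
  have 2: "lder X (\<lambda>U. F (w # U)) W \<in> G b \<and>
      g (lder X (\<lambda>U. F (w # U)) W) = lder X (\<lambda>U. g (F (w # U))) W"
    by (rule Cons.IH, rule Cons.prems(1)) (use X Cons.prems(2) in \<open>auto simp: algebra_simps\<close>)
  show ?case
    using 1 2 by (simp add: H_add H_sgn2 hlin_add_sgn2[OF g])
qed

text \<open>
  The terms in which \<open>X\<close> and \<open>Y\<close> act on different entries agree up to sign and cancel.  What remains
  are the terms where both act on the same entry, and these are governed by \<open>Jacobi_actl\<close>.
\<close>

lemma lder_commute:
  assumes X: "graded X" "length X = n - 1" and Y: "graded Y" "length Y = n - 1"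
    and "mlin (length W) F" "graded W"
  shows "lder Y (lder X F) W =
    lder X (\<lambda>A. lder A F W) Y + sgn2 (wt X * wt Y) (lder X (lder Y F) W)"
  using assms(5,6)
proof (induction W arbitrary: F)
  case Nil
  have "lder X (\<lambda>A. 0) Y = (0 :: 'v)"
    using lder_add[of X "\<lambda>_. 0 :: 'v" "\<lambda>_. 0" Y] by simp
  then show ?case by simp
next
  case (Cons w W)
  have w: "fst w \<in> G (snd w)" "graded W" using Cons.prems by auto
  have n1: "1 \<le> n" using n_ge_2 by simp
  have IH: "lder Y (lder X (\<lambda>U. F (w # U))) W =
      lder X (\<lambda>A. lder A (\<lambda>U. F (w # U)) W) Y
      + sgn2 (wt X * wt Y) (lder X (lder Y (\<lambda>U. F (w # U))) W)"
    by (rule Cons.IH) (use Cons.prems w in \<open>auto intro: mlin_Cons\<close>)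
  define b where "b = wt X + wt Y + snd w"
  define h where "h = (\<lambda>x. F ((x, b) # W))"
  have h: "hlin b h"
    unfolding h_def using mlin_slot[OF Cons.prems(1), of "[]" W b] w by simp
  have in1: "fst (actl Y (actl X w)) \<in> G b"
    using actl_graded[OF n1 Y, of "actl X w"] actl_graded[OF n1 X w(1)]
    by (simp add: b_def algebra_simps)
  have in2: "lder X (\<lambda>A. fst (actl A w)) Y \<in> G b \<and>
      h (lder X (\<lambda>A. fst (actl A w)) Y) = lder X (\<lambda>A. h (fst (actl A w))) Y"
  proof (rule hlin_lder_out[OF h _ X Y(1)])
    fix A assume "length A = length Y" "wt A = wt X + wt Y" "graded A"
    then show "fst (actl A w) \<in> G b"
      using actl_graded[OF n1, of A w] Y w by (simp add: b_def)
  qed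
  have "F (actl X (actl Y w) # W) = h (fst (actl X (actl Y w)))"
    by (simp add: h_def b_def actl_def algebra_simps)
  also have "\<dots> = lder X (\<lambda>A. h (fst (actl A w))) Y
      + sgn2 (wt X * wt Y) (h (fst (actl Y (actl X w))))"
    unfolding Jacobi_actl[OF n1 X Y w(1)] using in1 in2 by (simp add: hlin_add_sgn2[OF h])
  also have "lder X (\<lambda>A. h (fst (actl A w))) Y = lder X (\<lambda>A. F (actl A w # W)) Y"
    by (rule lder_cong) (simp add: h_def b_def actl_def)
  also have "h (fst (actl Y (actl X w))) = F (actl Y (actl X w) # W)"
    by (simp add: h_def b_def actl_def algebra_simps)
  finally have 1: "F (actl X (actl Y w) # W) = lder X (\<lambda>A. F (actl A w # W)) Y
      + sgn2 (wt X * wt Y) (F (actl Y (actl X w) # W))" .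
  have 2: "lder X (\<lambda>A. sgn2 (wt A * snd w) (lder A (\<lambda>U. F (w # U)) W)) Y
      = sgn2 ((wt X + wt Y) * snd w) (lder X (\<lambda>A. lder A (\<lambda>U. F (w # U)) W) Y)"
    using lder_sgn2_wt[of X 0 "snd w" "\<lambda>A. lder A (\<lambda>U. F (w # U)) W" Y]
    by (simp add: algebra_simps)
  show ?case
    by (simp add: lder_add lder_sgn2 IH 1 2) (simp add: sgn2_simps)
qed

text \<open>
  The super commutator of \<open>X\<close> with a cochain \<open>F\<close> of degree \<open>a\<close>, where the sign arises from moving
  \<open>X\<close> past \<open>F\<close> to let it act on the value.
\<close>

definition theta :: "bit \<Rightarrow> ('g \<times> bit) list \<Rightarrow> (('g \<times> bit) list \<Rightarrow> 'v) \<Rightarrow>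
    ('g \<times> bit) list \<Rightarrow> 'v" where
  "theta a X F W = sgn2 (wt X * a) (\<rho> (map fst X) (F W)) - lder X F W"

lemma theta_add:
  "length X = n - 1 \<Longrightarrow> theta a X (\<lambda>U. F U + F' U) W = theta a X F W + theta a X F' W"
  by (simp add: theta_def rho_add lder_add sgn2_simps)

lemma theta_diff:
  "length X = n - 1 \<Longrightarrow> theta a X (\<lambda>U. F U - F' U) W = theta a X F W - theta a X F' W"
  by (simp add: theta_def rho_diff lder_diff sgn2_simps)

lemma theta_scale:
  "length X = n - 1 \<Longrightarrow> theta a X (\<lambda>U. sv c (F U)) W = sv c (theta a X F W)"
  by (simp add: theta_def rho_scale sv_sgn2 V.scale_right_diff_distrib V.scale_right_distrib
      flip: lder_additive[of "sv c"])

lemma theta_cong: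
  assumes "graded X" "length X = n - 1" "graded W"
    and "\<And>U. graded U \<Longrightarrow> length U = length W \<Longrightarrow> F U = F' U"
  shows "theta a X F W = theta a X F' W"
  unfolding theta_def
  using assms lder_cong[of W X F F'] by simp

text \<open>
  The action on a cochain with its first block \<open>Y\<close> of arguments inserted: either \<open>X\<close> passes \<open>Y\<close>, or
  it acts on \<open>Y\<close>.
\<close>

lemma theta_append:
  "theta a X F (Y @ W) = sgn2 (wt X * wt Y) (theta (a + wt Y) X (\<lambda>U. F (Y @ U)) W)
     - lder X (\<lambda>A. F (A @ W)) Y"
  by (simp add: theta_def lder_append sgn2_simps)

text \<open>
  The operators \<open>\<theta>\<close> inherit the commutation relation of the fundamental objects.  The products of
  an action on the value and an action on the arguments cancel; the pure terms are the commutator axiom and \<open>lder_commute\<close>.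
\<close>

lemma theta_commute:
  assumes X: "graded X" "length X = n - 1" and Y: "graded Y" "length Y = n - 1"
    and F: "mlin (length W) F" "graded W"
  shows "theta (a + wt X) Y (theta a X F) W =
    sgn2 (wt X * wt Y) (theta (a + wt Y) X (theta a Y F) W) - lder X (\<lambda>A. theta a A F W) Y"
proof -
  have rl: "lder A (\<lambda>U. \<rho> (map fst B) (F U)) W = \<rho> (map fst B) (lder A F W)"
    if "length B = n - 1" for A B
    by (rule lder_additive[symmetric]) (simp add: that rho_add)
  have 2: "lder X (\<lambda>A. sgn2 (wt A * a) (\<rho> (map fst A) v)) Y
      = sgn2 ((wt X + wt Y) * a) (lder X (\<lambda>A. \<rho> (map fst A) v) Y)" for v
    using lder_sgn2_wt[of X 0 a "\<lambda>A. \<rho> (map fst A) v" Y]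
    by (simp add: algebra_simps)
  show ?thesis
    using X Y
    by (simp add: theta_def[abs_def] lder_diff lder_sgn2 rl rho_diff rho_sgn2 2
        lder_commute[OF X Y F] rho_commutator_label[OF X Y])
      (simp add: sgn2_simps)
qed

section \<open>The coboundary on graded lists\<close>

text \<open>
  The coboundary of a cochain of degree \<open>a\<close> as a recursion over its fundamental objects, the first
  of which consists of the first \<open>n - 1\<close> entries.  For \<open>m = 0\<close> it is the derivation defect of the
  map \<open>w \<mapsto> F [w]\<close>.
\<close>

primrec cob :: "nat \<Rightarrow> bit \<Rightarrow> (('g \<times> bit) list \<Rightarrow> 'v) \<Rightarrow> ('g \<times> bit) list \<Rightarrow> 'v" where
  "cob 0 a F W = plug a (\<lambda>w. F [w]) (\<lambda>U. \<rho> (map fst U)) W - F [(br (map fst W), wt W)]"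
| "cob (Suc m) a F W = theta a (take (n - 1) W) F (drop (n - 1) W)
     - cob m (a + wt (take (n - 1) W)) (\<lambda>U. F (take (n - 1) W @ U)) (drop (n - 1) W)"

abbreviation arity :: "nat \<Rightarrow> nat" where
  "arity m \<equiv> Suc (m * (n - 1))"

lemma cob_append:
  "length X = n - 1 \<Longrightarrow>
    cob (Suc m) a F (X @ W) = theta a X F W - cob m (a + wt X) (\<lambda>U. F (X @ U)) W"
  by simp

declare cob.simps [simp del]

lemma arity_Suc_cases:
  assumes "length W = arity (Suc m)"
  obtains X W' where "W = X @ W'" "length X = n - 1" "length W' = arity m"
proof
  show "W = take (n - 1) W @ drop (n - 1) W" by simp
qed (use assms n_ge_2 in auto)

lemma arity_1: "arity (Suc 0) = n"
  using n_ge_2 by simp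

lemma plug_rho_add:
  assumes "length W = n"
  shows "plug a (\<lambda>w. \<phi> w + \<phi>' w) (\<lambda>U. \<rho> (map fst U)) W =
    plug a \<phi> (\<lambda>U. \<rho> (map fst U)) W + plug a \<phi>' (\<lambda>U. \<rho> (map fst U)) W"
proof (rule plug_add_arg)
  fix U :: "('g \<times> bit) list" and v v'
  assume "Suc (length U) = length W"
  then have "length (map fst U) = n - 1" using assms by simp
  then show "\<rho> (map fst U) (v + v') = \<rho> (map fst U) v + \<rho> (map fst U) v'"
    by (rule rho_add)
qed

lemma plug_rho_scale:
  assumes "length W = n"
  shows "plug a (\<lambda>w. sv c (\<phi> w)) (\<lambda>U. \<rho> (map fst U)) W =
    sv c (plug a \<phi> (\<lambda>U. \<rho> (map fst U)) W)"
proof (rule plug_additive_arg[OF refl])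
  fix U :: "('g \<times> bit) list" and v
  assume "Suc (length U) = length W"
  then have "length (map fst U) = n - 1" using assms by simp
  then show "\<rho> (map fst U) (sv c v) = sv c (\<rho> (map fst U) v)"
    by (rule rho_scale)
qed (rule V.scale_right_distrib)

lemma cob_add:
  assumes "length W = arity (Suc m)"
  shows "cob m a (\<lambda>U. F U + F' U) W = cob m a F W + cob m a F' W"
  using assms
proof (induction m arbitrary: a F F' W)
  case 0
  then show ?case by (simp add: cob.simps plug_rho_add arity_1[simplified])
next
  case (Suc m)
  from Suc.prems obtain X W' where W: "W = X @ W'" "length X = n - 1" "length W' = arity (Suc m)"
    by (rule arity_Suc_cases)
  show ?case
    unfolding W(1) cob_append[OF W(2)] using W by (simp add: theta_add Suc.IH)
qed

lemma cob_scale: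
  assumes "length W = arity (Suc m)"
  shows "cob m a (\<lambda>U. sv c (F U)) W = sv c (cob m a F W)"
  using assms
proof (induction m arbitrary: a F W)
  case 0
  then show ?case
    by (simp add: cob.simps plug_rho_scale arity_1[simplified] V.scale_right_diff_distrib)
next
  case (Suc m)
  from Suc.prems obtain X W' where W: "W = X @ W'" "length X = n - 1" "length W' = arity (Suc m)"
    by (rule arity_Suc_cases)
  show ?case
    unfolding W(1) cob_append[OF W(2)] using W
    by (simp add: theta_scale Suc.IH V.scale_right_diff_distrib)
qed

lemma cob_sgn2:
  assumes "length W = arity (Suc m)"
  shows "cob m a (\<lambda>U. sgn2 p (F U)) W = sgn2 p (cob m a F W)"
  using cob_scale[OF assms, of a "-1" F] by (cases p) simp_all

lemma cob_zero:
  assumes "length W = arity (Suc m)"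
  shows "cob m a (\<lambda>U. 0) W = 0"
  using cob_scale[OF assms, of a 0 "\<lambda>_. 0"] by simp

lemma cob_diff:
  assumes "length W = arity (Suc m)"
  shows "cob m a (\<lambda>U. F U - F' U) W = cob m a F W - cob m a F' W"
  using cob_add[OF assms, of a F "\<lambda>U. sgn2 1 (F' U)"] unfolding cob_sgn2[OF assms] by simp

lemma cob_sum:
  assumes "length W = arity (Suc m)"
  shows "cob m a (\<lambda>U. \<Sum>i\<in>I. F i U) W = (\<Sum>i\<in>I. cob m a (F i) W)"
  by (induction I rule: infinite_finite_induct)
    (simp_all add: cob_zero[OF assms] cob_add[OF assms])

lemma cob_cong:
  assumes "graded W" "length W = arity (Suc m)"
    and "\<And>U. graded U \<Longrightarrow> length U = arity m \<Longrightarrow> F U = F' U"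
  shows "cob m a F W = cob m a F' W"
  using assms
proof (induction m arbitrary: a F F' W)
  case 0
  have "plug a (\<lambda>w. F [w]) (\<lambda>U. \<rho> (map fst U)) W = plug a (\<lambda>w. F' [w]) (\<lambda>U. \<rho> (map fst U)) W"
    by (rule plug_cong) (use 0 in \<open>auto simp: graded_def\<close>)
  then show ?case using 0 br_graded[of W] arity_1 by (simp add: cob.simps)
next
  case (Suc m)
  from Suc.prems(2) obtain X W' where W: "W = X @ W'" "length X = n - 1"
      "length W' = arity (Suc m)"
    by (rule arity_Suc_cases)
  have 1: "theta a X F W' = theta a X F' W'"
    by (rule theta_cong) (use W Suc.prems in auto)
  have 2: "cob m (a + wt X) (\<lambda>U. F (X @ U)) W' = cob m (a + wt X) (\<lambda>U. F' (X @ U)) W'"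
    by (rule Suc.IH) (use W Suc.prems in auto)
  show ?case
    unfolding W(1) cob_append[OF W(2)] using 1 2 by simp
qed

lemma cob_lder:
  assumes "length W = arity (Suc m)"
  shows "cob m b (\<lambda>U. lder X (\<lambda>A. F A U) Y) W = lder X (\<lambda>A. cob m b (F A) W) Y"
  by (induction Y arbitrary: F)
    (simp_all add: cob_zero[OF assms] cob_add[OF assms] cob_sgn2[OF assms])

text \<open>
  The action on the substitution sum hits either \<open>\<phi>\<close> or one of the other entries
  (\<open>lder_plug\<close>); the latter terms are cancelled by moving the action on the value past \<open>\<rho>\<close>.  The
  action on the bracket inside \<open>\<phi>\<close> is the fundamental identity.
\<close>

lemma cob_0_theta:
  assumes X: "graded X" "length X = n - 1" and W: "graded W" "length W = n" and F: "mlin 1 F"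
  shows "cob 0 (a + wt X) (theta a X F) W = theta a X (cob 0 a F) W"
proof -
  let ?R = "\<lambda>U. \<rho> (map fst U)"
  let ?\<phi> = "\<lambda>w. F [w]"
  have "lder X (\<lambda>U. F [(br (map fst U), wt U)]) W
      = lder X (\<lambda>U. F [(br (map fst U), wt X + wt W)]) W"
    by (rule lder_cong) simp
  also have "\<dots> = F [(lder X (\<lambda>U. br (map fst U)) W, wt X + wt W)]"
    using hlin_lder_out[of "wt X + wt W" "\<lambda>x. F [(x, wt X + wt W)]" W X "\<lambda>U. br (map fst U)"]
      mlin_slot[OF F, of "[]" "[]"] X W br_graded by fastforce
  also have "\<dots> = F [(br (map fst X @ [br (map fst W)]), wt X + wt W)]"
    using Jacobi_label[of X W] X W by simp
  finally have 1: "lder X (\<lambda>U. F [(br (map fst U), wt U)]) W =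
      F [actl X (br (map fst W), wt W)]" by (simp add: actl_def)
  have "sgn2 (wt X * a) (\<rho> (map fst X) (plug a ?\<phi> ?R W))
      = sgn2 (wt X * a) (plug a ?\<phi> (\<lambda>U v. \<rho> (map fst X) (?R U v)) W)"
    using plug_additive[of "\<rho> (map fst X)" a ?\<phi> ?R W] rho_add X by simp
  also have "plug a ?\<phi> (\<lambda>U v. \<rho> (map fst X) (?R U v)) W =
      plug a ?\<phi> (\<lambda>U v. lder X (\<lambda>U. ?R U v) U
        + sgn2 (wt X * wt U) (?R U (\<rho> (map fst X) v))) W"
    by (rule plug_cong, simp, rule rho_commutator_label) (use X W in \<open>auto simp: graded_def\<close>)
  also have "\<dots> = plug a ?\<phi> (\<lambda>U v. lder X (\<lambda>U. ?R U v) U) W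
      + plug (a + wt X) (\<lambda>w. \<rho> (map fst X) (?\<phi> w)) ?R W"
    by (simp only: plug_add plug_sgn2_wt[of a ?\<phi> "wt X" ?R "\<rho> (map fst X)"])
  finally have 2: "sgn2 (wt X * a) (\<rho> (map fst X) (plug a ?\<phi> ?R W)) =
      sgn2 (wt X * a) (plug a ?\<phi> (\<lambda>U v. lder X (\<lambda>U. ?R U v) U) W)
      + sgn2 (wt X * a) (plug (a + wt X) (\<lambda>w. \<rho> (map fst X) (?\<phi> w)) ?R W)"
    by (simp add: sgn2_add)
  have R_sgn2: "?R U (sgn2 p v) = sgn2 p (?R U v)" if "Suc (length U) = length W" for U p v
  proof -
    have "length (map fst U) = n - 1" using that W by simp
    then show ?thesis by (rule rho_sgn2)
  qed
  have 3: "plug (a + wt X) (\<lambda>w. theta a X F [w]) ?R W =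
      sgn2 (wt X * a) (plug (a + wt X) (\<lambda>w. \<rho> (map fst X) (?\<phi> w)) ?R W)
      - plug (a + wt X) (\<lambda>w. ?\<phi> (actl X w)) ?R W"
  proof -
    have "plug (a + wt X) (\<lambda>w. theta a X F [w]) ?R W =
        plug (a + wt X) (\<lambda>w. sgn2 (wt X * a) (\<rho> (map fst X) (?\<phi> w)) + sgn2 1 (?\<phi> (actl X w))) ?R W"
      by (simp add: theta_def)
    also have "\<dots> = plug (a + wt X) (\<lambda>w. sgn2 (wt X * a) (\<rho> (map fst X) (?\<phi> w))) ?R W
        + plug (a + wt X) (\<lambda>w. sgn2 1 (?\<phi> (actl X w))) ?R W"
      by (rule plug_rho_add[OF W(2)])
    also have "plug (a + wt X) (\<lambda>w. sgn2 (wt X * a) (\<rho> (map fst X) (?\<phi> w))) ?R W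
        = sgn2 (wt X * a) (plug (a + wt X) (\<lambda>w. \<rho> (map fst X) (?\<phi> w)) ?R W)"
      by (rule plug_additive_arg[OF refl]) (simp_all add: R_sgn2 sgn2_add)
    also have "plug (a + wt X) (\<lambda>w. sgn2 1 (?\<phi> (actl X w))) ?R W
        = sgn2 1 (plug (a + wt X) (\<lambda>w. ?\<phi> (actl X w)) ?R W)"
      by (rule plug_additive_arg[OF refl]) (simp_all only: R_sgn2 sgn2_add)
    finally show ?thesis by simp
  qed
  have 4: "theta a X F [(br (map fst W), wt W)] =
      sgn2 (wt X * a) (\<rho> (map fst X) (F [(br (map fst W), wt W)]))
      - F [actl X (br (map fst W), wt W)]"
    by (simp add: theta_def)
  show ?thesis
    unfolding cob.simps 3 4 unfolding theta_def lder_diff 1 lder_plug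
    using X by (simp add: rho_diff sgn2_diff 2)
qed

text \<open>
  Substituting \<open>F\<close> into the entries of \<open>X\<close> produces a combination of inner maps
  \<open>w \<mapsto> [u, v, w]\<close> with \<open>v\<close> in the module, and by \<open>rho_bracket_label\<close> each of them is a
  derivation of the bracket.  This is what makes the first step of \<open>\<delta>\<^sup>2 = 0\<close> work.
\<close>

lemma cob_0_inner:
  assumes X: "graded X" "length X = n - 1" and W: "graded W" "length W = n"
  shows "cob 0 (a + wt X) (\<lambda>U. cob 0 a F (X @ U) - theta a X F U) W = 0"
proof -
  let ?R = "\<lambda>U. \<rho> (map fst U)"
  \<comment> \<open>The inner map of the \<open>i\<close>-th entry; its sign moves \<open>F [X ! i]\<close> behind the argument.\<close>
  define \<psi> where "\<psi> i U = sgn2 ((a + snd (X ! i)) * wt U) (?R (omit i X @ U) (F [X ! i]))" for i U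
  \<comment> \<open>The summand 1 is due to the transposition of \<open>F [X ! i]\<close> with the argument of \<open>\<psi> i\<close>.\<close>
  define k where "k i = 1 + (a * wt (take i X) + (a + snd (X ! i)) * wt (drop (Suc i) X)
      + of_nat (length X - Suc i))" for i
  have len: "length (map fst (omit i X @ [w])) = n - 1" if "i < length X" for i w
    using length_omit[OF that] X by simp
  have 1: "cob 0 a F (X @ [w]) - theta a X F [w] = (\<Sum>i<length X. sgn2 (k i) (\<psi> i [w]))" for w
  proof -
    have "cob 0 a F (X @ [w]) - theta a X F [w]
        = plug a (\<lambda>x. - sgn2 ((a + snd x) * snd w) (F [x])) (\<lambda>U. ?R (U @ [w])) X"
      using plug_snoc[of X ?R a "\<lambda>w. F [w]" w] X
      by (simp add: cob.simps theta_def actl_def rho_minus algebra_simps)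
    also have "\<dots> = (\<Sum>i<length X. sgn2 (k i) (\<psi> i [w]))"
      unfolding plug_index
    proof (rule sum.cong)
      fix i assume "i \<in> {..<length X}"
      then have "i < length X" by simp
      then show "sgn2 (a * wt (take i X) + (a + snd (X ! i)) * wt (drop (Suc i) X)
            + of_nat (length X - Suc i))
          (?R (omit i X @ [w]) (- sgn2 ((a + snd (X ! i)) * snd w) (F [X ! i])))
          = sgn2 (k i) (\<psi> i [w])"
        by (simp only: rho_minus[OF len] rho_sgn2[OF len])
          (simp add: k_def \<psi>_def sgn2_simps)
    qed simp
    finally show ?thesis .
  qed
  have 2: "cob 0 (a + wt X) (\<psi> i) W = 0" if i: "i < length X" for i
  proof -
    let ?c = "a + snd (X ! i)" and ?v = "F [X ! i]"
    have len': "length (omit i X) = n - 2"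
      using length_omit[OF i] X by simp
    have "cob 0 (a + wt X) (\<psi> i) W =
        plug (wt (omit i X) + ?c) (\<lambda>w. sgn2 (?c * snd w) (?R (omit i X @ [w]) ?v)) ?R W
        - sgn2 (?c * wt W) (\<rho> (map fst (omit i X) @ [br (map fst W)]) ?v)"
      using wt_omit[OF i] by (simp add: cob.simps \<psi>_def algebra_simps)
    also have "plug (wt (omit i X) + ?c) (\<lambda>w. sgn2 (?c * snd w) (?R (omit i X @ [w]) ?v)) ?R W
        = sgn2 (?c * wt W) (plug (wt (omit i X)) (\<lambda>w. ?R (omit i X @ [w]) ?v) ?R W)"
    proof (rule plug_shift_degree)
      fix U :: "('g \<times> bit) list" and v
      assume "Suc (length U) = length W"
      then have "length (map fst U) = n - 1" using W by simp
      then show "?R U (- v) = - ?R U v" by (rule rho_minus)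
    qed
    also have "plug (wt (omit i X)) (\<lambda>w. ?R (omit i X @ [w]) ?v) ?R W
        = \<rho> (map fst (omit i X) @ [br (map fst W)]) ?v"
      using rho_bracket_label[of "omit i X" W ?v] graded_omit X W len' by simp
    finally show ?thesis by simp
  qed
  have W': "length W = arity (Suc 0)" using W arity_1 by simp
  have "cob 0 (a + wt X) (\<lambda>U. cob 0 a F (X @ U) - theta a X F U) W
      = cob 0 (a + wt X) (\<lambda>U. \<Sum>i<length X. sgn2 (k i) (\<psi> i U)) W"
  proof (rule cob_cong[OF W(1) W'])
    fix U :: "('g \<times> bit) list" assume "length U = arity 0"
    then obtain w where "U = [w]" by (auto simp: length_Suc_conv)
    then show "cob 0 a F (X @ U) - theta a X F U = (\<Sum>i<length X. sgn2 (k i) (\<psi> i U))"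
      using 1 by simp
  qed
  also have "\<dots> = 0"
    by (simp add: cob_sum[OF W'] cob_sgn2[OF W'] 2)
  finally show ?thesis .
qed

text \<open>
  By the recursion both sides at \<open>Y @ U\<close> split into terms where \<open>X\<close> acts on \<open>Y\<close> and terms where it
  passes \<open>Y\<close>.  Those with \<open>\<theta>\<^sub>Y\<close> match by \<open>theta_commute\<close> and the others by induction.
\<close>

lemma cob_theta:
  assumes "graded X" "length X = n - 1" "graded W" "length W = arity (Suc m)" "mlin (arity m) F"
  shows "cob m (a + wt X) (theta a X F) W = theta a X (cob m a F) W"
  using assms
proof (induction m arbitrary: a F W)
  case 0
  then show ?case using cob_0_theta[of X W F a] arity_1 by simp
next
  case (Suc m)
  note X = Suc.prems(1,2)
  from Suc.prems(4) obtain Y U where W: "W = Y @ U" and Y: "length Y = n - 1"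
    and U: "length U = arity (Suc m)"
    by (rule arity_Suc_cases)
  have YU: "graded Y" "graded U" using Suc.prems W by auto
  have FY: "mlin (arity m) (\<lambda>U. F (Y @ U))"
    by (rule mlin_append) (use Suc.prems Y YU in auto)
  have IH: "cob m (a + wt Y + wt X) (theta (a + wt Y) X (\<lambda>U. F (Y @ U))) U
      = theta (a + wt Y) X (cob m (a + wt Y) (\<lambda>U. F (Y @ U))) U"
    by (rule Suc.IH) (use X U YU FY in auto)
  have "cob (Suc m) (a + wt X) (theta a X F) W
      = theta (a + wt X) Y (theta a X F) U
      - cob m (a + wt X + wt Y) (\<lambda>U. theta a X F (Y @ U)) U"
    unfolding W by (rule cob_append[OF Y])
  also have "cob m (a + wt X + wt Y) (\<lambda>U. theta a X F (Y @ U)) U =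
      sgn2 (wt X * wt Y) (cob m (a + wt X + wt Y) (theta (a + wt Y) X (\<lambda>U. F (Y @ U))) U)
      - lder X (\<lambda>A. cob m (a + wt X + wt Y) (\<lambda>U. F (A @ U)) U) Y"
    unfolding theta_append cob_diff[OF U] cob_sgn2[OF U] cob_lder[OF U] ..
  also have "cob m (a + wt X + wt Y) (theta (a + wt Y) X (\<lambda>U. F (Y @ U))) U
      = theta (a + wt Y) X (cob m (a + wt Y) (\<lambda>U. F (Y @ U))) U"
    using IH by (simp add: algebra_simps)
  also have "theta (a + wt X) Y (theta a X F) U =
      sgn2 (wt X * wt Y) (theta (a + wt Y) X (theta a Y F) U) - lder X (\<lambda>A. theta a A F U) Y"
    by (rule theta_commute) (use X Y YU U Suc.prems in auto)
  finally have L: "cob (Suc m) (a + wt X) (theta a X F) W =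
      sgn2 (wt X * wt Y) (theta (a + wt Y) X (theta a Y F) U) - lder X (\<lambda>A. theta a A F U) Y
      - (sgn2 (wt X * wt Y) (theta (a + wt Y) X (cob m (a + wt Y) (\<lambda>U. F (Y @ U))) U)
        - lder X (\<lambda>A. cob m (a + wt X + wt Y) (\<lambda>U. F (A @ U)) U) Y)" .
  have "theta a X (cob (Suc m) a F) W =
      sgn2 (wt X * wt Y) (theta (a + wt Y) X (\<lambda>U. cob (Suc m) a F (Y @ U)) U)
      - lder X (\<lambda>A. cob (Suc m) a F (A @ U)) Y"
    unfolding W by (rule theta_append)
  also have "lder X (\<lambda>A. cob (Suc m) a F (A @ U)) Y =
      lder X (\<lambda>A. theta a A F U - cob m (a + wt X + wt Y) (\<lambda>U. F (A @ U)) U) Y"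
  proof (rule lder_cong)
    fix A :: "('g \<times> bit) list" assume A: "length A = length Y" "wt A = wt X + wt Y"
    show "cob (Suc m) a F (A @ U)
        = theta a A F U - cob m (a + wt X + wt Y) (\<lambda>U. F (A @ U)) U"
      using cob_append[of A m a F U] A Y by (simp add: add.assoc)
  qed
  finally show ?case
    unfolding L lder_diff cob_append[OF Y] theta_diff[OF X(2)] sgn2_diff
    by (simp add: algebra_simps)
qed

text \<open>
  Expanding twice at \<open>X @ U\<close> leaves \<open>\<theta>\<^sub>X \<delta> F - \<delta> \<theta>\<^sub>X F + \<delta> \<delta> (F (X, \<dots>))\<close>.  The first two terms
  cancel, and the last vanishes by induction.  For \<open>m = 0\<close> there is no recursion for the inner
  coboundary, and \<open>cob_0_inner\<close> takes its place.
\<close>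

theorem cob_cob:
  assumes "graded W" "length W = arity (Suc (Suc m))" "mlin (arity m) F"
  shows "cob (Suc m) a (cob m a F) W = 0"
  using assms
proof (induction m arbitrary: a F W)
  case 0
  from 0(2) obtain X U where W: "W = X @ U" and X: "length X = n - 1"
    and U: "length U = arity (Suc 0)"
    by (rule arity_Suc_cases)
  have "cob (Suc 0) a (cob 0 a F) W
      = theta a X (cob 0 a F) U - cob 0 (a + wt X) (\<lambda>U. cob 0 a F (X @ U)) U"
    unfolding W by (rule cob_append[OF X])
  also have "theta a X (cob 0 a F) U = cob 0 (a + wt X) (theta a X F) U"
    by (rule cob_theta[symmetric]) (use 0 X U W in auto)
  also have "\<dots> - cob 0 (a + wt X) (\<lambda>U. cob 0 a F (X @ U)) U
      = - cob 0 (a + wt X) (\<lambda>U. cob 0 a F (X @ U) - theta a X F U) U"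
    unfolding cob_diff[OF U] by simp
  also have "cob 0 (a + wt X) (\<lambda>U. cob 0 a F (X @ U) - theta a X F U) U = 0"
    by (rule cob_0_inner) (use 0 X U W arity_1 in auto)
  finally show ?case by simp
next
  case (Suc m)
  from Suc.prems(2) obtain X U where W: "W = X @ U" and X: "length X = n - 1"
    and U: "length U = arity (Suc (Suc m))"
    by (rule arity_Suc_cases)
  have XU: "graded X" "graded U" using Suc.prems W by auto
  have FX: "mlin (arity m) (\<lambda>U. F (X @ U))"
    by (rule mlin_append) (use Suc.prems X XU in auto)
  have "cob (Suc (Suc m)) a (cob (Suc m) a F) W
      = theta a X (cob (Suc m) a F) U
      - cob (Suc m) (a + wt X) (\<lambda>U. cob (Suc m) a F (X @ U)) U"
    unfolding W by (rule cob_append[OF X])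
  also have "cob (Suc m) (a + wt X) (\<lambda>U. cob (Suc m) a F (X @ U)) U
      = cob (Suc m) (a + wt X) (theta a X F) U
      - cob (Suc m) (a + wt X) (cob m (a + wt X) (\<lambda>U. F (X @ U))) U"
    unfolding cob_append[OF X] cob_diff[OF U] ..
  also have "cob (Suc m) (a + wt X) (cob m (a + wt X) (\<lambda>U. F (X @ U))) U = 0"
    by (rule Suc.IH) (use XU U FX in auto)
  also have "cob (Suc m) (a + wt X) (theta a X F) U = theta a X (cob (Suc m) a F) U"
    by (rule cob_theta) (use XU X U Suc.prems in auto)
  finally show ?case by simp
qed

section \<open>Multilinearity, degree and skew symmetry of the coboundary\<close>

lemma hlin_cob_param:
  assumes "\<And>U. graded U \<Longrightarrow> length U = arity m \<Longrightarrow> hlin b (\<lambda>x. F x U)"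
    and W: "graded W" "length W = arity (Suc m)"
  shows "hlin b (\<lambda>x. cob m a (F x) W)"
  unfolding hlin_def
proof (intro conjI ballI allI)
  fix x y assume xy: "x \<in> G b" "y \<in> G b"
  have "cob m a (F (x + y)) W = cob m a (\<lambda>U. F x U + F y U) W"
    by (rule cob_cong[OF W]) (use assms(1) xy in \<open>auto simp: hlin_def\<close>)
  then show "cob m a (F (x + y)) W = cob m a (F x) W + cob m a (F y) W"
    using cob_add[OF W(2)] by simp
next
  fix c x assume x: "x \<in> G b"
  have "cob m a (F (sg c x)) W = cob m a (\<lambda>U. sv c (F x U)) W"
    by (rule cob_cong[OF W]) (use assms(1) x in \<open>auto simp: hlin_def\<close>)
  then show "cob m a (F (sg c x)) W = sv c (cob m a (F x) W)"
    using cob_scale[OF W(2)] by simp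
qed

lemma hlin_br_slot:
  assumes "hlin (wt A + b + wt B) g" "Suc (length A + length B) = n" "graded A" "graded B"
  shows "hlin b (\<lambda>x. g (br (map fst A @ x # map fst B)))"
proof (rule hlin_compose[OF assms(1)])
  fix x assume "x \<in> G b"
  then show "br (map fst A @ x # map fst B) \<in> G (wt A + b + wt B)"
    using br_graded[of "A @ (x, b) # B"] assms by (simp add: add.assoc)
qed (use multilinear_slot[OF br_multilinear] assms in simp_all)

lemma hlin_actl_left:
  assumes F: "mlin (Suc (length W)) F" and "graded W" "fst w \<in> G (snd w)"
    and "Suc (length A + length B) = n - 1" "graded A" "graded B"
  shows "hlin b (\<lambda>x. F (actl (A @ (x, b) # B) w # W))"
proof -
  have "hlin b (\<lambda>x. (\<lambda>y. F ((y, wt A + b + wt (B @ [w])) # W))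
      (br (map fst A @ x # map fst (B @ [w]))))"
    by (rule hlin_br_slot[where g = "\<lambda>y. F ((y, wt A + b + wt (B @ [w])) # W)"])
      (use mlin_slot[OF F, of "[]" W] assms in auto)
  then show ?thesis
    by (simp add: actl_def algebra_simps)
qed

lemma hlin_actl_right:
  assumes F: "mlin (Suc (length A + length B)) F" and "graded A" "graded B"
    and "graded X" "length X = n - 1"
  shows "hlin b (\<lambda>x. F (A @ actl X (x, b) # B))"
proof -
  have "hlin b (\<lambda>x. F (A @ (br (map fst X @ [x]), wt X + b) # B))"
    using hlin_br_slot[of X b "[]" "\<lambda>y. F (A @ (y, wt X + b) # B)"] mlin_slot[OF F, of A B]
      assms n_ge_2 by simp
  then show ?thesis
    by (simp add: actl_def)
qed

lemma hlin_lder_left: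
  assumes "mlin (length W) F" "graded W"
    and "Suc (length A + length B) = n - 1" "graded A" "graded B"
  shows "hlin b (\<lambda>x. lder (A @ (x, b) # B) F W)"
  using assms(1,2)
proof (induction W arbitrary: F)
  case (Cons w W)
  have "hlin b (\<lambda>x. F (actl (A @ (x, b) # B) w # W))"
    by (rule hlin_actl_left) (use Cons.prems assms in auto)
  moreover have "hlin b (\<lambda>x. lder (A @ (x, b) # B) (\<lambda>U. F (w # U)) W)"
    by (rule Cons.IH) (use Cons.prems in \<open>auto intro: mlin_Cons\<close>)
  ultimately show ?case
    by (simp add: hlin_add hlin_sgn2)
qed simp

lemma hlin_lder_right:
  assumes F: "mlin (Suc (length A + length B)) F" and AB: "graded A" "graded B"
    and X: "graded X" "length X = n - 1"
  shows "hlin b (\<lambda>x. lder X F (A @ (x, b) # B))"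
proof -
  have "hlin b (\<lambda>x. lder X (\<lambda>U. F (U @ (x, b) # B)) A)"
    by (rule hlin_lder[OF _ X AB(1)], rule mlin_slot[OF F]) (use AB in auto)
  moreover have "hlin b (\<lambda>x. F (A @ actl X (x, b) # B))"
    by (rule hlin_actl_right) (use assms in auto)
  moreover have "hlin b (\<lambda>x. lder X (\<lambda>U. F (A @ (x, b) # U)) B)"
    by (rule hlin_lder[OF _ X AB(2)], rule mlin_slot[OF F]) (use AB in auto)
  ultimately show ?thesis
    by (simp add: lder_append hlin_add hlin_sgn2)
qed

lemma hlin_plug_slot:
  assumes "\<And>v. mlin (length A + length B) (\<lambda>U. R U v)"
    and "\<And>U. graded U \<Longrightarrow> length U = length A + length B \<Longrightarrow> hlin b (\<lambda>x. R U (\<phi> (x, b)))"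
    and "graded A" "graded B"
  shows "hlin b (\<lambda>x. plug a \<phi> R (A @ (x, b) # B))"
  using assms
proof (induction A arbitrary: R)
  case Nil
  have "hlin b (\<lambda>x. R B (\<phi> (x, b)))"
    using Nil by simp
  moreover have "hlin b (\<lambda>x. plug a \<phi> (\<lambda>U. R ((x, b) # U)) B)"
    by (rule hlin_plug, rule mlin_slot[OF Nil(1), of "[]", simplified]) (use Nil in auto)
  ultimately show ?case
    by (simp add: hlin_add hlin_sgn2)
next
  case (Cons w A)
  have "hlin b (\<lambda>x. R (A @ (x, b) # B) (\<phi> w))"
    by (rule mlin_slot[OF Cons.prems(1)]) (use Cons.prems in auto)
  moreover have "hlin b (\<lambda>x. plug a \<phi> (\<lambda>U. R (w # U)) (A @ (x, b) # B))"
    by (rule Cons.IH; (rule mlin_Cons)?) (use Cons.prems in auto)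
  ultimately show ?case
    by (simp add: hlin_add hlin_sgn2)
qed

lemma mlin_cob:
  assumes "mlin (arity m) F"
  shows "mlin (arity (Suc m)) (cob m a F)"
  using assms
proof (induction m arbitrary: a F)
  case 0
  show ?case
    unfolding mlin_def
  proof (intro allI impI)
    fix A b and B :: "('g \<times> bit) list"
    assume "Suc (length A + length B) = arity (Suc 0)" and AB: "graded A" "graded B"
    then have len: "length A + length B = n - 1" "Suc (length A + length B) = n"
      using arity_1 by simp_all
    have F: "hlin c (\<lambda>x. F [(x, c)])" for c
      using mlin_slot[OF 0, of "[]" "[]"] by simp
    have "hlin b (\<lambda>x. plug a (\<lambda>w. F [w]) (\<lambda>U. \<rho> (map fst U)) (A @ (x, b) # B))"
      by (rule hlin_plug_slot)
        (use len AB F in \<open>auto intro!: mlin_multilinear rho_multilinear[simplified] hlin_rho\<close>)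
    moreover have "hlin b (\<lambda>x. (\<lambda>y. F [(y, wt A + b + wt B)]) (br (map fst A @ x # map fst B)))"
      by (rule hlin_br_slot[where g = "\<lambda>y. F [(y, wt A + b + wt B)]"]) (use len AB F in auto)
    ultimately show "hlin b (\<lambda>x. cob 0 a F (A @ (x, b) # B))"
      by (simp add: cob.simps hlin_diff algebra_simps)
  qed
next
  case (Suc m)
  show ?case
    unfolding mlin_def
  proof (intro allI impI)
    fix A b and B :: "('g \<times> bit) list"
    assume len: "Suc (length A + length B) = arity (Suc (Suc m))" and AB: "graded A" "graded B"
    show "hlin b (\<lambda>x. cob (Suc m) a F (A @ (x, b) # B))"
    proof (cases "length A < n - 1")
      case True
      define B1 U where "B1 = take (n - 1 - Suc (length A)) B"
        and "U = drop (n - 1 - Suc (length A)) B"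
      have B: "B = B1 @ U" and gr: "graded B1" "graded U"
        using AB by (simp_all add: B1_def U_def)
      have lB1: "Suc (length A + length B1) = n - 1"
        using True len by (auto simp: B1_def)
      then have lX: "length (A @ (x, b) # B1) = n - 1" for x by simp
      have lU: "length U = arity (Suc m)"
        using len lB1 B by simp
      have 1: "hlin b (\<lambda>x. \<rho> (map fst A @ x # map fst B1) (F U))"
        by (rule hlin_multilinear[OF rho_multilinear]) (use lB1 in simp)
      have 2: "hlin b (\<lambda>x. lder (A @ (x, b) # B1) F U)"
        by (rule hlin_lder_left) (use Suc.prems lU lB1 gr AB in auto)
      have 3: "hlin b (\<lambda>x. cob m (a + (wt A + (b + wt B1))) (\<lambda>V. F ((A @ (x, b) # B1) @ V)) U)"
      proof (rule hlin_cob_param[OF _ gr(2) lU])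
        fix V :: "('g \<times> bit) list" assume "graded V" "length V = arity m"
        then show "hlin b (\<lambda>x. F ((A @ (x, b) # B1) @ V))"
          using mlin_slot[OF Suc.prems, of A "B1 @ V"] lB1 AB gr by simp
      qed
      have "cob (Suc m) a F (A @ (x, b) # B) = theta a (A @ (x, b) # B1) F U
          - cob m (a + (wt A + (b + wt B1))) (\<lambda>V. F ((A @ (x, b) # B1) @ V)) U" for x
        using cob_append[OF lX] B by simp
      then show ?thesis
        using 1 2 3 by (simp add: theta_def hlin_diff hlin_sgn2)
    next
      case False
      define X A1 where "X = take (n - 1) A" and "A1 = drop (n - 1) A"
      have A: "A = X @ A1" and gr: "graded X" "graded A1"
        using AB by (simp_all add: X_def A1_def)
      have lX: "length X = n - 1"
        using False by (simp add: X_def)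
      have lA1: "Suc (length A1 + length B) = arity (Suc m)"
        using len lX A n_ge_2 by auto
      have 1: "hlin b (\<lambda>x. \<rho> (map fst X) (F (A1 @ (x, b) # B)))"
        by (rule hlin_rho) (use lX mlin_slot[OF Suc.prems lA1] gr AB in auto)
      have 2: "hlin b (\<lambda>x. lder X F (A1 @ (x, b) # B))"
        by (rule hlin_lder_right) (use Suc.prems lA1 lX gr AB in auto)
      have "mlin (arity (Suc m)) (cob m (a + wt X) (\<lambda>V. F (X @ V)))"
        by (rule Suc.IH, rule mlin_append) (use Suc.prems lX gr in auto)
      then have 3: "hlin b (\<lambda>x. cob m (a + wt X) (\<lambda>V. F (X @ V)) (A1 @ (x, b) # B))"
        by (rule mlin_slot) (use lA1 gr AB in auto)
      show ?thesis
        unfolding A using cob_append[OF lX] 1 2 3 by (simp add: theta_def hlin_diff hlin_sgn2)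
    qed
  qed
qed

lemma rho_graded:
  assumes "graded X" "length X = n - 1" "v \<in> V c"
  shows "\<rho> (map fst X) v \<in> V (c + wt X)"
  using assms(1)
proof (cases rule: graded_label_cases)
  case 1
  then show ?thesis
    using rho_vanish[of "map fst X" v] assms by simp
next
  case 2
  then have "wt X = degs (map fst X)" by (metis wt_label)
  then show ?thesis
    using rho_degree[of "map fst X" v c] assms graded_homogeneous by simp
qed

lemma lder_degree:
  assumes "\<And>U. graded U \<Longrightarrow> length U = length W \<Longrightarrow> F U \<in> V (c + wt U)"
    and X: "graded X" "length X = n - 1" and "graded W"
  shows "lder X F W \<in> V (c + wt X + wt W)"
  using assms(1,4)
proof (induction W arbitrary: F c)
  case (Cons w W)
  have "F (actl X w # W) \<in> V (c + wt (actl X w # W))"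
    by (rule Cons.prems) (use X Cons.prems in auto)
  moreover have "lder X (\<lambda>U. F (w # U)) W \<in> V ((c + snd w) + wt X + wt W)"
  proof (rule Cons.IH)
    fix U assume "graded U" "length U = length W"
    then show "F (w # U) \<in> V (c + snd w + wt U)"
      using Cons.prems(1)[of "w # U"] Cons.prems(2) by (simp add: add.assoc)
  qed (use Cons.prems in simp)
  ultimately show ?case
    by (simp add: V.H_add V.H_sgn2 algebra_simps)
qed simp

lemma plug_degree:
  assumes "\<And>U w. graded U \<Longrightarrow> Suc (length U) = length W \<Longrightarrow> fst w \<in> G (snd w) \<Longrightarrow>
      R U (\<phi> w) \<in> V (c + wt U + snd w)"
    and "graded W"
  shows "plug a \<phi> R W \<in> V (c + wt W)"
  using assms
proof (induction W arbitrary: R c)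
  case (Cons w W)
  have "R W (\<phi> w) \<in> V (c + wt W + snd w)"
    by (rule Cons.prems) (use Cons.prems in auto)
  moreover have "plug a \<phi> (\<lambda>U. R (w # U)) W \<in> V ((c + snd w) + wt W)"
  proof (rule Cons.IH)
    fix U u assume "graded U" "Suc (length U) = length W" "fst u \<in> G (snd u)"
    then show "R (w # U) (\<phi> u) \<in> V (c + snd w + wt U + snd u)"
      using Cons.prems(1)[of "w # U" u] Cons.prems(2) by (simp add: add.assoc)
  qed (use Cons.prems in simp)
  ultimately show ?case
    by (simp add: V.H_add V.H_sgn2 algebra_simps)
qed simp

lemma cob_degree:
  assumes "\<And>U. graded U \<Longrightarrow> length U = arity m \<Longrightarrow> F U \<in> V (a + wt U)"
    and "graded W" "length W = arity (Suc m)"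
  shows "cob m a F W \<in> V (a + wt W)"
  using assms
proof (induction m arbitrary: a F W)
  case 0
  then have W: "graded W" "length W = n" using arity_1 by simp_all
  have "plug a (\<lambda>w. F [w]) (\<lambda>U. \<rho> (map fst U)) W \<in> V (a + wt W)"
  proof (rule plug_degree[OF _ W(1)])
    fix U w assume U: "graded U" "Suc (length U) = length W" and w: "fst w \<in> G (snd w)"
    then have "length U = n - 1" using W by simp
    moreover have "F [w] \<in> V (a + snd w)" using 0(1)[of "[w]"] w by simp
    ultimately show "\<rho> (map fst U) (F [w]) \<in> V (a + wt U + snd w)"
      using rho_graded[of U "F [w]" "a + snd w"] U by (simp add: algebra_simps)
  qed
  moreover have "F [(br (map fst W), wt W)] \<in> V (a + wt W)"
    using 0(1)[of "[(br (map fst W), wt W)]"] br_graded[OF W] by simp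
  ultimately show ?case by (simp add: cob.simps V.H_diff)
next
  case (Suc m)
  from Suc.prems(3) obtain X U where W: "W = X @ U" and X: "length X = n - 1"
    and U: "length U = arity (Suc m)"
    by (rule arity_Suc_cases)
  have XU: "graded X" "graded U" using Suc.prems W by auto
  have "\<rho> (map fst X) (F U) \<in> V (a + wt U + wt X)"
    by (rule rho_graded) (use XU X U Suc.prems in auto)
  moreover have "lder X F U \<in> V (a + wt X + wt U)"
    by (rule lder_degree) (use XU X U Suc.prems in auto)
  moreover have "cob m (a + wt X) (\<lambda>V. F (X @ V)) U \<in> V ((a + wt X) + wt U)"
  proof (rule Suc.IH)
    fix U assume "graded U" "length U = arity m"
    then show "F (X @ U) \<in> V (a + wt X + wt U)"
      using Suc.prems(1)[of "X @ U"] XU X by (simp add: add.assoc)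
  qed (use XU U in auto)
  ultimately show ?case
    unfolding W cob_append[OF X] theta_def
    by (intro V.H_diff V.H_sgn2) (simp_all add: algebra_simps)
qed

definition skew_at :: "nat \<Rightarrow> (nat \<Rightarrow> bool) \<Rightarrow> (('g \<times> bit) list \<Rightarrow> 'w::ab_group_add) \<Rightarrow> bool" where
  "skew_at N P F \<longleftrightarrow> (\<forall>A x y B. Suc (Suc (length A + length B)) = N \<longrightarrow> P (length A) \<longrightarrow>
     graded (A @ x # y # B) \<longrightarrow> F (A @ x # y # B) = - sgn2 (snd x * snd y) (F (A @ y # x # B)))"

lemma hlin_minus_sgn2:
  assumes "hlin b g" "y \<in> G b"
  shows "g (- sgn2 p y) = - sgn2 p (g y)"
  using hlin_add_sgn2[OF assms(1) zero_in_H assms(2), of "1 + p"] hlin_zero[OF assms(1)]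
  by (simp add: sgn2_Suc_left)

lemma skew_atD:
  assumes "skew_at N P F" "Suc (Suc (length A + length B)) = N" "P (length A)"
    and "graded A" "graded B" "fst x \<in> G (snd x)" "fst y \<in> G (snd y)"
  shows "F (A @ x # y # B) = - sgn2 (snd x * snd y) (F (A @ y # x # B))"
  using assms(1)[unfolded skew_at_def, rule_format, where A = A and x = x and y = y and B = B]
    assms by simp

lemma skew_at_Cons:
  assumes "skew_at (Suc N) P F" "fst w \<in> G (snd w)"
  shows "skew_at N (\<lambda>k. P (Suc k)) (\<lambda>U. F (w # U))"
  unfolding skew_at_def
proof (intro allI impI)
  fix A x y and B :: "('g \<times> bit) list"
  assume "Suc (Suc (length A + length B)) = N" "P (Suc (length A))" "graded (A @ x # y # B)"
  then show "F (w # A @ x # y # B) = - sgn2 (snd x * snd y) (F (w # A @ y # x # B))"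
    using skew_atD[OF assms(1), of "w # A" B x y] assms(2) by simp
qed

lemma skew_at_append:
  assumes "skew_at (length X + N) P F" "graded X" "\<And>k. Q k \<Longrightarrow> P (length X + k)"
  shows "skew_at N Q (\<lambda>U. F (X @ U))"
  unfolding skew_at_def
proof (intro allI impI)
  fix A x y and B :: "('g \<times> bit) list"
  assume "Suc (Suc (length A + length B)) = N" "Q (length A)" "graded (A @ x # y # B)"
  then show "F (X @ A @ x # y # B) = - sgn2 (snd x * snd y) (F (X @ A @ y # x # B))"
    using skew_atD[OF assms(1), of "X @ A" B x y] assms(2,3) by simp
qed

lemma super_skew_label:
  assumes "super_skew N \<phi>" "\<And>xs. length xs = N \<Longrightarrow> 0 \<in> set xs \<Longrightarrow> \<phi> xs = 0"
  shows "skew_at N (\<lambda>_. True) (\<lambda>U. \<phi> (map fst U))"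
  unfolding skew_at_def
proof (intro allI impI)
  fix A x y and B :: "('g \<times> bit) list"
  assume len: "Suc (Suc (length A + length B)) = N" and gr: "graded (A @ x # y # B)"
  let ?W = "A @ x # y # B" and ?W' = "A @ y # x # B"
  show "\<phi> (map fst ?W) = - sgn2 (snd x * snd y) (\<phi> (map fst ?W'))"
  proof (cases "0 \<in> set (map fst ?W)")
    case True
    then have "0 \<in> set (map fst ?W')" by auto
    then have "\<phi> (map fst ?W') = 0" "\<phi> (map fst ?W) = 0"
      using True len by (intro assms(2); simp)+
    then show ?thesis by simp
  next
    case False
    then have "deg (fst x) = snd x" "deg (fst y) = snd y"
      using gr by (auto intro!: deg_unique)
    moreover have "\<phi> (map fst ?W) = - sgn2 (deg (map fst ?W ! length A) * deg (map fst ?W ! Suc (length A)))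
        (\<phi> ((map fst ?W)[length A := map fst ?W ! Suc (length A), Suc (length A) := map fst ?W ! length A]))"
      by (rule assms(1)[unfolded super_skew_def, rule_format])
        (use len graded_homogeneous[OF gr] in auto)
    ultimately show ?thesis
      by (simp add: nth_append list_update_append)
  qed
qed

lemmas br_skew = super_skew_label[OF br_super_skew br_zero]
lemmas rho_skew = super_skew_label[OF rho_super_skew rho_vanish]

lemma skew_at_lder:
  assumes F: "skew_at N P F" and X: "graded X" "length X = n - 1"
  shows "skew_at N P (lder X F)"
  unfolding skew_at_def
proof (intro allI impI)
  fix A x y and B :: "('g \<times> bit) list"
  assume len: "Suc (Suc (length A + length B)) = N" and P: "P (length A)"
    and gr: "graded (A @ x # y # B)"
  have "lder X (\<lambda>U. F (U @ x # y # B)) A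
      = lder X (\<lambda>U. - sgn2 (snd x * snd y) (F (U @ y # x # B))) A"
    by (rule lder_cong, rule skew_atD[OF F]) (use len P gr X n_ge_2 in auto)
  then have 1: "lder X (\<lambda>U. F (U @ x # y # B)) A
      = - sgn2 (snd x * snd y) (lder X (\<lambda>U. F (U @ y # x # B)) A)"
    by (simp add: lder_minus lder_sgn2)
  have "lder X (\<lambda>U. F (A @ x # y # U)) B
      = lder X (\<lambda>U. - sgn2 (snd x * snd y) (F (A @ y # x # U))) B"
    by (rule lder_cong, rule skew_atD[OF F]) (use len P gr X n_ge_2 in auto)
  then have 2: "lder X (\<lambda>U. F (A @ x # y # U)) B
      = - sgn2 (snd x * snd y) (lder X (\<lambda>U. F (A @ y # x # U)) B)"
    by (simp add: lder_minus lder_sgn2)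
  have 3: "F (A @ actl X x # y # B) = - sgn2 (snd (actl X x) * snd y) (F (A @ y # actl X x # B))"
    by (rule skew_atD[OF F]) (use len P gr X n_ge_2 in auto)
  have 4: "F (A @ x # actl X y # B) = - sgn2 (snd x * snd (actl X y)) (F (A @ actl X y # x # B))"
    by (rule skew_atD[OF F]) (use len P gr X n_ge_2 in auto)
  show "lder X F (A @ x # y # B) = - sgn2 (snd x * snd y) (lder X F (A @ y # x # B))"
    unfolding lder_append lder.simps 1 2 3 4 by (simp add: sgn2_simps)
qed

text \<open>
  The two summands in which \<open>x\<close> or \<open>y\<close> is substituted are interchanged by the transposition; in all
  others the transposition takes place inside \<open>R\<close>.
\<close>

lemma skew_at_plug:
  assumes "\<And>v. skew_at N (\<lambda>_. True) (\<lambda>U. R U v)"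
  shows "skew_at (Suc N) (\<lambda>_. True) (plug a \<phi> R)"
  unfolding skew_at_def
proof (intro allI impI)
  fix A x y and B :: "('g \<times> bit) list"
  assume "Suc (Suc (length A + length B)) = Suc N" "graded (A @ x # y # B)"
  then show "plug a \<phi> R (A @ x # y # B) = - sgn2 (snd x * snd y) (plug a \<phi> R (A @ y # x # B))"
    using assms
  proof (induction A arbitrary: N R)
    case Nil
    have "plug a \<phi> (\<lambda>U. R (x # y # U)) B
        = plug a \<phi> (\<lambda>U v. - sgn2 (snd x * snd y) (R (y # x # U) v)) B"
      by (rule plug_cong, simp, rule skew_atD[OF Nil(3), of "[]", simplified])
        (use Nil in \<open>auto simp: graded_def\<close>)
    then show ?case
      by (simp add: plug_minus plug_sgn2) (simp add: sgn2_simps)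
  next
    case (Cons w A)
    obtain N' where N: "N = Suc N'" using Cons.prems(1) by (cases N) auto
    have 1: "R (A @ x # y # B) (\<phi> w) = - sgn2 (snd x * snd y) (R (A @ y # x # B) (\<phi> w))"
      by (rule skew_atD[OF Cons.prems(3)]) (use Cons.prems in auto)
    have 2: "plug a \<phi> (\<lambda>U. R (w # U)) (A @ x # y # B)
        = - sgn2 (snd x * snd y) (plug a \<phi> (\<lambda>U. R (w # U)) (A @ y # x # B))"
    proof (rule Cons.IH)
      show "skew_at N' (\<lambda>_. True) (\<lambda>U. R (w # U) v)" for v
        using skew_at_Cons[of N' "\<lambda>_. True" "\<lambda>U. R U v" w] Cons.prems N by simp
    qed (use Cons.prems N in auto)
    show ?case
      by (simp add: 1 2) (simp add: sgn2_simps)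
  qed
qed

lemma skew_lder_left:
  assumes "mlin (length W) F" "graded W"
    and "Suc (Suc (length A + length B)) = n - 1" "graded (A @ x # y # B)"
  shows "lder (A @ x # y # B) F W = - sgn2 (snd x * snd y) (lder (A @ y # x # B) F W)"
  using assms(1,2)
proof (induction W arbitrary: F)
  case (Cons w W)
  let ?X = "A @ x # y # B" and ?Y = "A @ y # x # B"
  let ?b = "wt ?X + snd w"
  have h: "hlin ?b (\<lambda>z. F ((z, ?b) # W))"
    using mlin_slot[OF Cons.prems(1), of "[]" W ?b] Cons.prems by simp
  have "br (map fst (A @ x # y # B @ [w]))
      = - sgn2 (snd x * snd y) (br (map fst (A @ y # x # B @ [w])))"
    by (rule skew_atD[OF br_skew]) (use assms Cons.prems in auto)
  then have 1: "fst (actl ?X w) = - sgn2 (snd x * snd y) (fst (actl ?Y w))"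
    by (simp add: actl_def)
  have in_b: "fst (actl ?Y w) \<in> G ?b"
    using actl_graded[of ?Y w] assms Cons.prems n_ge_2 by (simp add: algebra_simps)
  have "F (actl ?X w # W) = F ((- sgn2 (snd x * snd y) (fst (actl ?Y w)), ?b) # W)"
    unfolding 1[symmetric] by (simp add: actl_def)
  also have "\<dots> = - sgn2 (snd x * snd y) (F ((fst (actl ?Y w), ?b) # W))"
    by (rule hlin_minus_sgn2[OF h in_b])
  also have "(fst (actl ?Y w), ?b) = actl ?Y w"
    by (simp add: actl_def algebra_simps)
  finally have 2: "F (actl ?X w # W) = - sgn2 (snd x * snd y) (F (actl ?Y w # W))" .
  have 3: "lder ?X (\<lambda>U. F (w # U)) W = - sgn2 (snd x * snd y) (lder ?Y (\<lambda>U. F (w # U)) W)"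
    by (rule Cons.IH) (use Cons.prems in \<open>auto intro: mlin_Cons\<close>)
  show ?case
    by (simp add: 2 3) (simp add: sgn2_simps)
qed simp

text \<open>
  Whether a cochain with \<open>m\<close> fundamental objects is skew symmetric in positions \<open>k\<close> and \<open>k + 1\<close> of
  its concatenated arguments.  The blocks have \<open>n - 1\<close> entries, except that the last one also
  contains the final vector; hence the special case of \<open>k + 1 = n - 1\<close>.  For \<open>m = 0\<close> there is only
  one vector.
\<close>

primrec same_block :: "nat \<Rightarrow> nat \<Rightarrow> bool" where
  "same_block 0 k = False"
| "same_block (Suc m) k \<longleftrightarrow> Suc k < n - 1 \<or> (m = 0 \<and> Suc k = n - 1) \<or>
     (n - 1 \<le> k \<and> same_block m (k - (n - 1)))"

text \<open>
  The defect of a 0-cochain is skew symmetric in all \<open>n\<close> entries since the substitution sum and the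
  bracket are; this is the symmetry that joins the last vector to the last fundamental object.
\<close>

lemma skew_cob:
  assumes "mlin (arity m) F" "skew_at (arity m) (same_block m) F"
  shows "skew_at (arity (Suc m)) (same_block (Suc m)) (cob m a F)"
  using assms
proof (induction m arbitrary: a F)
  case 0
  have "skew_at n (\<lambda>_. True) (cob 0 a F)"
    unfolding skew_at_def
  proof (intro allI impI)
    fix A x y and B :: "('g \<times> bit) list"
    assume len: "Suc (Suc (length A + length B)) = n" and gr: "graded (A @ x # y # B)"
    let ?X = "A @ x # y # B" and ?Y = "A @ y # x # B"
    have h: "hlin (wt ?X) (\<lambda>z. F [(z, wt ?X)])"
      using mlin_slot[OF 0(1), of "[]" "[]"] by simp
    have 1: "plug a (\<lambda>w. F [w]) (\<lambda>U. \<rho> (map fst U)) ?X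
        = - sgn2 (snd x * snd y) (plug a (\<lambda>w. F [w]) (\<lambda>U. \<rho> (map fst U)) ?Y)"
      by (rule skew_atD[OF skew_at_plug[OF rho_skew]]) (use len gr in auto)
    have 2: "br (map fst ?X) = - sgn2 (snd x * snd y) (br (map fst ?Y))"
      by (rule skew_atD[OF br_skew]) (use len gr in auto)
    have in_b: "br (map fst ?Y) \<in> G (wt ?X)"
      using br_graded[of ?Y] len gr by (simp add: algebra_simps)
    have "F [(br (map fst ?X), wt ?X)] = - sgn2 (snd x * snd y) (F [(br (map fst ?Y), wt ?X)])"
      unfolding 2 by (rule hlin_minus_sgn2[OF h in_b])
    also have "wt ?X = wt ?Y" by (simp add: algebra_simps)
    finally have 3: "F [(br (map fst ?X), wt ?X)]
        = - sgn2 (snd x * snd y) (F [(br (map fst ?Y), wt ?Y)])"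
      by (simp add: algebra_simps)
    show "cob 0 a F ?X = - sgn2 (snd x * snd y) (cob 0 a F ?Y)"
      unfolding cob.simps 1 3 by (simp add: sgn2_simps)
  qed
  then have "skew_at n (same_block (Suc 0)) (cob 0 a F)"
    using skew_at_append[of "[]" n "\<lambda>_. True" "cob 0 a F" "same_block (Suc 0)"]
    by (simp del: same_block.simps)
  then show ?case
    by (simp only: arity_1)
next
  case (Suc m)
  show ?case
    unfolding skew_at_def
  proof (intro allI impI)
    fix A x y and B :: "('g \<times> bit) list"
    assume len: "Suc (Suc (length A + length B)) = arity (Suc (Suc m))"
      and P: "same_block (Suc (Suc m)) (length A)" and gr: "graded (A @ x # y # B)"
    show "cob (Suc m) a F (A @ x # y # B)
        = - sgn2 (snd x * snd y) (cob (Suc m) a F (A @ y # x # B))"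
    proof (cases "Suc (length A) < n - 1")
      case True
      define B1 U where "B1 = take (n - 1 - Suc (Suc (length A))) B"
        and "U = drop (n - 1 - Suc (Suc (length A))) B"
      have B: "B = B1 @ U" and gr': "graded B1" "graded U"
        using gr by (simp_all add: B1_def U_def)
      have lB1: "Suc (Suc (length A + length B1)) = n - 1"
        using True len by (auto simp: B1_def)
      have lU: "length U = arity (Suc m)"
        using len lB1 B by simp
      let ?X = "A @ x # y # B1" and ?Y = "A @ y # x # B1"
      have lX: "length ?X = n - 1" "length ?Y = n - 1" using lB1 by simp_all
      have wt: "wt ?X = wt ?Y" by (simp add: algebra_simps)
      have 1: "\<rho> (map fst ?X) (F U) = - sgn2 (snd x * snd y) (\<rho> (map fst ?Y) (F U))"
        by (rule skew_atD[OF rho_skew]) (use lB1 gr gr' in auto)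
      have 2: "lder ?X F U = - sgn2 (snd x * snd y) (lder ?Y F U)"
        by (rule skew_lder_left) (use Suc.prems lU lB1 gr gr' in auto)
      have "cob m (a + wt ?X) (\<lambda>W. F (?X @ W)) U
          = cob m (a + wt ?X) (\<lambda>W. sgn2 (1 + snd x * snd y) (F (?Y @ W))) U"
      proof (rule cob_cong[OF gr'(2) lU])
        fix W :: "('g \<times> bit) list" assume W: "graded W" "length W = arity m"
        have "F (A @ x # y # (B1 @ W)) = - sgn2 (snd x * snd y) (F (A @ y # x # (B1 @ W)))"
          by (rule skew_atD[OF Suc.prems(2)]) (use W lB1 gr gr' True in auto)
        then show "F (?X @ W) = sgn2 (1 + snd x * snd y) (F (?Y @ W))"
          by (simp add: sgn2_Suc_left)
      qed
      then have 3: "cob m (a + wt ?X) (\<lambda>W. F (?X @ W)) U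
          = - sgn2 (snd x * snd y) (cob m (a + wt ?Y) (\<lambda>W. F (?Y @ W)) U)"
        unfolding cob_sgn2[OF lU] by (simp add: sgn2_Suc_left add_ac)
      have "cob (Suc m) a F (?X @ U) = - sgn2 (snd x * snd y) (cob (Suc m) a F (?Y @ U))"
        unfolding cob_append[OF lX(1)] cob_append[OF lX(2)] 3 theta_def 1 2 unfolding wt
        by (simp add: sgn2_simps)
      then show ?thesis
        using B by simp
    next
      case False
      then have k: "n - 1 \<le> length A" "same_block (Suc m) (length A - (n - 1))"
        using P by auto
      define X A1 where "X = take (n - 1) A" and "A1 = drop (n - 1) A"
      have A: "A = X @ A1" and gr': "graded X" "graded A1"
        using gr by (simp_all add: X_def A1_def)
      have lX: "length X = n - 1"
        using k by (simp add: X_def)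
      have lA1: "Suc (Suc (length A1 + length B)) = arity (Suc m)"
        using len lX A by simp
      have P1: "same_block (Suc m) (length A1)"
        using k(2) by (simp add: A1_def)
      have 1: "F (A1 @ x # y # B) = - sgn2 (snd x * snd y) (F (A1 @ y # x # B))"
        by (rule skew_atD[OF Suc.prems(2) lA1 P1]) (use gr gr' in auto)
      have 2: "lder X F (A1 @ x # y # B) = - sgn2 (snd x * snd y) (lder X F (A1 @ y # x # B))"
        by (rule skew_atD[OF skew_at_lder[OF Suc.prems(2) gr'(1) lX] lA1 P1]) (use gr gr' in auto)
      have "skew_at (arity (Suc m)) (same_block (Suc m)) (cob m (a + wt X) (\<lambda>W. F (X @ W)))"
      proof (rule Suc.IH)
        show "mlin (arity m) (\<lambda>W. F (X @ W))"
          by (rule mlin_append) (use Suc.prems lX gr' in auto)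
        show "skew_at (arity m) (same_block m) (\<lambda>W. F (X @ W))"
        proof (rule skew_at_append)
          show "skew_at (length X + arity m) (same_block (Suc m)) F"
            using Suc.prems(2) lX by (simp del: same_block.simps)
        qed (use lX gr' n_ge_2 in auto)
      qed
      then have 3: "cob m (a + wt X) (\<lambda>W. F (X @ W)) (A1 @ x # y # B)
          = - sgn2 (snd x * snd y) (cob m (a + wt X) (\<lambda>W. F (X @ W)) (A1 @ y # x # B))"
        by (rule skew_atD) (use lA1 P1 gr gr' in auto)
      have "cob (Suc m) a F (X @ (A1 @ x # y # B))
          = - sgn2 (snd x * snd y) (cob (Suc m) a F (X @ (A1 @ y # x # B)))"
        unfolding cob_append[OF lX] 3 theta_def 1 2 using lX
        by (simp add: sgn2_simps rho_minus rho_sgn2)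
      then show ?thesis
        using A by simp
    qed
  qed
qed

section \<open>Multilinear extension\<close>

lemma mlin_relabel:
  assumes "mlin (length W) F" "graded W"
  shows "F (label (map fst W)) = F W"
  using assms(2)
proof (cases rule: graded_label_cases)
  case 1
  have "F W = 0" by (rule mlin_zero) (use 1 assms in auto)
  moreover have "F (label (map fst W)) = 0"
    by (rule mlin_zero) (use 1 assms graded_homogeneous in auto)
  ultimately show ?thesis by simp
qed simp

text \<open>
  One of the two components of a homogeneous vector is 0 and contributes nothing.
\<close>

lemma ext_Cons_homogeneous:
  assumes "mlin (Suc (length xs)) F" "x \<in> G b"
  shows "ext F (x # xs) = ext (\<lambda>U. F ((x, b) # U)) xs"
proof -
  have "ext (\<lambda>U. F ((0, c) # U)) xs = ext (\<lambda>U. 0) xs" for c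
    by (rule ext_cong, rule mlin_zero[OF assms(1)]) simp_all
  then show ?thesis
    using part_same[OF assms(2)] part_other[OF assms(2)] by (cases b) auto
qed

lemma ext_graded:
  assumes "mlin (length W) F" "graded W"
  shows "ext F (map fst W) = F W"
  using assms
proof (induction W arbitrary: F)
  case (Cons w W)
  have "ext (\<lambda>U. F (w # U)) (map fst W) = F (w # W)"
    by (rule Cons.IH) (use Cons.prems in \<open>auto intro: mlin_Cons\<close>)
  then show ?case
    using ext_Cons_homogeneous[of "map fst W" F "fst w" "snd w"] Cons.prems by simp
qed simp

lemma ext_slot:
  assumes "mlin (Suc (length xs + length ys)) F"
  shows "Vector_Spaces.linear sg sv (\<lambda>x. ext F (xs @ x # ys))"
  unfolding Vector_Spaces.linear_iff
proof (intro conjI allI)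
  show "ext F (xs @ (x + y) # ys) = ext F (xs @ x # ys) + ext F (xs @ y # ys)" for x y
    using assms
  proof (induction xs arbitrary: F)
    case Nil
    have "ext (\<lambda>U. F ((part a (x + y), a) # U)) ys
        = ext (\<lambda>U. F ((part a x, a) # U) + F ((part a y, a) # U)) ys" for a
      by (rule ext_cong)
        (use mlin_slot[OF Nil, of "[]" _ a] in \<open>simp add: hlin_def part_add part_split\<close>)
    then show ?case by (simp add: ext_add algebra_simps)
  next
    case (Cons z xs)
    have "ext (\<lambda>U. F ((part a z, a) # U)) (xs @ (x + y) # ys)
        = ext (\<lambda>U. F ((part a z, a) # U)) (xs @ x # ys)
          + ext (\<lambda>U. F ((part a z, a) # U)) (xs @ y # ys)" for a
      by (rule Cons.IH, rule mlin_Cons) (use Cons.prems part_split in auto)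
    then show ?case by (simp add: algebra_simps)
  qed
  show "ext F (xs @ sg c x # ys) = sv c (ext F (xs @ x # ys))" for c x
    using assms
  proof (induction xs arbitrary: F)
    case Nil
    have "ext (\<lambda>U. F ((part a (sg c x), a) # U)) ys
        = ext (\<lambda>U. sv c (F ((part a x, a) # U))) ys" for a
      by (rule ext_cong)
        (use mlin_slot[OF Nil, of "[]" _ a] in \<open>simp add: hlin_def part_scale part_split\<close>)
    then show ?case
      by (simp add: ext_additive[of "sv c"] V.scale_right_distrib)
  next
    case (Cons z xs)
    have "ext (\<lambda>U. F ((part a z, a) # U)) (xs @ sg c x # ys)
        = sv c (ext (\<lambda>U. F ((part a z, a) # U)) (xs @ x # ys))" for a
      by (rule Cons.IH, rule mlin_Cons) (use Cons.prems part_split in auto)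
    then show ?case by (simp add: V.scale_right_distrib)
  qed
qed (rule vector_space_axioms V.vector_space_axioms)+

lemma ext_skew:
  assumes "mlin N F" "skew_at N P F" "Suc (Suc (length xs + length ys)) = N" "P (length xs)"
    and "homogeneous x" "homogeneous y"
  shows "ext F (xs @ x # y # ys) = - sgn2 (deg x * deg y) (ext F (xs @ y # x # ys))"
  using assms(1-4)
proof (induction xs arbitrary: F N P)
  case Nil
  have x: "x \<in> G (deg x)" and y: "y \<in> G (deg y)"
    using assms homogeneous_deg by auto
  have m: "mlin (Suc (Suc (length ys))) F" using Nil by simp
  have *: "ext F (u # v # ys) = ext (\<lambda>U. F ((u, b) # (v, c) # U)) ys"
    if "u \<in> G b" "v \<in> G c" for u v b c
  proof -
    have "ext F (u # v # ys) = ext (\<lambda>U. F ((u, b) # U)) (v # ys)"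
      by (rule ext_Cons_homogeneous) (use m that in auto)
    also have "\<dots> = ext (\<lambda>U. F ((u, b) # (v, c) # U)) ys"
      by (rule ext_Cons_homogeneous, rule mlin_Cons) (use m that in auto)
    finally show ?thesis .
  qed
  have "ext (\<lambda>U. F ((x, deg x) # (y, deg y) # U)) ys
      = ext (\<lambda>U. - sgn2 (deg x * deg y) (F ((y, deg y) # (x, deg x) # U))) ys"
    by (rule ext_cong) (use skew_atD[OF Nil(2), of "[]" _ "(x, deg x)" "(y, deg y)"] Nil x y in auto)
  then show ?case
    using *[OF x y] *[OF y x] by (simp add: ext_minus_sgn2)
next
  case (Cons z xs)
  obtain N' where N: "N = Suc N'" using Cons.prems(3) by (cases N) auto
  have "ext (\<lambda>U. F ((part a z, a) # U)) (xs @ x # y # ys)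
      = - sgn2 (deg x * deg y) (ext (\<lambda>U. F ((part a z, a) # U)) (xs @ y # x # ys))" for a
  proof (rule Cons.IH)
    show "mlin N' (\<lambda>U. F ((part a z, a) # U))"
      by (rule mlin_Cons) (use Cons.prems N part_split in auto)
    show "skew_at N' (\<lambda>k. P (Suc k)) (\<lambda>U. F ((part a z, a) # U))"
      by (rule skew_at_Cons) (use Cons.prems N part_split in auto)
  qed (use Cons.prems N in auto)
  then show ?case by (simp add: sgn2_add)
qed

section \<open>Flat and nested argument lists\<close>

text \<open>
  The fundamental objects in a concatenated list of arguments; the final vector is left over.
\<close>

primrec blocks :: "nat \<Rightarrow> 'a list \<Rightarrow> 'a list list" where
  "blocks 0 xs = []"
| "blocks (Suc m) xs = take (n - 1) xs # blocks m (drop (n - 1) xs)"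

definition flat :: "nat \<Rightarrow> ('g list list \<Rightarrow> 'g \<Rightarrow> 'v) \<Rightarrow> ('g \<times> bit) list \<Rightarrow> 'v" where
  "flat m f W = f (blocks m (map fst W)) (last (map fst W))"

lemma fo_list_Cons [simp]: "fo_list (Suc m) (X # Xs) \<longleftrightarrow> length X = n - 1 \<and> fo_list m Xs"
  by (auto simp: fo_list_def)

lemma fo_list_Suc_cases:
  assumes "fo_list (Suc m) Xs"
  obtains X Ys where "Xs = X # Ys" "length X = n - 1" "fo_list m Ys"
  using assms by (cases Xs) (auto simp: fo_list_def)

lemma fo_list_0 [simp]: "fo_list 0 Xs \<longleftrightarrow> Xs = []"
  by (auto simp: fo_list_def)

lemma blocks_concat: "fo_list m Xs \<Longrightarrow> blocks m (concat Xs @ zs) = Xs"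
  by (induction m arbitrary: Xs) (auto elim!: fo_list_Suc_cases)

lemma fo_list_blocks: "length xs = arity m \<Longrightarrow> fo_list m (blocks m xs)"
  using n_ge_2 by (induction m arbitrary: xs) auto

lemma concat_blocks: "length xs = arity m \<Longrightarrow> concat (blocks m xs) @ [last xs] = xs"
proof (induction m arbitrary: xs)
  case 0
  then show ?case by (auto simp: length_Suc_conv)
next
  case (Suc m)
  then have "length (drop (n - 1) xs) = arity m"
    using n_ge_2 by auto
  with Suc.IH have "concat (blocks m (drop (n - 1) xs)) @ [last (drop (n - 1) xs)] = drop (n - 1) xs"
    by blast
  moreover have "last (drop (n - 1) xs) = last xs"
    using Suc.prems n_ge_2 by (intro last_drop) auto
  ultimately show ?case by simp
qed

lemma length_concat_fo_list: "fo_list m Xs \<Longrightarrow> length (concat Xs) = m * (n - 1)"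
  by (induction m arbitrary: Xs) (auto elim!: fo_list_Suc_cases)

lemma flat_append:
  "length X = n - 1 \<Longrightarrow> U \<noteq> [] \<Longrightarrow> flat (Suc m) f (X @ U) = flat m (\<lambda>Ys. f (map fst X # Ys)) U"
  by (simp add: flat_def drop_map take_map)

lemma flat_label: "fo_list m Xs \<Longrightarrow> flat m f (label (concat Xs @ [z])) = f Xs z"
  unfolding flat_def label_simps(5) by (simp add: blocks_concat)

text \<open>The conditions on cochains apart from the normalisation on lists of the wrong shape.\<close>

definition cochain_like :: "nat \<Rightarrow> ('g list list \<Rightarrow> 'g \<Rightarrow> 'v) \<Rightarrow> bool" where
  "cochain_like m f \<longleftrightarrow>
     (\<forall>Xs. fo_list m Xs \<longrightarrow> Vector_Spaces.linear sg sv (f Xs)) \<and>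
     (\<forall>Xs z i. fo_list m Xs \<longrightarrow> i < m \<longrightarrow>
        multilinear sg sv (n - 1) (\<lambda>X. f (Xs[i := X]) z) \<and>
        super_skew (n - 1) (\<lambda>X. f (Xs[i := X]) z)) \<and>
     (\<forall>Xs. fo_list m Xs \<longrightarrow> 0 < m \<longrightarrow>
        super_skew n (\<lambda>W. f (Xs[m - 1 := butlast W]) (last W)))"

lemma cochain_like_Cons:
  assumes "cochain_like (Suc m) f" "length X = n - 1"
  shows "cochain_like m (\<lambda>Xs. f (X # Xs))"
  unfolding cochain_like_def
proof (intro conjI allI impI)
  fix Xs assume "fo_list m Xs"
  then have XXs: "fo_list (Suc m) (X # Xs)" using assms by simp
  then show "Vector_Spaces.linear sg sv (f (X # Xs))"
    using assms(1) unfolding cochain_like_def by blast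
  show "multilinear sg sv (n - 1) (\<lambda>Y. f (X # Xs[i := Y]) z)"
    "super_skew (n - 1) (\<lambda>Y. f (X # Xs[i := Y]) z)" if "i < m" for i z
  proof -
    have "multilinear sg sv (n - 1) (\<lambda>Y. f ((X # Xs)[Suc i := Y]) z) \<and>
        super_skew (n - 1) (\<lambda>Y. f ((X # Xs)[Suc i := Y]) z)"
      using assms(1) XXs that unfolding cochain_like_def by blast
    then show "multilinear sg sv (n - 1) (\<lambda>Y. f (X # Xs[i := Y]) z)"
      "super_skew (n - 1) (\<lambda>Y. f (X # Xs[i := Y]) z)" by simp_all
  qed
  show "super_skew n (\<lambda>W. f (X # Xs[m - 1 := butlast W]) (last W))" if "0 < m"
  proof -
    have "super_skew n (\<lambda>W. f ((X # Xs)[Suc m - 1 := butlast W]) (last W))"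
      using assms(1) XXs unfolding cochain_like_def by blast
    moreover have "(X # Xs)[Suc m - 1 := Y] = X # Xs[m - 1 := Y]" for Y
      using that by (cases m) simp_all
    ultimately show ?thesis by simp
  qed
qed

text \<open>
  Stated without list updates, the conditions on the first fundamental object are what an induction
  over the blocks needs.
\<close>

lemma cochain_like_first:
  assumes "cochain_like (Suc m) f" "fo_list m Xs"
  shows "multilinear sg sv (n - 1) (\<lambda>X. f (X # Xs) z)" "super_skew (n - 1) (\<lambda>X. f (X # Xs) z)"
proof -
  have "fo_list (Suc m) (replicate (n - 1) 0 # Xs)" using assms by simp
  then have "multilinear sg sv (n - 1) (\<lambda>X. f ((replicate (n - 1) 0 # Xs)[0 := X]) z) \<and>
      super_skew (n - 1) (\<lambda>X. f ((replicate (n - 1) 0 # Xs)[0 := X]) z)"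
    using assms(1) unfolding cochain_like_def by blast
  then show "multilinear sg sv (n - 1) (\<lambda>X. f (X # Xs) z)"
    "super_skew (n - 1) (\<lambda>X. f (X # Xs) z)" by simp_all
qed

lemma mlin_flat:
  assumes "cochain_like m f"
  shows "mlin (arity m) (flat m f)"
  using assms
proof (induction m arbitrary: f)
  case 0
  then have "Vector_Spaces.linear sg sv (f [])"
    by (simp add: cochain_like_def)
  then show ?case
    by (auto simp: mlin_def hlin_def flat_def Vector_Spaces.linear_iff)
next
  case (Suc m)
  show ?case
    unfolding mlin_def
  proof (intro allI impI)
    fix A b and B :: "('g \<times> bit) list"
    assume len: "Suc (length A + length B) = arity (Suc m)" and gr: "graded A" "graded B"
    show "hlin b (\<lambda>x. flat (Suc m) f (A @ (x, b) # B))"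
    proof (cases "length A < n - 1")
      case True
      define B1 U where "B1 = take (n - 1 - Suc (length A)) B"
        and "U = drop (n - 1 - Suc (length A)) B"
      have B: "B = B1 @ U" by (simp add: B1_def U_def)
      have lB1: "Suc (length A + length B1) = n - 1"
        using True len by (auto simp: B1_def)
      then have lX: "length (A @ (x, b) # B1) = n - 1" for x by simp
      have lU: "length U = arity m"
        using len lB1 B by simp
      have "flat (Suc m) f (A @ (x, b) # B)
          = f ((map fst A @ x # map fst B1) # blocks m (map fst U)) (last (map fst U))" for x
      proof -
        have "flat (Suc m) f ((A @ (x, b) # B1) @ U)
            = flat m (\<lambda>Ys. f (map fst (A @ (x, b) # B1) # Ys)) U"
          by (rule flat_append[OF lX]) (use lU in auto)
        then show ?thesis using B by (simp add: flat_def[of m])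
      qed
      moreover have "hlin b (\<lambda>x. f ((map fst A @ x # map fst B1) # blocks m (map fst U))
          (last (map fst U)))"
        by (rule hlin_multilinear[OF cochain_like_first(1)[OF Suc.prems fo_list_blocks]])
          (use lU lB1 in auto)
      ultimately show ?thesis by simp
    next
      case False
      define X A1 where "X = take (n - 1) A" and "A1 = drop (n - 1) A"
      have A: "A = X @ A1" and gr': "graded A1"
        using gr by (simp_all add: X_def A1_def)
      have lX: "length X = n - 1"
        using False by (simp add: X_def)
      have lA1: "Suc (length A1 + length B) = arity m"
        using len lX A n_ge_2 by auto
      have "mlin (arity m) (flat m (\<lambda>Ys. f (map fst X # Ys)))"
        by (rule Suc.IH, rule cochain_like_Cons) (use Suc.prems lX in auto)
      then have "hlin b (\<lambda>x. flat m (\<lambda>Ys. f (map fst X # Ys)) (A1 @ (x, b) # B))"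
        by (rule mlin_slot) (use lA1 gr gr' in auto)
      then show ?thesis
        using A lX by (simp add: flat_append)
    qed
  qed
qed

lemma skew_flat:
  assumes "cochain_like m f"
  shows "skew_at (arity m) (same_block m) (flat m f)"
  using assms
proof (induction m arbitrary: f)
  case 0
  then show ?case by (simp add: skew_at_def)
next
  case (Suc m)
  show ?case
    unfolding skew_at_def
  proof (intro allI impI)
    fix A x y and B :: "('g \<times> bit) list"
    assume len: "Suc (Suc (length A + length B)) = arity (Suc m)"
      and P: "same_block (Suc m) (length A)" and gr: "graded (A @ x # y # B)"
    let ?P = "\<lambda>F. F (A @ x # y # B) = - sgn2 (snd x * snd y) (F (A @ y # x # B))"
    consider "Suc (length A) < n - 1" | "m = 0" "Suc (length A) = n - 1"
      | "n - 1 \<le> length A" "same_block m (length A - (n - 1))"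
      using P by auto
    then show "?P (flat (Suc m) f)"
    proof cases
      case 1
      define B1 U where "B1 = take (n - 1 - Suc (Suc (length A))) B"
        and "U = drop (n - 1 - Suc (Suc (length A))) B"
      have B: "B = B1 @ U" and gr': "graded B1"
        using gr by (simp_all add: B1_def U_def)
      have lB1: "Suc (Suc (length A + length B1)) = n - 1"
        using 1 len by (auto simp: B1_def)
      then have lX: "length (A @ u # v # B1) = n - 1" for u v by simp
      have lU: "length U = arity m"
        using len lB1 B by simp
      then have fo: "fo_list m (blocks m (map fst U))"
        by (intro fo_list_blocks) simp
      have "flat (Suc m) f (A @ u # v # B)
          = (\<lambda>X. f (map fst X # blocks m (map fst U)) (last (map fst U))) (A @ u # v # B1)" for u v
      proof -
        have "flat (Suc m) f ((A @ u # v # B1) @ U)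
            = flat m (\<lambda>Ys. f (map fst (A @ u # v # B1) # Ys)) U"
          by (rule flat_append[OF lX]) (use lU in auto)
        then show ?thesis using B by (simp add: flat_def[of m])
      qed
      moreover have "skew_at (n - 1) (\<lambda>_. True)
          (\<lambda>X. f (map fst X # blocks m (map fst U)) (last (map fst U)))"
        by (rule super_skew_label[OF cochain_like_first(2)[OF Suc.prems fo]],
            rule multilinear_zero[OF cochain_like_first(1)[OF Suc.prems fo]])
      then have "f (map fst (A @ x # y # B1) # blocks m (map fst U)) (last (map fst U))
          = - sgn2 (snd x * snd y)
              (f (map fst (A @ y # x # B1) # blocks m (map fst U)) (last (map fst U)))"
        by (rule skew_atD) (use lB1 gr gr' in auto)
      ultimately show ?thesis by simp
    next
      case 2
      then have len': "Suc (Suc (length A + length B)) = n"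
        using len arity_1 by simp
      have flat1: "flat (Suc m) f W = (\<lambda>W. f [butlast W] (last W)) (map fst W)" if "length W = n" for W
        using that 2 by (simp add: flat_def butlast_conv_take)
      have fo: "fo_list (Suc m) [replicate (n - 1) 0]" using 2 by simp
      have sk: "super_skew n (\<lambda>W. f [butlast W] (last W))"
      proof -
        have "super_skew n (\<lambda>W. f ([replicate (n - 1) 0][Suc m - 1 := butlast W]) (last W))"
          using Suc.prems fo unfolding cochain_like_def by blast
        then show ?thesis using 2 by simp
      qed
      have van: "f [butlast xs] (last xs) = 0" if xs: "length xs = n" "0 \<in> set xs" for xs
      proof (cases "0 \<in> set (butlast xs)")
        case True
        have "multilinear sg sv (n - 1) (\<lambda>X. f [X] (last xs))"
          using cochain_like_first(1)[OF Suc.prems, of "[]"] 2 by simp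
        from multilinear_zero[OF this, of "butlast xs"] True xs show ?thesis by simp
      next
        case False
        have "xs = butlast xs @ [last xs]"
          using xs by (metis append_butlast_last_id length_greater_0_conv list.size(3) not_numeral_le_zero n_ge_2)
        with False xs have "last xs = 0"
          by (metis Un_iff empty_iff insert_iff list.set(1) list.simps(15) set_append)
        moreover have "Vector_Spaces.linear sg sv (f [butlast xs])"
          using Suc.prems xs 2 unfolding cochain_like_def by simp
        ultimately show ?thesis
          unfolding Vector_Spaces.linear_iff by (metis additive_zero)
      qed
      have "?P (\<lambda>W. (\<lambda>W. f [butlast W] (last W)) (map fst W))"
        by (rule skew_atD[OF super_skew_label[OF sk van]]) (use len' gr in auto)
      then show ?thesis
        using flat1 len' by simp
    next
      case 3
      define X A1 where "X = take (n - 1) A" and "A1 = drop (n - 1) A"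
      have A: "A = X @ A1" and gr': "graded A1"
        using gr by (simp_all add: X_def A1_def)
      have lX: "length X = n - 1"
        using 3 by (simp add: X_def)
      have lA1: "Suc (Suc (length A1 + length B)) = arity m"
        using len lX A by simp
      have "skew_at (arity m) (same_block m) (flat m (\<lambda>Ys. f (map fst X # Ys)))"
        by (rule Suc.IH, rule cochain_like_Cons) (use Suc.prems lX in auto)
      then have "flat m (\<lambda>Ys. f (map fst X # Ys)) (A1 @ x # y # B)
          = - sgn2 (snd x * snd y) (flat m (\<lambda>Ys. f (map fst X # Ys)) (A1 @ y # x # B))"
        by (rule skew_atD) (use lA1 3 gr gr' in \<open>auto simp: A1_def\<close>)
      then show ?thesis
        using A lX by (simp add: flat_append)
    qed
  qed
qed

lemma same_block_inner: "Suc i < n - 1 \<Longrightarrow> j < m \<Longrightarrow> same_block m (j * (n - 1) + i)"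
proof (induction m arbitrary: j)
  case (Suc m)
  then show ?case by (cases j) auto
qed simp

lemma same_block_last: "Suc i < n \<Longrightarrow> same_block (Suc m) (m * (n - 1) + i)"
proof (induction m)
  case (Suc m)
  then show ?case using n_ge_2 by auto
qed auto

text \<open>
  The inverse of \<open>flat\<close>: the cochain on arbitrary arguments that is determined by a function of
  graded lists.
\<close>

definition nest :: "nat \<Rightarrow> (('g \<times> bit) list \<Rightarrow> 'v) \<Rightarrow> 'g list list \<Rightarrow> 'g \<Rightarrow> 'v" where
  "nest m F Xs z = (if fo_list m Xs then ext F (concat Xs @ [z]) else 0)"

lemma adjacent_split:
  assumes "Suc i < length xs"
  shows "xs = take i xs @ xs ! i # xs ! Suc i # drop (Suc (Suc i)) xs"
    "xs[i := xs ! Suc i, Suc i := xs ! i] = take i xs @ xs ! Suc i # xs ! i # drop (Suc (Suc i)) xs"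
proof -
  show "xs = take i xs @ xs ! i # xs ! Suc i # drop (Suc (Suc i)) xs"
    using assms by (simp add: Cons_nth_drop_Suc)
  from arg_cong[OF this, of "\<lambda>zs. zs[i := xs ! Suc i, Suc i := xs ! i]"]
  show "xs[i := xs ! Suc i, Suc i := xs ! i] = take i xs @ xs ! Suc i # xs ! i # drop (Suc (Suc i)) xs"
    using assms by (simp add: list_update_append)
qed

lemma super_skew_ext:
  assumes F: "mlin N F" "skew_at N P F" and len: "length us + k + length ws = N"
    and P: "\<And>i. Suc i < k \<Longrightarrow> P (length us + i)"
  shows "super_skew k (\<lambda>X. ext F (us @ X @ ws))"
  unfolding super_skew_def
proof (intro allI impI)
  fix xs :: "'g list" and i
  assume xs: "length xs = k" "list_all homogeneous xs" "Suc i < k"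
  let ?p = "take i xs" and ?x = "xs ! i" and ?y = "xs ! Suc i" and ?q = "drop (Suc (Suc i)) xs"
  have split: "xs = ?p @ ?x # ?y # ?q" "xs[i := ?y, Suc i := ?x] = ?p @ ?y # ?x # ?q"
    using adjacent_split xs by auto
  have "ext F ((us @ ?p) @ ?x # ?y # (?q @ ws))
      = - sgn2 (deg ?x * deg ?y) (ext F ((us @ ?p) @ ?y # ?x # (?q @ ws)))"
    by (rule ext_skew[OF F]) (use xs len P in \<open>auto simp: list_all_length\<close>)
  then show "ext F (us @ xs @ ws)
      = - sgn2 (deg ?x * deg ?y) (ext F (us @ xs[i := ?y, Suc i := ?x] @ ws))"
    unfolding split(2) by (subst (1) split(1)) simp
qed

lemma multilinear_ext:
  assumes F: "mlin N F" and len: "length us + k + length ws = N"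
  shows "multilinear sg sv k (\<lambda>X. ext F (us @ X @ ws))"
  unfolding multilinear_def
proof (intro allI impI)
  fix xs :: "'g list" and i
  assume xs: "length xs = k" "i < k"
  have "Vector_Spaces.linear sg sv (\<lambda>x. ext F ((us @ take i xs) @ x # (drop (Suc i) xs @ ws)))"
  proof (rule ext_slot)
    have "Suc (length (us @ take i xs) + length (drop (Suc i) xs @ ws)) = N"
      using len xs by simp
    then show "mlin (Suc (length (us @ take i xs) + length (drop (Suc i) xs @ ws))) F"
      using F by simp
  qed
  then show "Vector_Spaces.linear sg sv (\<lambda>x. ext F (us @ xs[i := x] @ ws))"
    using xs by (simp add: upd_conv_take_nth_drop)
qed

lemma nest_cochain:
  assumes F: "mlin (arity m) F" "skew_at (arity m) (same_block m) F"
  shows "nest m F \<in> cochains m"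
proof -
  have "cochain_like m (nest m F)"
    unfolding cochain_like_def
  proof (intro conjI allI impI)
    fix Xs assume Xs: "fo_list m Xs"
    then have lXs: "length Xs = m" "length (concat Xs) = m * (n - 1)"
      using length_concat_fo_list by (auto simp: fo_list_def)
    show "Vector_Spaces.linear sg sv (nest m F Xs)"
      using ext_slot[of "concat Xs" "[]" F] F(1) Xs lXs by (simp add: nest_def[abs_def])
    {
      fix i z assume i: "i < m"
      let ?us = "concat (take i Xs)" and ?ws = "concat (drop (Suc i) Xs) @ [z]"
      have fo: "fo_list i (take i Xs)" "fo_list (m - Suc i) (drop (Suc i) Xs)"
        using Xs i by (auto simp: fo_list_def dest: in_set_takeD in_set_dropD)
      have us: "length ?us = i * (n - 1)"
        by (rule length_concat_fo_list[OF fo(1)])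
      have ws: "length ?ws = Suc ((m - Suc i) * (n - 1))"
        using length_concat_fo_list[OF fo(2)] by simp
      have "i * (n - 1) + (n - 1) + (m - Suc i) * (n - 1) = (i + 1 + (m - Suc i)) * (n - 1)"
        by (simp only: distrib_right mult_1)
      also have "i + 1 + (m - Suc i) = m" using i by simp
      finally have len: "length ?us + (n - 1) + length ?ws = arity m"
        using us ws by simp
      have eq: "nest m F (Xs[i := X]) z = ext F (?us @ X @ ?ws)" if "length X = n - 1" for X
      proof -
        have "fo_list m (Xs[i := X])"
          using Xs that by (auto simp: fo_list_def dest: set_update_subset_insert[THEN subsetD])
        then show ?thesis
          using i lXs by (simp add: nest_def upd_conv_take_nth_drop)
      qed
      have "multilinear sg sv (n - 1) (\<lambda>X. ext F (?us @ X @ ?ws))"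
        by (rule multilinear_ext[OF F(1) len])
      then show "multilinear sg sv (n - 1) (\<lambda>X. nest m F (Xs[i := X]) z)"
        unfolding multilinear_def using eq by simp
      have "super_skew (n - 1) (\<lambda>X. ext F (?us @ X @ ?ws))"
        by (rule super_skew_ext[OF F len]) (use same_block_inner i us in auto)
      then show "super_skew (n - 1) (\<lambda>X. nest m F (Xs[i := X]) z)"
        unfolding super_skew_def using eq by simp
    }
    show "super_skew n (\<lambda>W. nest m F (Xs[m - 1 := butlast W]) (last W))" if m: "0 < m"
    proof -
      obtain k where k: "m = Suc k" using m by (cases m) auto
      let ?us = "concat (take k Xs)"
      have "fo_list k (take k Xs)"
        using Xs k by (auto simp: fo_list_def dest: in_set_takeD)
      then have us: "length ?us = k * (n - 1)"
        by (rule length_concat_fo_list)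
      have len: "length ?us + n + length ([] :: 'g list) = arity m"
        using us k n_ge_2 by simp
      have eq: "nest m F (Xs[m - 1 := butlast W]) (last W) = ext F (?us @ W @ [])"
        if "length W = n" for W
      proof -
        have W: "butlast W @ [last W] = W" using that n_ge_2 by (intro append_butlast_last_id) auto
        have "Xs[k := butlast W] = take k Xs @ [butlast W]"
          using k lXs by (simp add: upd_conv_take_nth_drop)
        moreover have "fo_list m (Xs[k := butlast W])"
          using Xs that by (auto simp: fo_list_def dest: set_update_subset_insert[THEN subsetD])
        ultimately show ?thesis
          using k W by (simp add: nest_def)
      qed
      have "super_skew n (\<lambda>X. ext F (?us @ X @ []))"
        by (rule super_skew_ext[OF F len]) (use same_block_last us k in auto)
      then show ?thesis
        unfolding super_skew_def using eq by simp
    qed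
  qed
  then show ?thesis
    by (simp add: cochains_def cochain_like_def nest_def)
qed

lemma flat_nest:
  assumes "mlin (arity m) F" "graded U" "length U = arity m"
  shows "flat m (nest m F) U = F U"
  using fo_list_blocks[of "map fst U" m] concat_blocks[of "map fst U" m] ext_graded[of U F] assms
  by (simp add: flat_def nest_def)

text \<open>
  The terms of the coboundary formula that contain \<open>X \<cdot> X\<^sub>j\<close> or \<open>X \<cdot> z\<close> form a single Lie derivative
  over the concatenated arguments.
\<close>

lemma lder_flat:
  assumes "fo_list l Ys"
  shows "lder (label X) (flat l f) (label (concat Ys @ [y])) =
    (\<Sum>j<l. sgn2 (degs X * (\<Sum>k<j. degs (Ys ! k)))
      (lin_ext (\<lambda>Z. f (Ys[j := Z]) y) (act_fo X (Ys ! j))))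
    + sgn2 (degs X * (\<Sum>k<l. degs (Ys ! k))) (f Ys (act X y))"
  using assms
proof (induction l arbitrary: Ys f)
  case 0
  then show ?case by (simp add: flat_def actl_def act_def)
next
  case (Suc l)
  then obtain Y Zs where Ys: "Ys = Y # Zs" "length Y = n - 1" "fo_list l Zs"
    by (elim fo_list_Suc_cases)
  let ?W = "label (concat Zs @ [y])"
  have W: "?W \<noteq> []" by simp
  have 1: "lder (label X) (\<lambda>U. flat (Suc l) f (U @ ?W)) (label Y)
      = lin_ext (\<lambda>Z. f (Z # Zs) y) (act_fo X Y)"
    unfolding lin_ext_lder
  proof (rule lder_cong)
    fix U :: "('g \<times> bit) list" assume "length U = length (label Y)"
    then have "length U = n - 1" using Ys by simp
    from flat_append[OF this W, of l f]
    show "flat (Suc l) f (U @ ?W) = f (map fst U # Zs) y"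
      unfolding flat_label[OF Ys(3)] .
  qed
  have "lder (label X) (\<lambda>U. flat (Suc l) f (label Y @ U)) ?W
      = lder (label X) (flat l (\<lambda>Zs. f (Y # Zs))) ?W"
  proof (rule lder_cong)
    fix U :: "('g \<times> bit) list" assume "length U = length ?W"
    then have "U \<noteq> []" by auto
    with flat_append[of "label Y" U l f]
    show "flat (Suc l) f (label Y @ U) = flat l (\<lambda>Zs. f (Y # Zs)) U"
      using Ys by simp
  qed
  then have 2: "lder (label X) (\<lambda>U. flat (Suc l) f (label Y @ U)) ?W
      = (\<Sum>j<l. sgn2 (degs X * (\<Sum>k<j. degs (Zs ! k)))
          (lin_ext (\<lambda>Z. f (Y # Zs[j := Z]) y) (act_fo X (Zs ! j))))
        + sgn2 (degs X * (\<Sum>k<l. degs (Zs ! k))) (f (Y # Zs) (act X y))"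
    using Suc.IH[OF Ys(3)] by simp
  have "lder (label X) (flat (Suc l) f) (label Y @ ?W)
      = lin_ext (\<lambda>Z. f (Z # Zs) y) (act_fo X Y) + sgn2 (degs X * degs Y)
          ((\<Sum>j<l. sgn2 (degs X * (\<Sum>k<j. degs (Zs ! k)))
            (lin_ext (\<lambda>Z. f (Y # Zs[j := Z]) y) (act_fo X (Zs ! j))))
          + sgn2 (degs X * (\<Sum>k<l. degs (Zs ! k))) (f (Y # Zs) (act X y)))"
    unfolding lder_append 1 2 by simp
  then show ?case
    using Ys(1)
    by (simp add: sum.lessThan_Suc_shift sgn2_sum sgn2_add sgn2_sgn2 algebra_simps
        del: sum.lessThan_Suc)
qed

section \<open>The coboundary formula as a recursion\<close>

text \<open>
  The summands with index \<open>i = 0\<close> are those in which the first fundamental object acts, and they add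
  up to \<open>\<theta>\<close>.  In all others \<open>X\<close> is only inserted into \<open>f\<close>; the index shift changes their sign, and the
  degree of \<open>X\<close> is added to that of \<open>f\<close>.
\<close>

lemma coboundary_hom_Cons:
  assumes "length X = n - 1" "fo_list (Suc m) Ys"
  shows "coboundary_hom a (Suc m) f (X # Ys) z =
    theta a (label X) (flat (Suc m) f) (label (concat Ys @ [z]))
    - coboundary_hom (a + degs X) m (\<lambda>Zs. f (X # Zs)) Ys z"
proof -
  let ?f = "\<lambda>Zs. f (X # Zs)"
  have theta: "theta a (label X) (flat (Suc m) f) (label (concat Ys @ [z])) =
      sgn2 (degs X * a) (\<rho> X (f Ys z))
      - ((\<Sum>j\<le>m. sgn2 (degs X * (\<Sum>k<j. degs (Ys ! k)))
          (lin_ext (\<lambda>Z. f (Ys[j := Z]) z) (act_fo X (Ys ! j))))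
        + sgn2 (degs X * (\<Sum>k<Suc m. degs (Ys ! k))) (f Ys (act X z)))"
    unfolding theta_def lder_flat[OF assms(2)] flat_label[OF assms(2)] lessThan_Suc_atMost
    by simp
  have S1: "(\<Sum>j\<le>Suc m. \<Sum>i<j.
        sgn2 (of_nat (Suc i) + degs ((X # Ys) ! i) * (\<Sum>k\<in>{i<..<j}. degs ((X # Ys) ! k)))
          (lin_ext (\<lambda>Z. f (omit i ((X # Ys)[j := Z])) z) (act_fo ((X # Ys) ! i) ((X # Ys) ! j))))
      = - (\<Sum>j\<le>m. sgn2 (degs X * (\<Sum>k<j. degs (Ys ! k)))
          (lin_ext (\<lambda>Z. f (Ys[j := Z]) z) (act_fo X (Ys ! j))))
      - (\<Sum>j\<le>m. \<Sum>i<j.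
        sgn2 (of_nat (Suc i) + degs (Ys ! i) * (\<Sum>k\<in>{i<..<j}. degs (Ys ! k)))
          (lin_ext (\<lambda>Z. ?f (omit i (Ys[j := Z])) z) (act_fo (Ys ! i) (Ys ! j))))"
    by (simp add: sum.atMost_Suc_shift sum.lessThan_Suc_shift sum_Suc_Suc_open sum_0_Suc_open
        sum.distrib sum_negf sum_subtractf sgn2_Suc_left add.assoc del: sum.lessThan_Suc sum.atMost_Suc)
  have S2: "(\<Sum>i\<le>Suc m.
        sgn2 (of_nat (Suc i) + degs ((X # Ys) ! i) * (\<Sum>k\<in>{i<..Suc m}. degs ((X # Ys) ! k)))
          (f (omit i (X # Ys)) (act ((X # Ys) ! i) z)))
      = - sgn2 (degs X * (\<Sum>k<Suc m. degs (Ys ! k))) (f Ys (act X z))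
      - (\<Sum>i\<le>m.
        sgn2 (of_nat (Suc i) + degs (Ys ! i) * (\<Sum>k\<in>{i<..m}. degs (Ys ! k)))
          (?f (omit i Ys) (act (Ys ! i) z)))"
    by (simp add: sum.atMost_Suc_shift sum_Suc_Suc_half_open sum_0_Suc_half_open
        sum_negf sgn2_Suc_left add.assoc del: sum.lessThan_Suc sum.atMost_Suc)
  have S3: "(\<Sum>i\<le>Suc m.
        sgn2 (of_nat i + degs ((X # Ys) ! i) * (a + (\<Sum>k<i. degs ((X # Ys) ! k))))
          (\<rho> ((X # Ys) ! i) (f (omit i (X # Ys)) z)))
      = sgn2 (degs X * a) (\<rho> X (f Ys z))
      - (\<Sum>i\<le>m.
        sgn2 (of_nat i + degs (Ys ! i) * ((a + degs X) + (\<Sum>k<i. degs (Ys ! k))))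
          (\<rho> (Ys ! i) (?f (omit i Ys) z)))"
    by (simp add: sum.atMost_Suc_shift sum.lessThan_Suc_shift
        sum_negf sgn2_Suc_left add.assoc del: sum.lessThan_Suc sum.atMost_Suc)
  have S4: "sgn2 (of_nat (Suc m))
       (\<Sum>i<n - 1.
          sgn2 ((a + (\<Sum>k<Suc m. degs ((X # Ys) ! k))) * degs (take i ((X # Ys) ! Suc m)))
            (mixed_br (take i ((X # Ys) ! Suc m)) (f (take (Suc m) (X # Ys)) ((X # Ys) ! Suc m ! i))
              (drop (Suc i) ((X # Ys) ! Suc m) @ [z])))
     = - sgn2 (of_nat m)
       (\<Sum>i<n - 1.
          sgn2 (((a + degs X) + (\<Sum>k<m. degs (Ys ! k))) * degs (take i (Ys ! m)))
            (mixed_br (take i (Ys ! m)) (?f (take m Ys) (Ys ! m ! i))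
              (drop (Suc i) (Ys ! m) @ [z])))"
    by (simp add: sum.lessThan_Suc_shift sgn2_Suc_left add.assoc del: sum.lessThan_Suc)
  show ?thesis
    unfolding coboundary_hom_def theta S1 S2 S3 S4 by simp
qed

lemma mixed_br_rho:
  "mixed_br ys v zs = sgn2 (V.deg v * degs zs + of_nat (length zs)) (\<rho> (ys @ zs) v)"
  by (induction zs arbitrary: ys) (simp_all add: sgn2_simps)

text \<open>
  The last sum of the formula and the action of \<open>X\<close> on the value at \<open>z\<close> are the substitutions of \<open>f\<close>
  at the entries of \<open>X\<close> and at \<open>z\<close>.  The degree of \<open>f\<close> has to be known here because \<open>mixed_br\<close> takes
  its signs from the values of \<open>f\<close>.
\<close>

lemma coboundary_hom_0:
  assumes X: "length X = n - 1"
    and f: "\<And>i. i < n - 1 \<Longrightarrow> f [] (X ! i) \<in> V (a + deg (X ! i))"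
  shows "coboundary_hom a 0 f [X] z = cob 0 a (flat 0 f) (label (X @ [z]))"
proof -
  let ?W = "label (X @ [z])"
  have "plug a (\<lambda>w. flat 0 f [w]) (\<lambda>U. \<rho> (map fst U)) ?W = (\<Sum>i<Suc (n - 1).
     sgn2 (a * degs (take i (X @ [z])) + (a + deg ((X @ [z]) ! i)) * degs (drop (Suc i) (X @ [z]))
         + of_nat (Suc (n - 1) - Suc i))
       (\<rho> (omit i (X @ [z])) (f [] ((X @ [z]) ! i))))"
    unfolding plug_index
    by (rule sum.cong)
      (use X in \<open>simp_all add: map_fst_omit flat_def del: label_simps(3) degs_simps take_append drop_append\<close>)
  also have "\<dots> = (\<Sum>i<n - 1.
      sgn2 (a * degs (take i X)) (mixed_br (take i X) (f [] (X ! i)) (drop (Suc i) X @ [z])))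
      + sgn2 (a * degs X) (\<rho> X (f [] z))"
    unfolding sum.lessThan_Suc
  proof (intro arg_cong2[of _ _ _ _ "(+)"] sum.cong refl)
    fix i assume "i \<in> {..<n - 1}"
    then have i: "i < n - 1" "i < length X" using X by auto
    let ?v = "f [] (X ! i)"
    \<comment> \<open>If the value is 0 then its degree is 0 by convention, but no sign matters.\<close>
    have "?v = 0 \<or> V.deg ?v = a + deg (X ! i)"
      using f[OF i(1)] V.deg_unique by blast
    moreover have "\<rho> (take i X @ drop (Suc i) X @ [z]) 0 = 0"
      by (rule rho_zero) (use i X in simp)
    moreover have "n - 1 - i = Suc (n - 1 - Suc i)" using i by simp
    ultimately show "sgn2 (a * degs (take i (X @ [z]))
          + (a + deg ((X @ [z]) ! i)) * degs (drop (Suc i) (X @ [z])) + of_nat (Suc (n - 1) - Suc i))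
        (\<rho> (omit i (X @ [z])) (f [] ((X @ [z]) ! i)))
      = sgn2 (a * degs (take i X)) (mixed_br (take i X) ?v (drop (Suc i) X @ [z]))"
      using i X by (auto simp: mixed_br_rho omit_def nth_append sgn2_simps)
  next
    show "sgn2 (a * degs (take (n - 1) (X @ [z]))
          + (a + deg ((X @ [z]) ! (n - 1))) * degs (drop (Suc (n - 1)) (X @ [z]))
          + of_nat (Suc (n - 1) - Suc (n - 1)))
        (\<rho> (omit (n - 1) (X @ [z])) (f [] ((X @ [z]) ! (n - 1))))
      = sgn2 (a * degs X) (\<rho> X (f [] z))"
      unfolding X[symmetric] by (simp add: omit_def)
  qed
  finally show ?thesis
    using X by (simp add: coboundary_hom_def cob.simps flat_def act_def mult.commute)
qed

lemma coboundary_hom_cob: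
  assumes "fo_list (Suc m) Xs" "list_all homogeneous (concat Xs)" "homogeneous z"
    and "\<And>U. graded U \<Longrightarrow> length U = arity m \<Longrightarrow> flat m f U \<in> V (a + wt U)"
  shows "coboundary_hom a m f Xs z = cob m a (flat m f) (label (concat Xs @ [z]))"
  using assms
proof (induction m arbitrary: a f Xs)
  case 0
  then obtain X where Xs: "Xs = [X]" "length X = n - 1"
    by (auto elim!: fo_list_Suc_cases)
  have "coboundary_hom a 0 f [X] z = cob 0 a (flat 0 f) (label (X @ [z]))"
  proof (rule coboundary_hom_0[OF Xs(2)])
    fix i assume "i < n - 1"
    then have "X ! i \<in> G (deg (X ! i))"
      using 0 Xs by (auto simp: list_all_length homogeneous_deg)
    then show "f [] (X ! i) \<in> V (a + deg (X ! i))"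
      using 0(4)[of "[(X ! i, deg (X ! i))]"] by (simp add: flat_def)
  qed
  then show ?case using Xs by simp
next
  case (Suc m)
  from Suc.prems(1) obtain X Ys where Xs: "Xs = X # Ys" and X: "length X = n - 1"
    and Ys: "fo_list (Suc m) Ys"
    by (rule fo_list_Suc_cases)
  have hom: "graded (label X)" "graded (label (concat Ys @ [z]))"
    using Suc.prems Xs by (simp_all add: homogeneous_deg)
  have lX: "length (label X) = n - 1" using X by simp
  have lW: "length (label (concat Ys @ [z])) = arity (Suc m)"
    using length_concat_fo_list[OF Ys] by simp
  have flat_Cons: "flat (Suc m) f (label X @ U) = flat m (\<lambda>Zs. f (X # Zs)) U"
    if "length U = arity m" for U
  proof -
    have "U \<noteq> []" using that by auto
    then show ?thesis using flat_append[OF lX, of U m f] by simp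
  qed
  have "coboundary_hom (a + degs X) m (\<lambda>Zs. f (X # Zs)) Ys z
      = cob m (a + degs X) (flat m (\<lambda>Zs. f (X # Zs))) (label (concat Ys @ [z]))"
  proof (rule Suc.IH)
    fix U assume U: "graded U" "length U = arity m"
    then show "flat m (\<lambda>Zs. f (X # Zs)) U \<in> V (a + degs X + wt U)"
      using Suc.prems(4)[of "label X @ U"] flat_Cons[of U] hom(1) lX by (simp add: add.assoc)
  qed (use Suc.prems Xs Ys in auto)
  also have "\<dots> = cob m (a + degs X) (\<lambda>U. flat (Suc m) f (label X @ U)) (label (concat Ys @ [z]))"
    by (rule cob_cong[OF hom(2) lW]) (simp add: flat_Cons)
  finally show ?case
    unfolding Xs coboundary_hom_Cons[OF X Ys] concat.simps append_assoc label_simps(3)[of X]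
      cob_append[OF lX] by simp
qed

section \<open>Homogeneous components of cochains\<close>

definition homog :: "bit \<Rightarrow> (('g \<times> bit) list \<Rightarrow> 'v) \<Rightarrow> ('g \<times> bit) list \<Rightarrow> 'v" where
  "homog a F W = V.part (a + wt W) (F W)"

lemma mlin_homog: "mlin N F \<Longrightarrow> mlin N (homog a F)"
  by (simp add: mlin_def hlin_def homog_def V.part_add V.part_scale)

lemma skew_homog:
  assumes "skew_at N P F"
  shows "skew_at N P (homog a F)"
  unfolding skew_at_def
proof (intro allI impI)
  fix A x y and B :: "('g \<times> bit) list"
  assume "Suc (Suc (length A + length B)) = N" "P (length A)" "graded (A @ x # y # B)"
  then have "F (A @ x # y # B) = - sgn2 (snd x * snd y) (F (A @ y # x # B))"
    by (intro skew_atD[OF assms]) auto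
  moreover have "wt (A @ x # y # B) = wt (A @ y # x # B)"
    by (simp add: add_ac)
  ultimately show "homog a F (A @ x # y # B) = - sgn2 (snd x * snd y) (homog a F (A @ y # x # B))"
    unfolding homog_def by (simp only: V.part_minus V.part_sgn2)
qed

lemma fo_list_comps3:
  assumes "Ys \<in> set (comps3 Xs)" "fo_list m Xs"
  shows "fo_list m Ys"
proof -
  have "map length Ys = map length Xs"
    using comps3_homogeneous assms by blast
  then have "length Ys = length Xs" "length ` set Ys = length ` set Xs"
    by (metis length_map, metis list.set_map)
  then show ?thesis
    using assms(2) unfolding fo_list_def
    by (metis imageE image_eqI)
qed

lemma comps3_sum_ext:
  assumes Xs: "fo_list m Xs"
    and F: "mlin (arity m) F"
    and h: "\<And>Ys y. fo_list m Ys \<Longrightarrow> list_all homogeneous (concat Ys) \<Longrightarrow> homogeneous y \<Longrightarrow>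
      h Ys y = F (label (concat Ys @ [y]))"
  shows "(\<Sum>Ys\<leftarrow>comps3 Xs. \<Sum>y\<leftarrow>comps1 z. h Ys y) = nest m F Xs z"
proof -
  have "(\<Sum>Ys\<leftarrow>comps3 Xs. \<Sum>y\<leftarrow>comps1 z. h Ys y)
      = (\<Sum>Ys\<leftarrow>comps3 Xs. \<Sum>y\<leftarrow>comps1 z. F (label (concat Ys @ [y])))"
  proof (intro arg_cong[of _ _ sum_list] map_cong refl)
    fix Ys y assume "Ys \<in> set (comps3 Xs)" "y \<in> set (comps1 z)"
    then show "h Ys y = F (label (concat Ys @ [y]))"
      using h fo_list_comps3 Xs comps3_homogeneous(1) homogeneous_part
      by (auto simp: comps1_def)
  qed
  also have "\<dots> = (\<Sum>ys\<leftarrow>comps2 (concat Xs @ [z]). F (label ys))"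
    by (rule comps3_comps1)
  also have "\<dots> = ext F (concat Xs @ [z])"
    by (rule sum_comps2_ext, rule mlin_relabel)
      (use F length_concat_fo_list[OF Xs] in auto)
  finally show ?thesis
    using Xs by (simp add: nest_def)
qed

text \<open>
  The component of degree \<open>a\<close> of a cochain takes homogeneous entries of total degree \<open>b\<close> to the
  component of degree \<open>a + b\<close> of the value; on concatenated arguments this is \<open>homog a\<close>.
\<close>

lemma cochain_part_nest:
  assumes F: "mlin (arity m) (flat m f)" and Xs: "fo_list m Xs"
  shows "cochain_part a f Xs z = nest m (homog a (flat m f)) Xs z"
  unfolding cochain_part_def
proof (rule comps3_sum_ext[OF Xs mlin_homog[OF F]])
  fix Ys y assume "fo_list m Ys"
  then show "V.part (a + (\<Sum>Y\<leftarrow>Ys. degs Y) + deg y) (f Ys y)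
      = homog a (flat m f) (label (concat Ys @ [y]))"
    unfolding homog_def flat_label[OF \<open>fo_list m Ys\<close>] by (simp add: degs_concat add.assoc)
qed

lemma flat_cochain_part:
  assumes F: "mlin (arity m) (flat m f)" and U: "graded U" "length U = arity m"
  shows "flat m (cochain_part a f) U = homog a (flat m f) U"
proof -
  have "flat m (cochain_part a f) U = flat m (nest m (homog a (flat m f))) U"
    unfolding flat_def
    by (rule cochain_part_nest[OF F, unfolded flat_def]) (use U in \<open>auto intro: fo_list_blocks\<close>)
  also have "\<dots> = homog a (flat m f) U"
    by (rule flat_nest[OF mlin_homog[OF F] U])
  finally show ?thesis .
qed

text \<open>
  The definition of the coboundary as a multilinear extension is compared with \<open>cob\<close> on homogeneous
  entries only.
\<close>

lemma coboundary_nest: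
  assumes F: "mlin (arity m) (flat m f)"
  shows "coboundary m f =
    nest (Suc m) (\<lambda>W. cob m 0 (homog 0 (flat m f)) W + cob m 1 (homog 1 (flat m f)) W)"
proof (intro ext)
  fix Xs z
  let ?F = "\<lambda>a. homog a (flat m f)"
  show "coboundary m f Xs z = nest (Suc m) (\<lambda>W. cob m 0 (?F 0) W + cob m 1 (?F 1) W) Xs z"
  proof (cases "fo_list (Suc m) Xs")
    case True
    have "(\<Sum>Ys\<leftarrow>comps3 Xs. \<Sum>y\<leftarrow>comps1 z. coboundary_hom a m (cochain_part a f) Ys y)
        = nest (Suc m) (cob m a (?F a)) Xs z" for a
    proof (rule comps3_sum_ext[OF True mlin_cob[OF mlin_homog[OF F]]])
      fix Ys y
      assume Ys: "fo_list (Suc m) Ys" "list_all homogeneous (concat Ys)" "homogeneous y"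
      have "coboundary_hom a m (cochain_part a f) Ys y
          = cob m a (flat m (cochain_part a f)) (label (concat Ys @ [y]))"
        by (rule coboundary_hom_cob[OF Ys])
          (simp add: flat_cochain_part[OF F] homog_def V.part_split)
      also have "\<dots> = cob m a (?F a) (label (concat Ys @ [y]))"
        by (rule cob_cong)
          (use Ys length_concat_fo_list[OF Ys(1)] flat_cochain_part[OF F] in \<open>auto simp: homogeneous_deg\<close>)
      finally show "coboundary_hom a m (cochain_part a f) Ys y
          = cob m a (?F a) (label (concat Ys @ [y]))" .
    qed
    then show ?thesis
      using True by (simp add: coboundary_def nest_def ext_add)
  qed (simp add: coboundary_def nest_def)
qed

section \<open>The coboundary squares to zero\<close>

theorem coboundary_cochain:
  assumes f: "f \<in> cochains m"
  shows "coboundary m f \<in> cochains (Suc m)" "coboundary (Suc m) (coboundary m f) = (\<lambda>Xs z. 0)"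
proof -
  let ?F = "\<lambda>a. homog a (flat m f)"
  define D where "D = (\<lambda>W. cob m 0 (?F 0) W + cob m 1 (?F 1) W)"
  have cl: "cochain_like m f"
    using f by (simp add: cochains_def cochain_like_def)
  have F: "mlin (arity m) (flat m f)" "skew_at (arity m) (same_block m) (flat m f)"
    using mlin_flat[OF cl] skew_flat[OF cl] .
  have mD: "mlin (arity (Suc m)) (cob m a (?F a))" for a
    by (rule mlin_cob[OF mlin_homog[OF F(1)]])
  have sD: "skew_at (arity (Suc m)) (same_block (Suc m)) (cob m a (?F a))" for a
    by (rule skew_cob[OF mlin_homog[OF F(1)] skew_homog[OF F(2)]])
  have D1: "mlin (arity (Suc m)) D"
    using mD[of 0] mD[of 1] unfolding mlin_def D_def by (simp add: hlin_add)
  have D2: "skew_at (arity (Suc m)) (same_block (Suc m)) D"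
    unfolding skew_at_def
  proof (intro allI impI)
    fix A x y and B :: "('g \<times> bit) list"
    assume *: "Suc (Suc (length A + length B)) = arity (Suc m)" "same_block (Suc m) (length A)"
      "graded (A @ x # y # B)"
    have "cob m a (?F a) (A @ x # y # B) = - sgn2 (snd x * snd y) (cob m a (?F a) (A @ y # x # B))"
      for a
      by (rule skew_atD[OF sD *(1,2)]) (use *(3) in auto)
    then show "D (A @ x # y # B) = - sgn2 (snd x * snd y) (D (A @ y # x # B))"
      unfolding D_def by (simp add: sgn2_add)
  qed
  have df: "coboundary m f = nest (Suc m) D"
    unfolding D_def by (rule coboundary_nest[OF F(1)])
  show "coboundary m f \<in> cochains (Suc m)"
    unfolding df by (rule nest_cochain[OF D1 D2])
  have clD: "cochain_like (Suc m) (nest (Suc m) D)"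
    using nest_cochain[OF D1 D2] by (simp add: cochains_def cochain_like_def)
  let ?H = "\<lambda>a. homog a (flat (Suc m) (nest (Suc m) D))"
  \<comment> \<open>Taking components commutes with the coboundary, because \<open>cob\<close> preserves degrees.\<close>
  have H: "?H a U = cob m a (?F a) U" if U: "graded U" "length U = arity (Suc m)" for a U
  proof -
    have deg: "cob m b (?F b) U \<in> V (b + wt U)" for b
      by (rule cob_degree) (use U in \<open>auto simp: homog_def V.part_split\<close>)
    have "?H a U = V.part (a + wt U) (cob m 0 (?F 0) U) + V.part (a + wt U) (cob m 1 (?F 1) U)"
      unfolding homog_def[of a "flat (Suc m) _"] flat_nest[OF D1 U] by (simp add: D_def V.part_add)
    moreover have "V.part (a + wt U) (cob m a (?F a) U) = cob m a (?F a) U"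
      by (rule V.part_same[OF deg])
    moreover have "V.part (a + wt U) (cob m (a + 1) (?F (a + 1)) U) = 0"
      by (rule V.part_other[OF deg]) (cases a; cases "wt U"; simp)
    ultimately show ?thesis by (cases a) simp_all
  qed
  have "ext (\<lambda>W. cob (Suc m) 0 (?H 0) W + cob (Suc m) 1 (?H 1) W) (concat Xs @ [z]) = ext (\<lambda>W. 0) (concat Xs @ [z])"
    if Xs: "fo_list (Suc (Suc m)) Xs" for Xs z
  proof (rule ext_cong)
    fix W assume "graded W" "length W = length (concat Xs @ [z])"
    then have W: "graded W" "length W = arity (Suc (Suc m))"
      using length_concat_fo_list[OF Xs] by simp_all
    have "cob (Suc m) a (?H a) W = cob (Suc m) a (cob m a (?F a)) W" for a
      by (rule cob_cong[OF W]) (rule H)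
    then show "cob (Suc m) 0 (?H 0) W + cob (Suc m) 1 (?H 1) W = 0"
      using cob_cob[OF W mlin_homog[OF F(1)]] by simp
  qed
  then have "nest (Suc (Suc m)) (\<lambda>W. cob (Suc m) 0 (?H 0) W + cob (Suc m) 1 (?H 1) W) = (\<lambda>Xs z. 0)"
    by (intro ext) (simp add: nest_def)
  then show "coboundary (Suc m) (coboundary m f) = (\<lambda>Xs z. 0)"
    unfolding df coboundary_nest[OF mlin_flat[OF clD]] .
qed

end

theorem theorem2p7:
  fixes sg :: "'k::field \<Rightarrow> 'g::ab_group_add \<Rightarrow> 'g" and G :: "bit \<Rightarrow> 'g set"
    and n :: nat and br :: "'g list \<Rightarrow> 'g"
    and sv :: "'k \<Rightarrow> 'v::ab_group_add \<Rightarrow> 'v" and V :: "bit \<Rightarrow> 'v set"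
    and \<rho> :: "'g list \<Rightarrow> 'v \<Rightarrow> 'v"
    and m :: nat and f :: "'g list list \<Rightarrow> 'g \<Rightarrow> 'v"
  assumes "2 \<le> n"
    and "n_Lie_superalgebra sg G n br"
    and "graded_module sg G n br sv V \<rho>"
    and "f \<in> graded_module.cochains sg G n sv m"
  shows "graded_module.coboundary G n br V \<rho> m f
           \<in> graded_module.cochains sg G n sv (Suc m) \<and>
         graded_module.coboundary G n br V \<rho> (Suc m)
           (graded_module.coboundary G n br V \<rho> m f) = (\<lambda>Xs z. 0)"
proof -
  interpret graded_module sg G n br sv V \<rho>
    by (rule assms(3))
  interpret graded_module_ge2 sg G n br sv V \<rho>
    by standard (rule assms(1))
  show ?thesis
    using coboundary_cochain[OF assms(4)] by blast
qed

end
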